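(* Let $S$ and $T$ be countable, strongly Morita equivalent inverse semigroups without zero, and suppose both are weak semilattices. Then their respective reduced $L^p$-operator algebras $F^p_{\mathrm{red}}(S)$ and $F^p_{\mathrm{red}}(T)$ are Morita equivalent for $p\in[1,\infty)$.
   Context: **Inverse semigroups.** An inverse semigroup $S$ has the natural partial order $s\le t\iff s=te$ for some idempotent $e$. $S$ is a weak semilattice if for all $s,t\in S$ the set $\{u\in S:u\le s,\ u\le t\}$ is finitely generated as an order ideal (a finite, possibly empty, union of principal order ideals). $S$ and $T$ are strongly Morita equivalent if there are a set $X$ with a left action of $S$ and a right action of $T$, and surjective maps $\langle\cdot,\cdot\rangle:X\times X\to S$ and $[\cdot,\cdot]:X\times X\to T$ such that for all $x,y,z\in X$, $s\in S$, $t\in T$: $\langle sx,y\rangle=s\langle x,y\rangle$; $\langle y,x\rangle=\langle x,y\rangle^*$; $\langle x,x\rangle x=x$; $[x,yt]=[x,y]t$; $[y,x]=[x,y]^*$; $x[x,x]=x$; $\langle x,y\rangle z=x[y,z]$. **Reduced $L^p$-operator algebra.** The left regular representation $\lambda$ of $S$ on $\ell^p(S)$ is $\lambda(s)\delta_t=\delta_{st}$ if $tt^*\le s^*s$ and $\lambda(s)\delta_t=0$ otherwise. Extending linearly to the semigroup algebra $\mathbb CS$, $F^p_{\mathrm{red}}(S)$ is the operator-norm closure of $\lambda(\mathbb CS)$ in $B(\ell^p(S))$. **Morita equivalence.** A Banach $B$-pair $(\mathsf X,\mathsf Y)$ is a left Banach $B$-module $\mathsf X$ and a right Banach $B$-module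 $\mathsf Y$ (contractive actions) with a bilinear pairing $\langle\cdot,\cdot\rangle_B:\mathsf X\times\mathsf Y\to B$, left $B$-linear in $\mathsf X$, right $B$-linear in $\mathsf Y$, $\|\langle x,y\rangle\|\le\|x\|\|y\|$; it is nondegenerate if $\mathrm{span}(B\mathsf X)$ is dense in $\mathsf X$ and $\mathrm{span}(\mathsf YB)$ is dense in $\mathsf Y$, and full if $\mathrm{span}\langle\mathsf X,\mathsf Y\rangle$ is dense in $B$. $\mathcal L_B(\mathsf X,\mathsf Y)$ is the Banach algebra of pairs $T=(T^l,T^r)$ of bounded $B$-module maps $T^l:\mathsf X\to\mathsf X$, $T^r:\mathsf Y\to\mathsf Y$ with $\langle T^lx,y\rangle=\langle x,T^ry\rangle$, norm $\max(\|T^l\|,\|T^r\|)$, product $TS=(S^lT^l,T^rS^r)$. A Banach $(A,B)$-correspondence is a Banach $B$-pair with a contractive homomorphism $A\to\mathcal L_B(\mathsf X,\mathsf Y)$, giving actions $x\cdot a$ and $a\cdot y$. Banach algebras $A,B$ are Morita equivalent if there are bimodules ${}_B\mathsf X_A$, ${}_A\mathsf Y_B$ and bilinear pairings $\langle\cdot,\cdot\rangle_B:\mathsf X\times\mathsf Y\to B$, ${}_A\langle\cdot,\cdot\rangle:\mathsf Y\times\mathsf X\to A$ such that $(\mathsf X,\mathsf Y)$ is a Banach $(A,B)$-correspondence, full and nondegenerate as a Banach $B$-pair; $(\mathsf Y,\mathsf X)$ is a Banach $(B,A)$-correspondence, full and nondegenerate as a Banach $A$-pair; and $\langle x_1,y\rangle_Bx_2=x_1\,{}_A\langle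 y,x_2\rangle$, $y_1\langle x,y_2\rangle_B={}_A\langle y_1,x\rangle y_2$. *)

theory Defs
  imports "HOL-Analysis.Analysis" "HOL-Algebra.Module"
begin

section \<open>Inverse semigroups\<close>

class inverse_semigroup = semigroup_mult +
  assumes ex1_generalized_inverse: "\<exists>!t. s * t * s = s \<and> t * s * t = t"

definition star :: "'s::inverse_semigroup \<Rightarrow> 's"  (\<open>(_\<^sup>\<star>)\<close> [1000] 999) where
  "s\<^sup>\<star> = (THE t. s * t * s = s \<and> t * s * t = t)"

lemma star_props: "s * s\<^sup>\<star> * s = s" "s\<^sup>\<star> * s * s\<^sup>\<star> = s\<^sup>\<star>"
  using theI'[OF ex1_generalized_inverse[of s]] unfolding star_def by auto

definition natural_le :: "'s::inverse_semigroup \<Rightarrow> 's \<Rightarrow> bool"  (infix \<open>\<preceq>\<close> 50) where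
  "s \<preceq> t \<longleftrightarrow> (\<exists>e. e * e = e \<and> s = t * e)"

definition weak_semilattice :: "'s::inverse_semigroup itself \<Rightarrow> bool" where
  "weak_semilattice _ \<longleftrightarrow>
     (\<forall>s t :: 's. \<exists>F. finite F \<and> {u. u \<preceq> s \<and> u \<preceq> t} = (\<Union>v\<in>F. {u. u \<preceq> v}))"

definition has_zero :: "'s::inverse_semigroup itself \<Rightarrow> bool" where
  "has_zero _ \<longleftrightarrow> (\<exists>z::'s. \<forall>s. z * s = z \<and> s * z = z)"

definition morita_biset ::
  "'x set \<Rightarrow> ('s::inverse_semigroup \<Rightarrow> 'x \<Rightarrow> 'x) \<Rightarrow> ('x \<Rightarrow> 't::inverse_semigroup \<Rightarrow> 'x) \<Rightarrow>
   ('x \<Rightarrow> 'x \<Rightarrow> 's) \<Rightarrow> ('x \<Rightarrow> 'x \<Rightarrow> 't) \<Rightarrow> bool" where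
  "morita_biset X la ra ips ipt \<longleftrightarrow>
     (\<forall>s. \<forall>x\<in>X. la s x \<in> X) \<and> (\<forall>s s'. \<forall>x\<in>X. la (s * s') x = la s (la s' x)) \<and>
     (\<forall>t. \<forall>x\<in>X. ra x t \<in> X) \<and> (\<forall>t t'. \<forall>x\<in>X. ra x (t * t') = ra (ra x t) t') \<and>
     (\<lambda>(x, y). ips x y) ` (X \<times> X) = UNIV \<and>
     (\<lambda>(x, y). ipt x y) ` (X \<times> X) = UNIV \<and>
     (\<forall>s. \<forall>x\<in>X. \<forall>y\<in>X. ips (la s x) y = s * ips x y) \<and>
     (\<forall>x\<in>X. \<forall>y\<in>X. ips y x = (ips x y)\<^sup>\<star>) \<and>
     (\<forall>x\<in>X. la (ips x x) x = x) \<and>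
     (\<forall>t. \<forall>x\<in>X. \<forall>y\<in>X. ipt x (ra y t) = ipt x y * t) \<and>
     (\<forall>x\<in>X. \<forall>y\<in>X. ipt y x = (ipt x y)\<^sup>\<star>) \<and>
     (\<forall>x\<in>X. ra x (ipt x x) = x) \<and>
     (\<forall>x\<in>X. \<forall>y\<in>X. \<forall>z\<in>X. la (ips x y) z = ra x (ipt y z))"

text \<open>HOL cannot quantify over types inside a formula, so the type \<open>'x\<close> in which the set
  \<open>X\<close> lives is an explicit argument.  Used as a hypothesis with \<open>'x\<close> a free type
  variable, this is the existence of a biset over an arbitrary set.\<close>

definition strongly_morita_equivalent ::
  "'x itself \<Rightarrow> 's::inverse_semigroup itself \<Rightarrow> 't::inverse_semigroup itself \<Rightarrow> bool" where
  "strongly_morita_equivalent _ _ _ \<longleftrightarrow>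
     (\<exists>(X :: 'x set) (la :: 's \<Rightarrow> 'x \<Rightarrow> 'x) (ra :: 'x \<Rightarrow> 't \<Rightarrow> 'x) ips ipt.
        morita_biset X la ra ips ipt)"


section \<open>Banach spaces and Banach algebras on explicit carriers\<close>

text \<open>The spaces \<open>\<ell>\<^sup>p(S)\<close>, with \<open>p\<close> a variable, and the closed
  algebras of operators on them are subsets of function types, so normed spaces are records with a
  carrier.  The record fields \<open>one\<close>, and for mere Banach spaces also \<open>mult\<close>, are ignored;
  a Banach algebra need not have a unit.\<close>

definition complex_ring :: "complex ring" where
  "complex_ring = \<lparr>carrier = UNIV, mult = (*), one = 1, zero = 0, add = (+)\<rparr>"

lemma cring_complex_ring: "cring complex_ring"
proof (rule cringI)
  show "abelian_group complex_ring"
  proof (rule abelian_groupI)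
    fix x :: complex
    have "- x + x = 0" by simp
    then show "\<exists>y\<in>carrier complex_ring. y \<oplus>\<^bsub>complex_ring\<^esub> x = \<zero>\<^bsub>complex_ring\<^esub>"
      by (auto simp: complex_ring_def intro!: exI[of _ "- x"])
  qed (auto simp: complex_ring_def)
  show "comm_monoid complex_ring"
    by (rule comm_monoidI) (auto simp: complex_ring_def)
qed (auto simp: complex_ring_def algebra_simps)

record 'a cnormed = "(complex, 'a) module" +
  nrm :: "'a \<Rightarrow> real"

text \<open>\<open>Metric_space\<close> demands symmetry and nonnegativity of the distance also off the
  carrier, hence the case distinction.\<close>

definition ndist :: "'a cnormed \<Rightarrow> 'a \<Rightarrow> 'a \<Rightarrow> real" where
  "ndist V x y = (if x \<in> carrier V \<and> y \<in> carrier V then nrm V (x \<ominus>\<^bsub>V\<^esub> y) else 0)"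

definition ntopology :: "'a cnormed \<Rightarrow> 'a topology" where
  "ntopology V = Metric_space.mtopology (carrier V) (ndist V)"

locale normed_space = Module.module complex_ring V for V :: "'a cnormed" (structure) +
  assumes nrm_nonneg: "x \<in> carrier V \<Longrightarrow> 0 \<le> nrm V x"
    and nrm_eq_0_iff: "x \<in> carrier V \<Longrightarrow> nrm V x = 0 \<longleftrightarrow> x = \<zero>"
    and nrm_smult: "x \<in> carrier V \<Longrightarrow> nrm V (c \<odot> x) = cmod c * nrm V x"
    and nrm_triangle: "\<lbrakk>x \<in> carrier V; y \<in> carrier V\<rbrakk> \<Longrightarrow> nrm V (x \<oplus> y) \<le> nrm V x + nrm V y"

lemma (in normed_space) Metric_space_ndist: "Metric_space (carrier V) (ndist V)"
proof
  have closed: "x \<ominus> y \<in> carrier V" if "x \<in> carrier V" "y \<in> carrier V" for x y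
    using that by (simp add: M.minus_closed)
  have neg: "\<ominus> x = (- 1) \<odot> x" if x: "x \<in> carrier V" for x
  proof -
    have m1: "\<ominus>\<^bsub>complex_ring\<^esub> \<one>\<^bsub>complex_ring\<^esub> = - 1"
      by (rule R.minus_equality) (auto simp: complex_ring_def)
    show ?thesis
      using smult_l_minus[of "\<one>\<^bsub>complex_ring\<^esub>" x] x smult_one[OF x]
      unfolding m1 by simp
  qed
  show "0 \<le> ndist V x y" for x y
    by (auto simp: ndist_def intro: nrm_nonneg closed)
  show "ndist V x y = ndist V y x" for x y
  proof (cases "x \<in> carrier V \<and> y \<in> carrier V")
    case True
    then have "y \<ominus> x = \<ominus> (x \<ominus> y)"
      by (simp add: a_minus_def M.minus_add M.a_comm)
    also have "\<dots> = (- 1) \<odot> (x \<ominus> y)"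
      using True closed neg by blast
    finally show ?thesis
      using True by (simp add: ndist_def nrm_smult closed)
  qed (auto simp: ndist_def)
  show "ndist V x y = 0 \<longleftrightarrow> x = y" if "x \<in> carrier V" "y \<in> carrier V" for x y
  proof -
    have "x \<ominus> y = \<zero> \<longleftrightarrow> x = y"
      using that by (metis a_minus_def M.a_inv_closed M.minus_equality M.minus_minus M.r_neg)
    then show ?thesis
      using that by (simp add: ndist_def nrm_eq_0_iff closed)
  qed
  show "ndist V x z \<le> ndist V x y + ndist V y z"
    if xyz: "x \<in> carrier V" "y \<in> carrier V" "z \<in> carrier V" for x y z
  proof -
    have "(x \<ominus> y) \<oplus> (y \<ominus> z) = x \<oplus> ((\<ominus> y \<oplus> y) \<oplus> \<ominus> z)"
      using xyz unfolding a_minus_def by (simp only: M.a_assoc M.a_closed M.a_inv_closed)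
    also have "\<dots> = x \<ominus> z"
      using xyz by (simp only: a_minus_def M.l_neg M.l_zero M.a_inv_closed)
    finally have "x \<ominus> z = (x \<ominus> y) \<oplus> (y \<ominus> z)" ..
    then show ?thesis
      using xyz nrm_triangle[OF closed closed, of x y y z] by (simp add: ndist_def)
  qed
qed

locale banach_space = normed_space +
  assumes complete: "Metric_space.mcomplete (carrier V) (ndist V)"

definition linear_map :: "'a cnormed \<Rightarrow> 'b cnormed \<Rightarrow> ('a \<Rightarrow> 'b) \<Rightarrow> bool" where
  "linear_map V W T \<longleftrightarrow>
     (\<forall>x\<in>carrier V. T x \<in> carrier W) \<and>
     (\<forall>x\<in>carrier V. \<forall>y\<in>carrier V. T (x \<oplus>\<^bsub>V\<^esub> y) = T x \<oplus>\<^bsub>W\<^esub> T y) \<and>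
     (\<forall>c. \<forall>x\<in>carrier V. T (c \<odot>\<^bsub>V\<^esub> x) = c \<odot>\<^bsub>W\<^esub> T x)"

definition bounded_linear_map :: "'a cnormed \<Rightarrow> 'b cnormed \<Rightarrow> ('a \<Rightarrow> 'b) \<Rightarrow> bool" where
  "bounded_linear_map V W T \<longleftrightarrow>
     linear_map V W T \<and> (\<exists>c. \<forall>x\<in>carrier V. nrm W (T x) \<le> c * nrm V x)"

definition operator_norm :: "'a cnormed \<Rightarrow> 'b cnormed \<Rightarrow> ('a \<Rightarrow> 'b) \<Rightarrow> real" where
  "operator_norm V W T = Inf {c. 0 \<le> c \<and> (\<forall>x\<in>carrier V. nrm W (T x) \<le> c * nrm V x)}"

definition contractive_bilinear ::
  "'a cnormed \<Rightarrow> 'b cnormed \<Rightarrow> 'c cnormed \<Rightarrow> ('a \<Rightarrow> 'b \<Rightarrow> 'c) \<Rightarrow> bool" where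
  "contractive_bilinear V W Z f \<longleftrightarrow>
     (\<forall>x\<in>carrier V. linear_map W Z (\<lambda>y. f x y)) \<and>
     (\<forall>y\<in>carrier W. linear_map V Z (\<lambda>x. f x y)) \<and>
     (\<forall>x\<in>carrier V. \<forall>y\<in>carrier W. nrm Z (f x y) \<le> nrm V x * nrm W y)"

locale banach_algebra = banach_space A for A :: "'a cnormed" (structure) +
  assumes mult_bilinear: "contractive_bilinear A A A (\<lambda>a b. a \<otimes> b)"
    and mult_assoc: "\<lbrakk>a \<in> carrier A; b \<in> carrier A; c \<in> carrier A\<rbrakk>
      \<Longrightarrow> (a \<otimes> b) \<otimes> c = a \<otimes> (b \<otimes> c)"

text \<open>Operators are extensional, i.e. undefined off the carrier, so that equality of operators
  is equality of HOL functions.\<close>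

definition bounded_operators :: "'a cnormed \<Rightarrow> ('a \<Rightarrow> 'a) cnormed" where
  "bounded_operators V =
     \<lparr>carrier = {T. T \<in> extensional (carrier V) \<and> bounded_linear_map V V T},
      mult = (\<lambda>T S. \<lambda>x\<in>carrier V. T (S x)),
      one = (\<lambda>x\<in>carrier V. x),
      zero = (\<lambda>x\<in>carrier V. \<zero>\<^bsub>V\<^esub>),
      add = (\<lambda>T S. \<lambda>x\<in>carrier V. T x \<oplus>\<^bsub>V\<^esub> S x),
      smult = (\<lambda>c T. \<lambda>x\<in>carrier V. c \<odot>\<^bsub>V\<^esub> T x),
      nrm = operator_norm V V\<rparr>"

definition linear_span :: "'a cnormed \<Rightarrow> 'a set \<Rightarrow> 'a set" where
  "linear_span V E = (\<lambda>H. submodule H complex_ring V) hull E"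

definition dense_span :: "'a cnormed \<Rightarrow> 'a set \<Rightarrow> bool" where
  "dense_span V E \<longleftrightarrow> ntopology V closure_of linear_span V E = carrier V"


section \<open>The reduced \<open>L\<^sup>p\<close>-operator algebra\<close>

definition ell :: "real \<Rightarrow> ('s \<Rightarrow> complex) cnormed" where
  "ell p =
     \<lparr>carrier = {f. (\<lambda>t. cmod (f t) powr p) summable_on UNIV},
      mult = (\<lambda>f g t. f t * g t),
      one = (\<lambda>t. 1),
      zero = (\<lambda>t. 0),
      add = (\<lambda>f g t. f t + g t),
      smult = (\<lambda>c f t. c * f t),
      nrm = (\<lambda>f. (\<Sum>\<^sub>\<infinity>t. cmod (f t) powr p) powr (1 / p))\<rparr>"

text \<open>The index set of the sum has at most one element, since \<open>t \<mapsto> s * t\<close> is injective on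
  \<open>{t. t * t\<^sup>\<star> \<preceq> s\<^sup>\<star> * s}\<close>.\<close>

definition left_regular :: "'s::inverse_semigroup \<Rightarrow> ('s \<Rightarrow> complex) \<Rightarrow> 's \<Rightarrow> complex" where
  "left_regular s f u = (\<Sum>t | t * t\<^sup>\<star> \<preceq> s\<^sup>\<star> * s \<and> s * t = u. f t)"

lemma left_regular_inj: assumes "t * t\<^sup>\<star> \<preceq> s\<^sup>\<star> * s" shows "s\<^sup>\<star> * (s * t) = t"
proof -
  obtain e where e: "e * e = e" "t * t\<^sup>\<star> = s\<^sup>\<star> * s * e" using assms by (auto simp: natural_le_def)
  have s: "s\<^sup>\<star> * s * (s\<^sup>\<star> * s) = s\<^sup>\<star> * s"
    using star_props(1)[of s] by (metis mult.assoc)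
  have t: "t = s\<^sup>\<star> * s * e * t"
    using e(2) star_props(1)[of t] by metis
  then have "s\<^sup>\<star> * (s * t) = s\<^sup>\<star> * s * (s\<^sup>\<star> * s) * e * t"
    by (metis mult.assoc)
  also have "\<dots> = t"
    using s t by simp
  finally show ?thesis .
qed

lemma left_regular_delta:
  fixes s t :: "'s::inverse_semigroup"
  shows "left_regular s (indicator {t}) =
    (if t * t\<^sup>\<star> \<preceq> s\<^sup>\<star> * s then indicator {s * t} else (\<lambda>_. 0))"
proof
  fix u
  let ?I = "{t'. t' * t'\<^sup>\<star> \<preceq> s\<^sup>\<star> * s \<and> s * t' = u}"
  have sub: "?I \<subseteq> {s\<^sup>\<star> * u}" using left_regular_inj by fastforce
  then have fin: "finite ?I" by (rule finite_subset) simp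
  have "left_regular s (indicator {t}) u = (\<Sum>t'\<in>?I. if t' = t then 1 else 0)"
    unfolding left_regular_def by (rule sum.cong) (auto simp: indicator_def)
  also have "\<dots> = (if t \<in> ?I then 1 else 0)" using fin by (simp add: sum.delta)
  finally show "left_regular s (indicator {t}) u = (if t * t\<^sup>\<star> \<preceq> s\<^sup>\<star> * s then indicator {s * t} else (\<lambda>_. 0)) u"
    by (auto simp: indicator_def)
qed

text \<open>Elements of the semigroup algebra are finitely supported functions \<open>a\<close>.\<close>

definition left_regular_alg ::
  "real \<Rightarrow> ('s::inverse_semigroup \<Rightarrow> complex) \<Rightarrow> ('s \<Rightarrow> complex) \<Rightarrow> ('s \<Rightarrow> complex)" where
  "left_regular_alg p a =
     (\<lambda>f\<in>carrier (ell p). \<lambda>u. \<Sum>s | a s \<noteq> 0. a s * left_regular s f u)"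

definition F_red ::
  "'s::inverse_semigroup itself \<Rightarrow> real \<Rightarrow> (('s \<Rightarrow> complex) \<Rightarrow> ('s \<Rightarrow> complex)) cnormed" where
  "F_red _ p = (bounded_operators (ell p))
     \<lparr>carrier := ntopology (bounded_operators (ell p))
        closure_of (left_regular_alg p ` {a. finite {s. a s \<noteq> 0}})\<rparr>"


section \<open>Morita equivalence of Banach algebras\<close>

definition left_banach_module :: "'b cnormed \<Rightarrow> 'x cnormed \<Rightarrow> ('b \<Rightarrow> 'x \<Rightarrow> 'x) \<Rightarrow> bool" where
  "left_banach_module B X l \<longleftrightarrow> banach_space X \<and> contractive_bilinear B X X l \<and>
     (\<forall>b\<in>carrier B. \<forall>b'\<in>carrier B. \<forall>x\<in>carrier X. l (b \<otimes>\<^bsub>B\<^esub> b') x = l b (l b' x))"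

definition right_banach_module :: "'b cnormed \<Rightarrow> 'y cnormed \<Rightarrow> ('y \<Rightarrow> 'b \<Rightarrow> 'y) \<Rightarrow> bool" where
  "right_banach_module B Y r \<longleftrightarrow> banach_space Y \<and> contractive_bilinear Y B Y r \<and>
     (\<forall>b\<in>carrier B. \<forall>b'\<in>carrier B. \<forall>y\<in>carrier Y. r y (b \<otimes>\<^bsub>B\<^esub> b') = r (r y b) b')"

definition banach_pair :: "'b cnormed \<Rightarrow> 'x cnormed \<Rightarrow> 'y cnormed \<Rightarrow>
    ('b \<Rightarrow> 'x \<Rightarrow> 'x) \<Rightarrow> ('y \<Rightarrow> 'b \<Rightarrow> 'y) \<Rightarrow> ('x \<Rightarrow> 'y \<Rightarrow> 'b) \<Rightarrow> bool" where
  "banach_pair B X Y l r ip \<longleftrightarrow>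
     left_banach_module B X l \<and> right_banach_module B Y r \<and> contractive_bilinear X Y B ip \<and>
     (\<forall>b\<in>carrier B. \<forall>x\<in>carrier X. \<forall>y\<in>carrier Y. ip (l b x) y = b \<otimes>\<^bsub>B\<^esub> ip x y) \<and>
     (\<forall>b\<in>carrier B. \<forall>x\<in>carrier X. \<forall>y\<in>carrier Y. ip x (r y b) = ip x y \<otimes>\<^bsub>B\<^esub> b)"

definition nondegenerate_pair :: "'b cnormed \<Rightarrow> 'x cnormed \<Rightarrow> 'y cnormed \<Rightarrow>
    ('b \<Rightarrow> 'x \<Rightarrow> 'x) \<Rightarrow> ('y \<Rightarrow> 'b \<Rightarrow> 'y) \<Rightarrow> bool" where
  "nondegenerate_pair B X Y l r \<longleftrightarrow>
     dense_span X {l b x | b x. b \<in> carrier B \<and> x \<in> carrier X} \<and>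
     dense_span Y {r y b | y b. y \<in> carrier Y \<and> b \<in> carrier B}"

definition full_pair :: "'b cnormed \<Rightarrow> 'x cnormed \<Rightarrow> 'y cnormed \<Rightarrow> ('x \<Rightarrow> 'y \<Rightarrow> 'b) \<Rightarrow> bool" where
  "full_pair B X Y ip \<longleftrightarrow> dense_span B {ip x y | x y. x \<in> carrier X \<and> y \<in> carrier Y}"

text \<open>The Banach algebra \<open>\<L>\<^sub>B(X, Y)\<close>; note the reversed product in the first component.\<close>

definition pair_operators :: "'b cnormed \<Rightarrow> 'x cnormed \<Rightarrow> 'y cnormed \<Rightarrow>
    ('b \<Rightarrow> 'x \<Rightarrow> 'x) \<Rightarrow> ('y \<Rightarrow> 'b \<Rightarrow> 'y) \<Rightarrow> ('x \<Rightarrow> 'y \<Rightarrow> 'b) \<Rightarrow>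
    (('x \<Rightarrow> 'x) \<times> ('y \<Rightarrow> 'y)) cnormed" where
  "pair_operators B X Y l r ip =
     \<lparr>carrier = {(P, Q).
        P \<in> carrier (bounded_operators X) \<and> Q \<in> carrier (bounded_operators Y) \<and>
        (\<forall>b\<in>carrier B. \<forall>x\<in>carrier X. P (l b x) = l b (P x)) \<and>
        (\<forall>b\<in>carrier B. \<forall>y\<in>carrier Y. Q (r y b) = r (Q y) b) \<and>
        (\<forall>x\<in>carrier X. \<forall>y\<in>carrier Y. ip (P x) y = ip x (Q y))},
      mult = (\<lambda>(P, Q) (P', Q').
        (P' \<otimes>\<^bsub>bounded_operators X\<^esub> P, Q \<otimes>\<^bsub>bounded_operators Y\<^esub> Q')),
      one = (\<one>\<^bsub>bounded_operators X\<^esub>, \<one>\<^bsub>bounded_operators Y\<^esub>),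
      zero = (\<zero>\<^bsub>bounded_operators X\<^esub>, \<zero>\<^bsub>bounded_operators Y\<^esub>),
      add = (\<lambda>(P, Q) (P', Q').
        (P \<oplus>\<^bsub>bounded_operators X\<^esub> P', Q \<oplus>\<^bsub>bounded_operators Y\<^esub> Q')),
      smult = (\<lambda>c (P, Q). (c \<odot>\<^bsub>bounded_operators X\<^esub> P, c \<odot>\<^bsub>bounded_operators Y\<^esub> Q)),
      nrm = (\<lambda>(P, Q). max (operator_norm X X P) (operator_norm Y Y Q))\<rparr>"

definition contractive_hom :: "'a cnormed \<Rightarrow> 'c cnormed \<Rightarrow> ('a \<Rightarrow> 'c) \<Rightarrow> bool" where
  "contractive_hom A C \<phi> \<longleftrightarrow> linear_map A C \<phi> \<and>
     (\<forall>a\<in>carrier A. \<forall>a'\<in>carrier A. \<phi> (a \<otimes>\<^bsub>A\<^esub> a') = \<phi> a \<otimes>\<^bsub>C\<^esub> \<phi> a') \<and>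
     (\<forall>a\<in>carrier A. nrm C (\<phi> a) \<le> nrm A a)"

text \<open>The homomorphism \<open>A \<rightarrow> \<L>\<^sub>B(X, Y)\<close> of a correspondence is given through the actions
  \<open>ra x a\<close> of \<open>A\<close> on \<open>X\<close> and \<open>la a y\<close> of \<open>A\<close> on \<open>Y\<close> that it induces.\<close>

definition banach_correspondence :: "'a cnormed \<Rightarrow> 'b cnormed \<Rightarrow> 'x cnormed \<Rightarrow> 'y cnormed \<Rightarrow>
    ('b \<Rightarrow> 'x \<Rightarrow> 'x) \<Rightarrow> ('y \<Rightarrow> 'b \<Rightarrow> 'y) \<Rightarrow> ('x \<Rightarrow> 'y \<Rightarrow> 'b) \<Rightarrow>
    ('x \<Rightarrow> 'a \<Rightarrow> 'x) \<Rightarrow> ('a \<Rightarrow> 'y \<Rightarrow> 'y) \<Rightarrow> bool" where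
  "banach_correspondence A B X Y l r ip ra la \<longleftrightarrow>
     banach_pair B X Y l r ip \<and>
     contractive_hom A (pair_operators B X Y l r ip)
       (\<lambda>a. (\<lambda>x\<in>carrier X. ra x a, \<lambda>y\<in>carrier Y. la a y))"

text \<open>The types \<open>'x\<close> and \<open>'y\<close> in which the carriers of the two bimodules live are explicit
  arguments; for any choice of them, \<open>morita_equivalent\<close> implies the existence of bimodules as
  required.  The type \<open>nat \<Rightarrow> complex\<close> has room, up to isometric isomorphism, for every
  separable Banach space.\<close>

definition morita_equivalent ::
  "'x itself \<Rightarrow> 'y itself \<Rightarrow> 'a cnormed \<Rightarrow> 'b cnormed \<Rightarrow> bool" where
  "morita_equivalent _ _ A B \<longleftrightarrow> banach_algebra A \<and> banach_algebra B \<and>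
     (\<exists>(X :: 'x cnormed) (Y :: 'y cnormed) bx xa ay yb ipB ipA.
        banach_correspondence A B X Y bx yb ipB xa ay \<and>
        full_pair B X Y ipB \<and> nondegenerate_pair B X Y bx yb \<and>
        banach_correspondence B A Y X ay xa ipA yb bx \<and>
        full_pair A Y X ipA \<and> nondegenerate_pair A Y X ay xa \<and>
        (\<forall>x\<^sub>1\<in>carrier X. \<forall>x\<^sub>2\<in>carrier X. \<forall>y\<in>carrier Y. bx (ipB x\<^sub>1 y) x\<^sub>2 = xa x\<^sub>1 (ipA y x\<^sub>2)) \<and>
        (\<forall>y\<^sub>1\<in>carrier Y. \<forall>y\<^sub>2\<in>carrier Y. \<forall>x\<in>carrier X. yb y\<^sub>1 (ipB x y\<^sub>2) = ay (ipA y\<^sub>1 x) y\<^sub>2))"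

end

theory Submission
  imports Defs
begin

text \<open>Let \<open>X\<close> be the equivalence biset and \<open>X\<^sup>\<star>\<close> its opposite, a \<open>T\<close>-\<open>S\<close>-biset.  The sets \<open>S\<close>, \<open>X\<close>,
\<open>X\<^sup>\<star>\<close>, \<open>T\<close> are the corners of a linking inverse semigroupoid: a point \<open>x\<close> of \<open>X\<close> is a partial
isomorphism from the idempotent \<open>[x, x]\<close> of \<open>T\<close> to the idempotent \<open>\<langle>x, x\<rangle>\<close> of \<open>S\<close>, the two
pairings are the products \<open>X X\<^sup>\<star> \<rightarrow> S\<close> and \<open>X\<^sup>\<star> X \<rightarrow> T\<close>.  If all four corners act by left
translation on one space \<open>\<ell>\<^sup>p(W)\<close>, then the closed spans of the operators of \<open>X\<^sup>\<star>\<close> and of \<open>X\<close> are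
the two bimodules, and every action and both pairings are composition in the Banach algebra \<open>E\<close> of
bounded operators on \<open>\<ell>\<^sup>p(W)\<close>.  Contractivity and all associativity laws are then inherited from
\<open>E\<close>.  Fullness holds because every element of \<open>S\<close> is a value \<open>\<langle>x, y\<rangle>\<close> and every element of \<open>T\<close> a
value \<open>[x, y]\<close>, and nondegeneracy because \<open>x = \<langle>x, x\<rangle>x = x[x, x]\<close>.  This reduction is
\<open>morita_equivalent_of_embeddings\<close>.

What remains is to choose \<open>W\<close> so that the corners \<open>S\<close> and \<open>T\<close> generate isometric copies of
\<open>F\<^sup>p\<^sub>r\<^sub>e\<^sub>d(S)\<close> and \<open>F\<^sup>p\<^sub>r\<^sub>e\<^sub>d(T)\<close>.  The space \<open>\<ell>\<^sup>p(S)\<close> is the \<open>\<ell>\<^sup>p\<close>-sum of its columns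
\<open>{s. s\<^sup>\<star>s = e}\<close>, one for each idempotent \<open>e\<close>, and every operator in \<open>F\<^sup>p\<^sub>r\<^sub>e\<^sub>d(S)\<close> preserves them
(\<open>column_projection\<close>).  The norm of a block diagonal operator on an \<open>\<ell>\<^sup>p\<close>-sum is the supremum of the
norms of its blocks, so repeating columns does not change it, as long as no column is lost.  Take a
sequence \<open>\<zeta>\<close> in \<open>X\<close> such that every idempotent of \<open>S\<close> is some \<open>\<langle>\<zeta>\<^sub>n, \<zeta>\<^sub>n\<rangle>\<close> and every idempotent
of \<open>T\<close> is some \<open>[\<zeta>\<^sub>n, \<zeta>\<^sub>n]\<close>; it exists because \<open>S\<close> and \<open>T\<close> are countable.  Let \<open>W\<close> contain, for
every \<open>n\<close>, a copy of the column of \<open>S\<close> at \<open>\<langle>\<zeta>\<^sub>n, \<zeta>\<^sub>n\<rangle>\<close> and a copy of the column of \<open>T\<close> at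
\<open>[\<zeta>\<^sub>n, \<zeta>\<^sub>n]\<close>.  Then \<open>S\<close> and \<open>T\<close> act isometrically on \<open>\<ell>\<^sup>p(W)\<close> (\<open>amp_isometric\<close>).  Translation by
\<open>\<zeta>\<^sub>n\<close> identifies the column of \<open>S\<close> at \<open>\<langle>\<zeta>\<^sub>n, \<zeta>\<^sub>n\<rangle>\<close> with the points \<open>y\<close> of \<open>X\<close> that satisfy
\<open>[y, y] = [\<zeta>\<^sub>n, \<zeta>\<^sub>n]\<close>, by \<open>s \<mapsto> s\<zeta>\<^sub>n\<close> with inverse \<open>y \<mapsto> \<langle>y, \<zeta>\<^sub>n\<rangle>\<close>, and so \<open>x\<close> in \<open>X\<close> acts on
\<open>\<ell>\<^sup>p(W)\<close> by mapping the point \<open>t\<close> of the \<open>n\<close>-th column of \<open>T\<close> to the point \<open>\<langle>xt, \<zeta>\<^sub>n\<rangle>\<close> of the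
\<open>n\<close>-th column of \<open>S\<close>.  The product rules of the semigroupoid are \<open>ampS_link\<close>, \<open>link_ampT\<close> and
\<open>link_link'\<close>; the other three follow by exchanging \<open>S\<close> and \<open>T\<close>.

Since \<open>W\<close> is countable, an operator on \<open>\<ell>\<^sup>p(W)\<close> is determined by a sequence of matrix
coefficients, and this puts the two bimodules into the type of complex sequences.\<close>

section \<open>Closed subspaces and isometric embeddings\<close>

lemma complex_ring_simps [simp]:
  "carrier complex_ring = UNIV" "\<zero>\<^bsub>complex_ring\<^esub> = 0" "\<one>\<^bsub>complex_ring\<^esub> = 1"
  "x \<otimes>\<^bsub>complex_ring\<^esub> y = x * y" "x \<oplus>\<^bsub>complex_ring\<^esub> y = x + y"
  by (simp_all add: complex_ring_def)

lemma normed_spaceI: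
  fixes V :: "'a cnormed" (structure)
  assumes zero: "\<zero> \<in> carrier V"
    and add: "\<And>x y. \<lbrakk>x \<in> carrier V; y \<in> carrier V\<rbrakk> \<Longrightarrow> x \<oplus> y \<in> carrier V"
    and smult: "\<And>c x. x \<in> carrier V \<Longrightarrow> c \<odot> x \<in> carrier V"
    and assoc: "\<And>x y z. \<lbrakk>x \<in> carrier V; y \<in> carrier V; z \<in> carrier V\<rbrakk> \<Longrightarrow> (x \<oplus> y) \<oplus> z = x \<oplus> (y \<oplus> z)"
    and comm: "\<And>x y. \<lbrakk>x \<in> carrier V; y \<in> carrier V\<rbrakk> \<Longrightarrow> x \<oplus> y = y \<oplus> x"
    and l_zero: "\<And>x. x \<in> carrier V \<Longrightarrow> \<zero> \<oplus> x = x"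
    and l_neg: "\<And>x. x \<in> carrier V \<Longrightarrow> (- 1) \<odot> x \<oplus> x = \<zero>"
    and l_distr: "\<And>a b x. x \<in> carrier V \<Longrightarrow> (a + b) \<odot> x = a \<odot> x \<oplus> b \<odot> x"
    and r_distr: "\<And>a x y. \<lbrakk>x \<in> carrier V; y \<in> carrier V\<rbrakk> \<Longrightarrow> a \<odot> (x \<oplus> y) = a \<odot> x \<oplus> a \<odot> y"
    and s_assoc: "\<And>a b x. x \<in> carrier V \<Longrightarrow> (a * b) \<odot> x = a \<odot> (b \<odot> x)"
    and s_one: "\<And>x. x \<in> carrier V \<Longrightarrow> 1 \<odot> x = x"
    and nonneg: "\<And>x. x \<in> carrier V \<Longrightarrow> 0 \<le> nrm V x"
    and definite: "\<And>x. x \<in> carrier V \<Longrightarrow> nrm V x = 0 \<longleftrightarrow> x = \<zero>"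
    and homog: "\<And>c x. x \<in> carrier V \<Longrightarrow> nrm V (c \<odot> x) = cmod c * nrm V x"
    and triangle: "\<And>x y. \<lbrakk>x \<in> carrier V; y \<in> carrier V\<rbrakk> \<Longrightarrow> nrm V (x \<oplus> y) \<le> nrm V x + nrm V y"
  shows "normed_space V"
proof -
  have "abelian_group V"
  proof (rule abelian_groupI)
    show "\<exists>y\<in>carrier V. y \<oplus> x = \<zero>" if "x \<in> carrier V" for x
      using l_neg[OF that] smult[OF that, of "- 1"] by blast
  qed (fact zero add assoc comm l_zero)+
  then have "Module.module complex_ring V"
    by (intro moduleI[OF cring_complex_ring])
      (simp_all only: complex_ring_simps UNIV_I smult l_distr r_distr s_assoc s_one)
  then show ?thesis
    by (rule normed_space.intro) (rule normed_space_axioms.intro; fact)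
qed

context normed_space
begin

lemma zero_mem [simp, intro]: "\<zero> \<in> carrier V"
  and add_mem [simp, intro]: "\<lbrakk>x \<in> carrier V; y \<in> carrier V\<rbrakk> \<Longrightarrow> x \<oplus> y \<in> carrier V"
  and smult_mem [simp, intro]: "x \<in> carrier V \<Longrightarrow> c \<odot> x \<in> carrier V"
  and minus_mem [simp, intro]: "\<lbrakk>x \<in> carrier V; y \<in> carrier V\<rbrakk> \<Longrightarrow> x \<ominus> y \<in> carrier V"
  using smult_closed[of c x] by (auto simp: M.minus_closed)

lemma uminus_conv: "x \<in> carrier V \<Longrightarrow> \<ominus> x = (- 1) \<odot> x"
proof -
  assume x: "x \<in> carrier V"
  have m1: "\<ominus>\<^bsub>complex_ring\<^esub> \<one>\<^bsub>complex_ring\<^esub> = - 1"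
    by (rule R.minus_equality) auto
  show "\<ominus> x = (- 1) \<odot> x"
    using smult_l_minus[of "\<one>\<^bsub>complex_ring\<^esub>" x] x smult_one[OF x]
    unfolding m1 by simp
qed

lemma minus_conv: "\<lbrakk>x \<in> carrier V; y \<in> carrier V\<rbrakk> \<Longrightarrow> x \<ominus> y = x \<oplus> (- 1) \<odot> y"
  by (simp add: a_minus_def uminus_conv)

lemma smult_zero_left [simp]: "x \<in> carrier V \<Longrightarrow> 0 \<odot> x = \<zero>"
  using smult_l_null[of x] by simp

lemma smult_zero_right [simp]: "c \<odot> \<zero> = \<zero>"
  using smult_r_null[of c] by simp

lemma nrm_zero [simp]: "nrm V \<zero> = 0"
  by (simp add: nrm_eq_0_iff)

lemma ndist_triangle:
  "\<lbrakk>x \<in> carrier V; y \<in> carrier V; z \<in> carrier V\<rbrakk> \<Longrightarrow> nrm V (x \<ominus> z) \<le> nrm V (x \<ominus> y) + nrm V (y \<ominus> z)"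
  using Metric_space.triangle[OF Metric_space_ndist, of x y z] by (simp add: ndist_def)

lemma nrm_minus_commute:
  "\<lbrakk>x \<in> carrier V; y \<in> carrier V\<rbrakk> \<Longrightarrow> nrm V (x \<ominus> y) = nrm V (y \<ominus> x)"
  using Metric_space.commute[OF Metric_space_ndist, of x y] by (simp add: ndist_def)

lemma nrm_le_minus:
  assumes "x \<in> carrier V" "y \<in> carrier V" shows "nrm V x \<le> nrm V (x \<ominus> y) + nrm V y"
  using ndist_triangle[of x y \<zero>] assms by (simp add: minus_conv)

lemma minus_eq_zero_iff:
  "\<lbrakk>x \<in> carrier V; y \<in> carrier V\<rbrakk> \<Longrightarrow> nrm V (x \<ominus> y) = 0 \<longleftrightarrow> x = y"
  using Metric_space.zero[OF Metric_space_ndist, of x y] by (simp add: ndist_def)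

lemma add_minus_add:
  assumes "x \<in> carrier V" "y \<in> carrier V" "a \<in> carrier V" "b \<in> carrier V"
  shows "(x \<oplus> y) \<ominus> (a \<oplus> b) = (x \<ominus> a) \<oplus> (y \<ominus> b)"
  using assms by (simp add: a_minus_def M.minus_add M.a_ac)

lemma smult_minus_smult:
  assumes "x \<in> carrier V" "a \<in> carrier V"
  shows "c \<odot> x \<ominus> c \<odot> a = c \<odot> (x \<ominus> a)"
  using assms smult_r_distr[of c x "\<ominus> a"] smult_r_minus[of c a] by (simp add: a_minus_def)

lemma closure_of_iff:
  assumes "S \<subseteq> carrier V"
  shows "x \<in> ntopology V closure_of S \<longleftrightarrow> x \<in> carrier V \<and> (\<forall>r>0. \<exists>y\<in>S. nrm V (x \<ominus> y) < r)"
  using assms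
  by (simp add: ntopology_def Metric_space.metric_closure_of[OF Metric_space_ndist]
      Metric_space.in_mball[OF Metric_space_ndist])
    (auto simp: ndist_def subset_iff Bex_def)

lemma closure_of_superset:
  assumes "S \<subseteq> carrier V" shows "S \<subseteq> ntopology V closure_of S"
proof
  fix x assume x: "x \<in> S"
  then have "nrm V (x \<ominus> x) = 0" using assms minus_eq_zero_iff[of x x] by blast
  then show "x \<in> ntopology V closure_of S"
    using x assms unfolding closure_of_iff[OF assms] by (auto intro!: bexI[of _ x])
qed

end

definition closed_subspace :: "'a cnormed \<Rightarrow> 'a set \<Rightarrow> bool" where
  "closed_subspace V H \<longleftrightarrow> H \<subseteq> carrier V \<and> \<zero>\<^bsub>V\<^esub> \<in> H \<and> (\<forall>x\<in>H. \<forall>y\<in>H. x \<oplus>\<^bsub>V\<^esub> y \<in> H) \<and>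
     (\<forall>c. \<forall>x\<in>H. c \<odot>\<^bsub>V\<^esub> x \<in> H) \<and>
     (\<forall>x\<in>carrier V. (\<forall>r>0. \<exists>y\<in>H. nrm V (x \<ominus>\<^bsub>V\<^esub> y) < r) \<longrightarrow> x \<in> H)"

lemma closed_subspaceD:
  assumes "closed_subspace V H"
  shows "H \<subseteq> carrier V" "\<zero>\<^bsub>V\<^esub> \<in> H" "\<And>x y. \<lbrakk>x \<in> H; y \<in> H\<rbrakk> \<Longrightarrow> x \<oplus>\<^bsub>V\<^esub> y \<in> H"
    "\<And>c x. x \<in> H \<Longrightarrow> c \<odot>\<^bsub>V\<^esub> x \<in> H"
    "\<And>x. \<lbrakk>x \<in> carrier V; \<And>r. 0 < r \<Longrightarrow> \<exists>y\<in>H. nrm V (x \<ominus>\<^bsub>V\<^esub> y) < r\<rbrakk> \<Longrightarrow> x \<in> H"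
  using assms unfolding closed_subspace_def by auto

text \<open>Generation is phrased through closed subspaces, so that an assertion about all elements of a space is
proved by checking generators and observing that the assertion defines a closed subspace.\<close>

definition generates :: "'a cnormed \<Rightarrow> 'a set \<Rightarrow> bool" where
  "generates V G \<longleftrightarrow> G \<subseteq> carrier V \<and> (\<forall>H. closed_subspace V H \<and> G \<subseteq> H \<longrightarrow> carrier V \<subseteq> H)"

definition closed_span :: "'a cnormed \<Rightarrow> 'a set \<Rightarrow> 'a set" where
  "closed_span V G = closed_subspace V hull G"

context normed_space
begin

lemma closed_subspace_carrier: "closed_subspace V (carrier V)"
  by (auto simp: closed_subspace_def)

lemma closed_subspace_zero: "closed_subspace V {\<zero>}"
  unfolding closed_subspace_def
proof (intro conjI ballI allI impI)
  fix x assume x: "x \<in> carrier V" "\<forall>r>0. \<exists>y\<in>{\<zero>}. nrm V (x \<ominus> y) < r"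
  then have "\<not> 0 < nrm V (x \<ominus> \<zero>)" by blast
  then have "nrm V (x \<ominus> \<zero>) = 0" using nrm_nonneg[of "x \<ominus> \<zero>"] x(1) by force
  then show "x \<in> {\<zero>}" using x(1) minus_eq_zero_iff by blast
qed auto

lemma closed_subspace_Inter:
  assumes "\<H> \<noteq> {}" "\<And>H. H \<in> \<H> \<Longrightarrow> closed_subspace V H"
  shows "closed_subspace V (\<Inter>\<H>)"
proof -
  have "x \<in> H" if "x \<in> carrier V" "\<forall>r>0. \<exists>y\<in>\<Inter>\<H>. nrm V (x \<ominus> y) < r" "H \<in> \<H>" for x H
  proof (rule closed_subspaceD(5)[OF assms(2)[OF that(3)] that(1)])
    show "\<exists>y\<in>H. nrm V (x \<ominus> y) < r" if "0 < r" for r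
      using that \<open>\<forall>r>0. _ r\<close> \<open>H \<in> \<H>\<close> by blast
  qed
  then show ?thesis
    unfolding closed_subspace_def[of V "\<Inter>\<H>"]
  proof (intro conjI ballI allI impI)
    show "\<Inter>\<H> \<subseteq> carrier V" using assms(1) closed_subspaceD(1)[OF assms(2)] by blast
    show "\<zero> \<in> \<Inter>\<H>" using closed_subspaceD(2)[OF assms(2)] by blast
    show "x \<oplus> y \<in> \<Inter>\<H>" if "x \<in> \<Inter>\<H>" "y \<in> \<Inter>\<H>" for x y
      using that closed_subspaceD(3)[OF assms(2)] by blast
    show "c \<odot> x \<in> \<Inter>\<H>" if "x \<in> \<Inter>\<H>" for c x
      using that closed_subspaceD(4)[OF assms(2)] by blast
  qed blast
qed

lemma closed_span_closed:
  assumes "G \<subseteq> carrier V" shows "closed_subspace V (closed_span V G)"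
  unfolding closed_span_def hull_def
  by (rule closed_subspace_Inter) (use assms closed_subspace_carrier in auto)

lemma closed_subspace_closure:
  assumes S: "S \<subseteq> carrier V" "\<zero> \<in> S"
    and add: "\<And>x y. \<lbrakk>x \<in> S; y \<in> S\<rbrakk> \<Longrightarrow> x \<oplus> y \<in> S" and smult: "\<And>c x. x \<in> S \<Longrightarrow> c \<odot> x \<in> S"
  shows "closed_subspace V (ntopology V closure_of S)"
  unfolding closed_subspace_def
proof (intro conjI ballI allI impI)
  let ?C = "ntopology V closure_of S"
  note iff = closure_of_iff[OF S(1)]
  show "?C \<subseteq> carrier V" using iff by auto
  show "\<zero> \<in> ?C" using closure_of_superset[OF S(1)] S(2) by blast
  show "x \<oplus> y \<in> ?C" if x: "x \<in> ?C" and y: "y \<in> ?C" for x y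
    unfolding iff
  proof (intro conjI allI impI)
    show "x \<oplus> y \<in> carrier V" using x y iff by auto
    fix r :: real assume "0 < r"
    then obtain a b where ab: "a \<in> S" "b \<in> S" "nrm V (x \<ominus> a) < r/2" "nrm V (y \<ominus> b) < r/2"
      using x y iff half_gt_zero by metis
    have "nrm V ((x \<oplus> y) \<ominus> (a \<oplus> b)) \<le> nrm V (x \<ominus> a) + nrm V (y \<ominus> b)"
      using ab S(1) x y iff by (subst add_minus_add) (auto intro!: nrm_triangle)
    also have "\<dots> < r" using ab by simp
    finally show "\<exists>c\<in>S. nrm V ((x \<oplus> y) \<ominus> c) < r" using add[OF ab(1,2)] by blast
  qed
  show "c \<odot> x \<in> ?C" if x: "x \<in> ?C" for c x
    unfolding iff
  proof (intro conjI allI impI)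
    show "c \<odot> x \<in> carrier V" using x iff by auto
    fix r :: real assume "0 < r"
    then have "0 < r / (cmod c + 1)" by (simp add: add_nonneg_pos)
    then obtain a where a: "a \<in> S" "nrm V (x \<ominus> a) < r / (cmod c + 1)"
      using x iff by blast
    have xa: "x \<in> carrier V" "a \<in> carrier V" using x a iff S(1) by auto
    have "nrm V (c \<odot> x \<ominus> c \<odot> a) = cmod c * nrm V (x \<ominus> a)"
      using xa by (simp add: smult_minus_smult nrm_smult)
    also have "\<dots> \<le> (cmod c + 1) * nrm V (x \<ominus> a)"
      using xa by (intro mult_right_mono nrm_nonneg) auto
    also have "\<dots> < r" using a(2) pos_less_divide_eq[of "cmod c + 1" "nrm V (x \<ominus> a)" r]
      by (simp add: add_nonneg_pos mult.commute)
    finally show "\<exists>b\<in>S. nrm V (c \<odot> x \<ominus> b) < r" using smult[OF a(1)] by blast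
  qed
  show "x \<in> ?C" if x: "x \<in> carrier V" and r: "\<forall>r>0. \<exists>y\<in>?C. nrm V (x \<ominus> y) < r" for x
    unfolding iff
  proof (intro conjI allI impI)
    show "x \<in> carrier V" by fact
    fix r :: real assume "0 < r"
    then obtain y where y: "y \<in> ?C" "nrm V (x \<ominus> y) < r/2" using r half_gt_zero by blast
    then obtain z where z: "z \<in> S" "nrm V (y \<ominus> z) < r/2"
      using iff half_gt_zero[OF \<open>0 < r\<close>] by blast
    have "nrm V (x \<ominus> z) \<le> nrm V (x \<ominus> y) + nrm V (y \<ominus> z)"
      using x y z iff S(1) by (intro ndist_triangle) auto
    then show "\<exists>z\<in>S. nrm V (x \<ominus> z) < r" using y z by (intro bexI[of _ z]) auto
  qed
qed

lemma dense_spanI: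
  assumes "generates V G" "G \<subseteq> G'" "G' \<subseteq> carrier V"
  shows "dense_span V G'"
proof -
  let ?L = "linear_span V G'"
  have sub: "?L \<subseteq> carrier V"
    unfolding linear_span_def by (rule hull_minimal) (fact assms(3) carrier_is_submodule)+
  have "closed_subspace V (ntopology V closure_of ?L)"
  proof (rule closed_subspace_closure[OF sub])
    have iff: "x \<in> ?L \<longleftrightarrow> (\<forall>H. submodule H complex_ring V \<longrightarrow> G' \<subseteq> H \<longrightarrow> x \<in> H)" for x
      unfolding linear_span_def hull_def by blast
    show add: "x \<oplus> y \<in> ?L" if "x \<in> ?L" "y \<in> ?L" for x y
      using that unfolding iff by (blast intro: submoduleE(5))
    show smult: "c \<odot> x \<in> ?L" if "x \<in> ?L" for c x
      using that submoduleE(4)[of _ c] unfolding iff by simp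
    show "\<zero> \<in> ?L"
      unfolding iff
    proof (intro allI impI)
      fix H assume H: "submodule H complex_ring V"
      then obtain x where "x \<in> H" "x \<in> carrier V" using submoduleE(1,2) by blast
      then show "\<zero> \<in> H" using submoduleE(4)[OF H, of 0 x] by simp
    qed
  qed
  moreover have "G' \<subseteq> ?L" unfolding linear_span_def by (rule hull_subset)
  then have "G' \<subseteq> ntopology V closure_of ?L"
    using closure_of_superset[OF sub] by blast
  ultimately have "carrier V \<subseteq> ntopology V closure_of ?L"
    using assms unfolding generates_def by blast
  then show ?thesis
    unfolding dense_span_def using closure_of_iff[OF sub] by auto
qed

end

lemma banach_spaceI:
  fixes V :: "'a cnormed" (structure)
  assumes "normed_space V"
    and *: "\<And>\<sigma> :: nat \<Rightarrow> 'a. \<lbrakk>\<And>n. \<sigma> n \<in> carrier V;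
        \<And>e. 0 < e \<Longrightarrow> \<exists>N. \<forall>m\<ge>N. \<forall>n\<ge>N. nrm V (\<sigma> m \<ominus> \<sigma> n) < e\<rbrakk> \<Longrightarrow>
      \<exists>x\<in>carrier V. \<forall>e>0. \<exists>N. \<forall>n\<ge>N. nrm V (\<sigma> n \<ominus> x) < e"
  shows "banach_space V"
proof (intro banach_space.intro banach_space_axioms.intro)
  interpret normed_space V by fact
  interpret d: Metric_space "carrier V" "ndist V" by (rule Metric_space_ndist)
  show "normed_space V" by fact
  show "d.mcomplete" unfolding d.mcomplete_def
  proof (intro allI impI)
    fix \<sigma> :: "nat \<Rightarrow> 'a" assume C: "d.MCauchy \<sigma>"
    then have mem: "\<sigma> n \<in> carrier V" for n by (auto simp: d.MCauchy_def)
    have "\<exists>x\<in>carrier V. \<forall>e>0. \<exists>N. \<forall>n\<ge>N. nrm V (\<sigma> n \<ominus> x) < e"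
    proof (rule *[OF mem])
      fix e :: real assume "0 < e"
      then show "\<exists>N. \<forall>m\<ge>N. \<forall>n\<ge>N. nrm V (\<sigma> m \<ominus> \<sigma> n) < e"
        using C mem unfolding d.MCauchy_def ndist_def by fastforce
    qed
    then show "\<exists>x. limitin d.mtopology \<sigma> x sequentially"
      unfolding d.limit_metric_sequentially using mem by (auto simp: ndist_def)
  qed
qed

context banach_space
begin

lemma Cauchy_converges:
  fixes \<sigma> :: "nat \<Rightarrow> 'a"
  assumes mem: "\<And>n. \<sigma> n \<in> carrier V"
    and C: "\<And>e. 0 < e \<Longrightarrow> \<exists>N. \<forall>m\<ge>N. \<forall>n\<ge>N. nrm V (\<sigma> m \<ominus> \<sigma> n) < e"
  obtains x where "x \<in> carrier V" "\<And>e. 0 < e \<Longrightarrow> \<exists>N. \<forall>n\<ge>N. nrm V (\<sigma> n \<ominus> x) < e"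
proof -
  interpret d: Metric_space "carrier V" "ndist V" by (rule Metric_space_ndist)
  have "d.MCauchy \<sigma>"
    unfolding d.MCauchy_def
  proof (intro conjI allI impI)
    fix e :: real assume "0 < e"
    then obtain N where "\<forall>m\<ge>N. \<forall>n\<ge>N. nrm V (\<sigma> m \<ominus> \<sigma> n) < e" using C by blast
    then show "\<exists>N. \<forall>n n'. N \<le> n \<longrightarrow> N \<le> n' \<longrightarrow> ndist V (\<sigma> n) (\<sigma> n') < e"
      using mem by (auto simp: ndist_def)
  qed (use mem in auto)
  then obtain x where "limitin d.mtopology \<sigma> x sequentially"
    using complete d.mcomplete_def by blast
  then show ?thesis
    unfolding d.limit_metric_sequentially using that mem by (auto simp: ndist_def)
qed

end

lemma linear_mapD:
  assumes "linear_map V W T"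
  shows "x \<in> carrier V \<Longrightarrow> T x \<in> carrier W"
    "\<lbrakk>x \<in> carrier V; y \<in> carrier V\<rbrakk> \<Longrightarrow> T (x \<oplus>\<^bsub>V\<^esub> y) = T x \<oplus>\<^bsub>W\<^esub> T y"
    "x \<in> carrier V \<Longrightarrow> T (c \<odot>\<^bsub>V\<^esub> x) = c \<odot>\<^bsub>W\<^esub> T x"
  using assms unfolding linear_map_def by auto

lemma linear_map_zero:
  assumes "normed_space V" "normed_space W" "linear_map V W T"
  shows "T \<zero>\<^bsub>V\<^esub> = \<zero>\<^bsub>W\<^esub>"
proof -
  interpret V: normed_space V by fact
  interpret W: normed_space W by fact
  have "T (0 \<odot>\<^bsub>V\<^esub> \<zero>\<^bsub>V\<^esub>) = 0 \<odot>\<^bsub>W\<^esub> T \<zero>\<^bsub>V\<^esub>" using linear_mapD[OF assms(3)] by blast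
  then show ?thesis using linear_mapD(1)[OF assms(3) V.zero_mem] by simp
qed

lemma linear_map_minus:
  assumes "normed_space V" "normed_space W" "linear_map V W T" "x \<in> carrier V" "y \<in> carrier V"
  shows "T (x \<ominus>\<^bsub>V\<^esub> y) = T x \<ominus>\<^bsub>W\<^esub> T y"
proof -
  interpret V: normed_space V by fact
  interpret W: normed_space W by fact
  show ?thesis using assms(4,5) linear_mapD[OF assms(3)] by (simp add: V.minus_conv W.minus_conv)
qed

lemma closed_subspace_vimage:
  assumes V: "normed_space V" and W: "normed_space W" and T: "bounded_linear_map V W T"
    and H: "closed_subspace W H"
  shows "closed_subspace V {x \<in> carrier V. T x \<in> H}"
proof -
  interpret V: normed_space V by fact
  interpret W: normed_space W by fact
  have lin: "linear_map V W T" using T by (simp add: bounded_linear_map_def)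
  obtain c where c: "\<And>x. x \<in> carrier V \<Longrightarrow> nrm W (T x) \<le> c * nrm V x"
    using T by (auto simp: bounded_linear_map_def)
  note H' = closed_subspaceD[OF H]
  have "T x \<in> H" if x: "x \<in> carrier V"
    and cl: "\<forall>r>0. \<exists>y\<in>{x \<in> carrier V. T x \<in> H}. nrm V (x \<ominus>\<^bsub>V\<^esub> y) < r" for x
  proof (rule H'(5))
    show "T x \<in> carrier W" using linear_mapD[OF lin] x by blast
    fix r :: real assume r: "0 < r"
    then have "0 < r / (\<bar>c\<bar> + 1)" by (simp add: add_nonneg_pos)
    then obtain y where y: "y \<in> carrier V" "T y \<in> H" "nrm V (x \<ominus>\<^bsub>V\<^esub> y) < r / (\<bar>c\<bar> + 1)"
      using cl by blast
    have "nrm W (T x \<ominus>\<^bsub>W\<^esub> T y) \<le> c * nrm V (x \<ominus>\<^bsub>V\<^esub> y)"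
      using c[of "x \<ominus>\<^bsub>V\<^esub> y"] x y by (simp add: linear_map_minus[OF V W lin])
    also have "\<dots> \<le> (\<bar>c\<bar> + 1) * nrm V (x \<ominus>\<^bsub>V\<^esub> y)"
      using x y by (intro mult_right_mono V.nrm_nonneg) auto
    also have "\<dots> < r" using y(3) pos_less_divide_eq[of "\<bar>c\<bar> + 1" "nrm V (x \<ominus>\<^bsub>V\<^esub> y)" r]
      by (simp add: add_nonneg_pos mult.commute)
    finally show "\<exists>z\<in>H. nrm W (T x \<ominus>\<^bsub>W\<^esub> z) < r" using y by blast
  qed
  then show ?thesis
    using H' linear_mapD[OF lin] linear_map_zero[OF V W lin]
    unfolding closed_subspace_def[of V] by auto
qed

definition isometric_embedding :: "'a cnormed \<Rightarrow> 'b cnormed \<Rightarrow> ('a \<Rightarrow> 'b) \<Rightarrow> bool" where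
  "isometric_embedding V E i \<longleftrightarrow> linear_map V E i \<and> (\<forall>x\<in>carrier V. nrm E (i x) = nrm V x)"

lemma isometric_embedding_inj:
  assumes "normed_space V" "normed_space E" "isometric_embedding V E i"
  shows "inj_on i (carrier V)"
proof (rule inj_onI)
  interpret V: normed_space V by fact
  interpret E: normed_space E by fact
  have lin: "linear_map V E i" and n: "\<And>x. x \<in> carrier V \<Longrightarrow> nrm E (i x) = nrm V x"
    using assms(3) by (auto simp: isometric_embedding_def)
  fix x y assume xy: "x \<in> carrier V" "y \<in> carrier V" "i x = i y"
  then have "nrm V (x \<ominus>\<^bsub>V\<^esub> y) = nrm E (i x \<ominus>\<^bsub>E\<^esub> i y)"
    using n[of "x \<ominus>\<^bsub>V\<^esub> y"] by (simp add: linear_map_minus[OF assms(1,2) lin])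
  also have "\<dots> = 0" using xy linear_mapD(1)[OF lin] by (simp add: E.minus_eq_zero_iff)
  finally show "x = y" using xy V.minus_eq_zero_iff by blast
qed

text \<open>A closed subspace of a Banach space is complete and isometries preserve completeness, so its image
is closed.\<close>

lemma isometric_embedding_image:
  assumes "banach_space V" "normed_space E" "isometric_embedding V E i" "closed_subspace V H"
  shows "closed_subspace E (i ` H)"
proof -
  interpret V: banach_space V by fact
  interpret E: normed_space E by fact
  note V = V.normed_space_axioms
  have lin: "linear_map V E i" and n: "\<And>x. x \<in> carrier V \<Longrightarrow> nrm E (i x) = nrm V x"
    using assms(3) by (auto simp: isometric_embedding_def)
  note L = linear_mapD[OF lin] and H = closed_subspaceD[OF assms(4)]
  have "x \<in> i ` H" if x: "x \<in> carrier E" and cl: "\<forall>r>0. \<exists>y\<in>i ` H. nrm E (x \<ominus>\<^bsub>E\<^esub> y) < r" for x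
  proof -
    have "\<exists>v\<in>H. nrm E (x \<ominus>\<^bsub>E\<^esub> i v) < inverse (Suc k)" for k
      using cl[rule_format, of "inverse (Suc k)"] by simp
    then obtain \<sigma> where \<sigma>: "\<And>k. \<sigma> k \<in> H" "\<And>k. nrm E (x \<ominus>\<^bsub>E\<^esub> i (\<sigma> k)) < inverse (Suc k)" by metis
    have mem: "\<sigma> k \<in> carrier V" for k using \<sigma>(1) H(1) by blast
    have small: "\<exists>N. \<forall>k\<ge>N. nrm E (x \<ominus>\<^bsub>E\<^esub> i (\<sigma> k)) < e" if "0 < e" for e
    proof -
      obtain N where N: "inverse (real (Suc N)) < e" using reals_Archimedean[OF \<open>0 < e\<close>] by blast
      have "nrm E (x \<ominus>\<^bsub>E\<^esub> i (\<sigma> k)) < e" if "N \<le> k" for k :: nat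
      proof -
        have "inverse (real (Suc k)) \<le> inverse (real (Suc N))" using that by (intro le_imp_inverse_le) auto
        then show ?thesis using \<sigma>(2)[of k] N by linarith
      qed
      then show ?thesis by blast
    qed
    have nn: "nrm V (\<sigma> j \<ominus>\<^bsub>V\<^esub> \<sigma> k) = nrm E (i (\<sigma> j) \<ominus>\<^bsub>E\<^esub> i (\<sigma> k))" for j k
      using n[of "\<sigma> j \<ominus>\<^bsub>V\<^esub> \<sigma> k"] mem by (simp add: linear_map_minus[OF V assms(2) lin])
    have "\<exists>N. \<forall>j\<ge>N. \<forall>k\<ge>N. nrm V (\<sigma> j \<ominus>\<^bsub>V\<^esub> \<sigma> k) < e" if "0 < e" for e
    proof -
      obtain N where N: "\<And>k. N \<le> k \<Longrightarrow> nrm E (x \<ominus>\<^bsub>E\<^esub> i (\<sigma> k)) < e/2"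
        using small[of "e/2"] \<open>0 < e\<close> by auto
      have "nrm V (\<sigma> j \<ominus>\<^bsub>V\<^esub> \<sigma> k) < e" if "N \<le> j" "N \<le> k" for j k
        using E.ndist_triangle[of "i (\<sigma> j)" x "i (\<sigma> k)"] E.nrm_minus_commute[of x "i (\<sigma> j)"]
          L(1)[OF mem] x N[OF that(1)] N[OF that(2)] nn[of j k] by auto
      then show ?thesis by blast
    qed
    from V.Cauchy_converges[of \<sigma>, OF mem this] obtain v where v: "v \<in> carrier V"
      "\<And>e. 0 < e \<Longrightarrow> \<exists>N. \<forall>k\<ge>N. nrm V (\<sigma> k \<ominus>\<^bsub>V\<^esub> v) < e" by metis
    have vH: "v \<in> H"
    proof (rule H(5)[OF v(1)])
      fix r :: real assume "0 < r"
      then obtain N where "\<forall>k\<ge>N. nrm V (\<sigma> k \<ominus>\<^bsub>V\<^esub> v) < r" using v by blast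
      then show "\<exists>y\<in>H. nrm V (v \<ominus>\<^bsub>V\<^esub> y) < r" using \<sigma>(1) V.nrm_minus_commute v(1) mem by (metis order_refl)
    qed
    have "nrm E (x \<ominus>\<^bsub>E\<^esub> i v) \<le> 0"
    proof (rule field_le_epsilon)
      fix e :: real assume "0 < e"
      then have e: "0 < e/2" by simp
      obtain N where N: "\<And>k. N \<le> k \<Longrightarrow> nrm E (x \<ominus>\<^bsub>E\<^esub> i (\<sigma> k)) < e/2" using small[OF e] by auto
      obtain M where M: "\<And>k. M \<le> k \<Longrightarrow> nrm V (\<sigma> k \<ominus>\<^bsub>V\<^esub> v) < e/2" using v(2)[OF e] by auto
      define k where "k = max M N"
      have "nrm E (i (\<sigma> k) \<ominus>\<^bsub>E\<^esub> i v) = nrm V (\<sigma> k \<ominus>\<^bsub>V\<^esub> v)"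
        using n[of "\<sigma> k \<ominus>\<^bsub>V\<^esub> v"] mem v by (simp add: linear_map_minus[OF V assms(2) lin])
      then show "nrm E (x \<ominus>\<^bsub>E\<^esub> i v) \<le> 0 + e"
        using E.ndist_triangle[of x "i (\<sigma> k)" "i v"] L(1) mem x v(1) N[of k] M[of k] k_def by fastforce
    qed
    then have "x = i v"
      using E.minus_eq_zero_iff[of x "i v"] E.nrm_nonneg[of "x \<ominus>\<^bsub>E\<^esub> i v"] x v L(1)[OF v(1)] by auto
    then show ?thesis using vH by blast
  qed
  moreover have "\<zero>\<^bsub>E\<^esub> \<in> i ` H"
    using linear_map_zero[OF V assms(2) lin] H(2) by (metis image_eqI)
  moreover have "x \<oplus>\<^bsub>E\<^esub> y \<in> i ` H" if "x \<in> i ` H" "y \<in> i ` H" for x y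
    using that H(1,3) L(2) by (smt (verit) image_iff subsetD)
  moreover have "c \<odot>\<^bsub>E\<^esub> x \<in> i ` H" if "x \<in> i ` H" for x c
    using that H(1,4) L(3) by (smt (verit) image_iff subsetD)
  ultimately show ?thesis
    using H(1) L(1) unfolding closed_subspace_def by blast
qed

text \<open>The axioms of a normed space, and completeness when the image is closed, can be checked in the
target of an injective map that respects the operations and the norm.  This covers closed subspaces
with the inherited structure and structure transported along an injection.\<close>

lemma banach_space_pullback:
  fixes V :: "'a cnormed" and E :: "'b cnormed"
  assumes "banach_space E" and cl: "closed_subspace E (i ` carrier V)"
    and inj: "inj_on i (carrier V)"
    and ops: "\<zero>\<^bsub>V\<^esub> \<in> carrier V" "\<And>x y. \<lbrakk>x \<in> carrier V; y \<in> carrier V\<rbrakk> \<Longrightarrow> x \<oplus>\<^bsub>V\<^esub> y \<in> carrier V"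
       "\<And>c x. x \<in> carrier V \<Longrightarrow> c \<odot>\<^bsub>V\<^esub> x \<in> carrier V"
    and zero: "i \<zero>\<^bsub>V\<^esub> = \<zero>\<^bsub>E\<^esub>"
    and add: "\<And>x y. \<lbrakk>x \<in> carrier V; y \<in> carrier V\<rbrakk> \<Longrightarrow> i (x \<oplus>\<^bsub>V\<^esub> y) = i x \<oplus>\<^bsub>E\<^esub> i y"
    and smult: "\<And>c x. x \<in> carrier V \<Longrightarrow> i (c \<odot>\<^bsub>V\<^esub> x) = c \<odot>\<^bsub>E\<^esub> i x"
    and nrm: "\<And>x. x \<in> carrier V \<Longrightarrow> nrm V x = nrm E (i x)"
  shows "banach_space V" "isometric_embedding V E i"
proof -
  interpret E: banach_space E by fact
  note C = closed_subspaceD[OF cl]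
  have iE: "\<And>x. x \<in> carrier V \<Longrightarrow> i x \<in> carrier E" using C(1) by auto
  have eqI: "x = y" if "x \<in> carrier V" "y \<in> carrier V" "i x = i y" for x y
    using that inj by (auto dest: inj_onD)
  show V: "banach_space V"
  proof (rule banach_spaceI)
    show ns: "normed_space V"
    proof (rule normed_spaceI)
      show "x \<oplus>\<^bsub>V\<^esub> y \<oplus>\<^bsub>V\<^esub> z = x \<oplus>\<^bsub>V\<^esub> (y \<oplus>\<^bsub>V\<^esub> z)" if "x \<in> carrier V" "y \<in> carrier V" "z \<in> carrier V" for x y z
        using that by (intro eqI) (auto simp: ops add iE E.M.a_assoc)
      show "x \<oplus>\<^bsub>V\<^esub> y = y \<oplus>\<^bsub>V\<^esub> x" if "x \<in> carrier V" "y \<in> carrier V" for x y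
        using that by (intro eqI) (auto simp: ops add iE E.M.a_comm)
      show "\<zero>\<^bsub>V\<^esub> \<oplus>\<^bsub>V\<^esub> x = x" if "x \<in> carrier V" for x
        using that by (intro eqI) (auto simp: ops add zero iE)
      show "(- 1) \<odot>\<^bsub>V\<^esub> x \<oplus>\<^bsub>V\<^esub> x = \<zero>\<^bsub>V\<^esub>" if "x \<in> carrier V" for x
        using that by (intro eqI) (auto simp: ops add zero smult iE E.M.l_neg E.uminus_conv[symmetric])
      show "(a + b) \<odot>\<^bsub>V\<^esub> x = a \<odot>\<^bsub>V\<^esub> x \<oplus>\<^bsub>V\<^esub> b \<odot>\<^bsub>V\<^esub> x" if "x \<in> carrier V" for a b x
        using that E.smult_l_distr[of a b "i x"] by (intro eqI) (auto simp: ops add smult iE)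
      show "a \<odot>\<^bsub>V\<^esub> (x \<oplus>\<^bsub>V\<^esub> y) = a \<odot>\<^bsub>V\<^esub> x \<oplus>\<^bsub>V\<^esub> a \<odot>\<^bsub>V\<^esub> y" if "x \<in> carrier V" "y \<in> carrier V" for a x y
        using that E.smult_r_distr[of a "i x" "i y"] by (intro eqI) (auto simp: ops add smult iE)
      show "(a * b) \<odot>\<^bsub>V\<^esub> x = a \<odot>\<^bsub>V\<^esub> (b \<odot>\<^bsub>V\<^esub> x)" if "x \<in> carrier V" for a b x
        using that E.smult_assoc1[of a b "i x"] by (intro eqI) (auto simp: ops smult iE)
      show "1 \<odot>\<^bsub>V\<^esub> x = x" if "x \<in> carrier V" for x
        using that E.smult_one[of "i x"] by (intro eqI) (auto simp: ops smult iE)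
      show "nrm V x = 0 \<longleftrightarrow> x = \<zero>\<^bsub>V\<^esub>" if "x \<in> carrier V" for x
        using that ops zero nrm iE by (auto simp: E.nrm_eq_0_iff intro: eqI)
      show "nrm V (x \<oplus>\<^bsub>V\<^esub> y) \<le> nrm V x + nrm V y" if "x \<in> carrier V" "y \<in> carrier V" for x y
        using that by (auto simp: nrm ops add iE E.nrm_triangle)
    qed (auto simp: ops nrm smult iE E.nrm_nonneg E.nrm_smult)
    interpret V: normed_space V by fact
    have lin: "linear_map V E i" using iE add smult by (auto simp: linear_map_def)
    fix \<sigma> :: "nat \<Rightarrow> 'a" assume mem: "\<And>n. \<sigma> n \<in> carrier V"
      and C: "\<And>e. 0 < e \<Longrightarrow> \<exists>N. \<forall>m\<ge>N. \<forall>n\<ge>N. nrm V (\<sigma> m \<ominus>\<^bsub>V\<^esub> \<sigma> n) < e"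
    have nm: "nrm V (x \<ominus>\<^bsub>V\<^esub> y) = nrm E (i x \<ominus>\<^bsub>E\<^esub> i y)" if "x \<in> carrier V" "y \<in> carrier V" for x y
      using that by (simp add: nrm linear_map_minus[OF ns E.normed_space_axioms lin])
    obtain x where x: "x \<in> carrier E" "\<And>e. 0 < e \<Longrightarrow> \<exists>N. \<forall>n\<ge>N. nrm E (i (\<sigma> n) \<ominus>\<^bsub>E\<^esub> x) < e"
    proof (rule E.Cauchy_converges[of "\<lambda>n. i (\<sigma> n)"])
      show "i (\<sigma> n) \<in> carrier E" for n using iE mem by auto
      show "\<exists>N. \<forall>m\<ge>N. \<forall>n\<ge>N. nrm E (i (\<sigma> m) \<ominus>\<^bsub>E\<^esub> i (\<sigma> n)) < e" if "0 < e" for e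
        using C[OF that] nm[OF mem mem] by simp
    qed auto
    have "x \<in> i ` carrier V"
    proof (rule closed_subspaceD(5)[OF cl x(1)])
      fix r :: real assume "0 < r"
      then obtain N where "\<forall>n\<ge>N. nrm E (i (\<sigma> n) \<ominus>\<^bsub>E\<^esub> x) < r" using x by blast
      then have "nrm E (x \<ominus>\<^bsub>E\<^esub> i (\<sigma> N)) < r" using E.nrm_minus_commute x(1) iE[OF mem] by simp
      then show "\<exists>y\<in>i ` carrier V. nrm E (x \<ominus>\<^bsub>E\<^esub> y) < r" using mem by blast
    qed
    then obtain v where "v \<in> carrier V" "x = i v" by blast
    then show "\<exists>x\<in>carrier V. \<forall>e>0. \<exists>N. \<forall>n\<ge>N. nrm V (\<sigma> n \<ominus>\<^bsub>V\<^esub> x) < e"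
      using x(2) nm mem by auto
  qed
  show "isometric_embedding V E i"
    using iE add smult nrm by (auto simp: linear_map_def isometric_embedding_def)
qed

section \<open>The Banach algebra of bounded operators\<close>

lemma bounded_linear_mapI:
  assumes "linear_map V W T" "\<And>x. x \<in> carrier V \<Longrightarrow> nrm W (T x) \<le> c * nrm V x"
  shows "bounded_linear_map V W T"
  using assms unfolding bounded_linear_map_def by blast

lemma operator_norm_leI:
  assumes "0 \<le> c" "\<And>x. x \<in> carrier V \<Longrightarrow> nrm W (T x) \<le> c * nrm V x"
  shows "operator_norm V W T \<le> c"
  unfolding operator_norm_def
  by (rule cInf_lower) (use assms in \<open>auto intro: bdd_belowI[of _ 0]\<close>)

lemma operator_norm:
  assumes "normed_space V" "normed_space W" "bounded_linear_map V W T"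
  shows "0 \<le> operator_norm V W T"
    and "x \<in> carrier V \<Longrightarrow> nrm W (T x) \<le> operator_norm V W T * nrm V x"
proof -
  interpret V: normed_space V by fact
  interpret W: normed_space W by fact
  have lin: "linear_map V W T" using assms(3) by (simp add: bounded_linear_map_def)
  let ?S = "{c. 0 \<le> c \<and> (\<forall>x\<in>carrier V. nrm W (T x) \<le> c * nrm V x)}"
  obtain c where c: "\<And>x. x \<in> carrier V \<Longrightarrow> nrm W (T x) \<le> c * nrm V x"
    using assms(3) by (auto simp: bounded_linear_map_def)
  have "\<bar>c\<bar> \<in> ?S"
    using c V.nrm_nonneg by (auto intro!: order_trans[OF c] mult_right_mono)
  then have ne: "?S \<noteq> {}" by blast
  show "0 \<le> operator_norm V W T"
    unfolding operator_norm_def by (rule cInf_greatest[OF ne]) auto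
  show "nrm W (T x) \<le> operator_norm V W T * nrm V x" if x: "x \<in> carrier V"
  proof (cases "nrm V x = 0")
    case True
    then have "x = \<zero>\<^bsub>V\<^esub>" using V.nrm_eq_0_iff x by blast
    then have "nrm W (T x) = 0"
      using linear_map_zero[OF assms(1,2) lin] by simp
    then show ?thesis using True by simp
  next
    case False
    then have pos: "0 < nrm V x" using V.nrm_nonneg[OF x] by simp
    have "nrm W (T x) / nrm V x \<le> operator_norm V W T"
      unfolding operator_norm_def
      by (rule cInf_greatest[OF ne]) (use pos x in \<open>auto simp: field_simps\<close>)
    then show ?thesis using pos by (simp add: field_simps)
  qed
qed

definition tends :: "'a cnormed \<Rightarrow> (nat \<Rightarrow> 'a) \<Rightarrow> 'a \<Rightarrow> bool" where
  "tends V \<sigma> x \<longleftrightarrow> (\<lambda>n. nrm V (\<sigma> n \<ominus>\<^bsub>V\<^esub> x)) \<longlonglongrightarrow> 0"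

context normed_space
begin

lemma tends_unique:
  assumes "\<And>n. \<sigma> n \<in> carrier V" "x \<in> carrier V" "y \<in> carrier V" "tends V \<sigma> x" "tends V \<sigma> y"
  shows "x = y"
proof -
  have "(\<lambda>n. nrm V (\<sigma> n \<ominus> x) + nrm V (\<sigma> n \<ominus> y)) \<longlonglongrightarrow> 0 + 0"
    using assms(4,5) unfolding tends_def by (rule tendsto_add)
  moreover have "nrm V (x \<ominus> y) \<le> nrm V (\<sigma> n \<ominus> x) + nrm V (\<sigma> n \<ominus> y)" for n
    using ndist_triangle[of x "\<sigma> n" y] nrm_minus_commute[of x "\<sigma> n"] assms by simp
  ultimately have "nrm V (x \<ominus> y) \<le> 0"
    by (intro LIMSEQ_le_const[where X = "\<lambda>n. nrm V (\<sigma> n \<ominus> x) + nrm V (\<sigma> n \<ominus> y)"]) auto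
  then show ?thesis using nrm_nonneg[of "x \<ominus> y"] minus_eq_zero_iff[of x y] assms by force
qed

lemma tends_add:
  assumes "\<And>n. \<sigma> n \<in> carrier V" "\<And>n. \<tau> n \<in> carrier V" "x \<in> carrier V" "y \<in> carrier V"
    "tends V \<sigma> x" "tends V \<tau> y"
  shows "tends V (\<lambda>n. \<sigma> n \<oplus> \<tau> n) (x \<oplus> y)"
  unfolding tends_def
proof (rule real_tendsto_sandwich[where f = "\<lambda>_. 0" and h = "\<lambda>n. nrm V (\<sigma> n \<ominus> x) + nrm V (\<tau> n \<ominus> y)"])
  show "(\<lambda>n. nrm V (\<sigma> n \<ominus> x) + nrm V (\<tau> n \<ominus> y)) \<longlonglongrightarrow> 0"
    using tendsto_add[OF assms(5,6)[unfolded tends_def]] by simp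
  show "\<forall>\<^sub>F n in sequentially. nrm V (\<sigma> n \<oplus> \<tau> n \<ominus> (x \<oplus> y)) \<le> nrm V (\<sigma> n \<ominus> x) + nrm V (\<tau> n \<ominus> y)"
    using assms(1-4) by (auto simp: add_minus_add intro!: always_eventually nrm_triangle)
  show "\<forall>\<^sub>F n in sequentially. 0 \<le> nrm V (\<sigma> n \<oplus> \<tau> n \<ominus> (x \<oplus> y))"
    using assms(1-4) by (auto intro!: always_eventually nrm_nonneg)
qed auto

lemma tends_smult:
  assumes "\<And>n. \<sigma> n \<in> carrier V" "x \<in> carrier V" "tends V \<sigma> x"
  shows "tends V (\<lambda>n. c \<odot> \<sigma> n) (c \<odot> x)"
  using tendsto_mult_left[OF assms(3)[unfolded tends_def], of "cmod c"] assms(1,2)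
  by (simp add: tends_def smult_minus_smult nrm_smult)

end

text \<open>The equalizer is the preimage of \<open>0\<close> under the difference of the two maps.\<close>

lemma closed_subspace_equalizer:
  assumes V: "normed_space V" and W: "normed_space W"
    and S: "bounded_linear_map V W S" and T: "bounded_linear_map V W T"
  shows "closed_subspace V {x \<in> carrier V. S x = T x}"
proof -
  interpret V: normed_space V by fact
  interpret W: normed_space W by fact
  note SD = linear_mapD[OF conjunct1[OF S[unfolded bounded_linear_map_def]]]
    and TD = linear_mapD[OF conjunct1[OF T[unfolded bounded_linear_map_def]]]
  obtain c d where c: "\<And>x. x \<in> carrier V \<Longrightarrow> nrm W (S x) \<le> c * nrm V x"
    and d: "\<And>x. x \<in> carrier V \<Longrightarrow> nrm W (T x) \<le> d * nrm V x"
    using S T unfolding bounded_linear_map_def by blast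
  have "bounded_linear_map V W (\<lambda>x. S x \<ominus>\<^bsub>W\<^esub> T x)"
  proof (rule bounded_linear_mapI[where c = "c + d"])
    show "linear_map V W (\<lambda>x. S x \<ominus>\<^bsub>W\<^esub> T x)"
      using SD TD by (simp add: linear_map_def W.add_minus_add W.smult_minus_smult)
    show "nrm W (S x \<ominus>\<^bsub>W\<^esub> T x) \<le> (c + d) * nrm V x" if x: "x \<in> carrier V" for x
    proof -
      have "nrm W (S x \<ominus>\<^bsub>W\<^esub> T x) \<le> nrm W (S x) + nrm W ((- 1) \<odot>\<^bsub>W\<^esub> T x)"
        using SD(1)[OF x] TD(1)[OF x] by (simp add: W.minus_conv W.nrm_triangle)
      also have "\<dots> = nrm W (S x) + nrm W (T x)" using TD(1)[OF x] by (simp add: W.nrm_smult)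
      finally show ?thesis using c[OF x] d[OF x] by (simp add: distrib_right)
    qed
  qed
  from closed_subspace_vimage[OF V W this W.closed_subspace_zero]
  show ?thesis
    using SD(1) TD(1) W.minus_eq_zero_iff W.nrm_eq_0_iff
    by (auto elim!: back_subst[of "closed_subspace V"])
qed

context normed_space
begin

abbreviation BO :: "('a \<Rightarrow> 'a) cnormed" where "BO \<equiv> bounded_operators V"

lemma BO_simps:
  "\<zero>\<^bsub>BO\<^esub> = (\<lambda>x\<in>carrier V. \<zero>)" "T \<oplus>\<^bsub>BO\<^esub> S = (\<lambda>x\<in>carrier V. T x \<oplus> S x)"
  "c \<odot>\<^bsub>BO\<^esub> T = (\<lambda>x\<in>carrier V. c \<odot> T x)" "T \<otimes>\<^bsub>BO\<^esub> S = (\<lambda>x\<in>carrier V. T (S x))"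
  "nrm BO T = operator_norm V V T"
  by (simp_all add: bounded_operators_def)

lemma BO_iff: "T \<in> carrier BO \<longleftrightarrow> T \<in> extensional (carrier V) \<and> bounded_linear_map V V T"
  by (simp add: bounded_operators_def)

lemma BO_linear: "T \<in> carrier BO \<Longrightarrow> linear_map V V T"
  by (simp add: BO_iff bounded_linear_map_def)

lemmas BO_linearD = linear_mapD[OF BO_linear]

lemma BO_norm: "T \<in> carrier BO \<Longrightarrow> x \<in> carrier V \<Longrightarrow> nrm V (T x) \<le> nrm BO T * nrm V x"
  and BO_nonneg: "T \<in> carrier BO \<Longrightarrow> 0 \<le> nrm BO T"
  using operator_norm[OF normed_space_axioms normed_space_axioms] by (auto simp: BO_iff BO_simps)

lemma BO_eqI:
  "\<lbrakk>T \<in> carrier BO; S \<in> carrier BO; \<And>x. x \<in> carrier V \<Longrightarrow> T x = S x\<rbrakk> \<Longrightarrow> T = S"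
  by (rule extensionalityI[of _ "carrier V"]) (auto simp: BO_iff)

lemma BO_restrict:
  assumes "\<And>x. x \<in> carrier V \<Longrightarrow> T x \<in> carrier V"
    "\<And>x y. \<lbrakk>x \<in> carrier V; y \<in> carrier V\<rbrakk> \<Longrightarrow> T (x \<oplus> y) = T x \<oplus> T y"
    "\<And>c x. x \<in> carrier V \<Longrightarrow> T (c \<odot> x) = c \<odot> T x"
    "0 \<le> c" "\<And>x. x \<in> carrier V \<Longrightarrow> nrm V (T x) \<le> c * nrm V x"
  shows "restrict T (carrier V) \<in> carrier BO \<and> nrm BO (restrict T (carrier V)) \<le> c"
proof
  show "restrict T (carrier V) \<in> carrier BO"
    unfolding BO_iff using assms
    by (auto simp: linear_map_def intro!: bounded_linear_mapI[where c = c])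
  show "nrm BO (restrict T (carrier V)) \<le> c"
    unfolding BO_simps using assms by (auto intro!: operator_norm_leI)
qed

lemmas BO_restrictI = BO_restrict[THEN conjunct1]

lemma normed_space_BO: "normed_space BO"
proof (rule normed_spaceI)
  show zero: "\<zero>\<^bsub>BO\<^esub> \<in> carrier BO"
    unfolding BO_simps by (rule BO_restrictI[where c = 0]) auto
  have add: "T \<oplus>\<^bsub>BO\<^esub> S \<in> carrier BO \<and> nrm BO (T \<oplus>\<^bsub>BO\<^esub> S) \<le> nrm BO T + nrm BO S"
    if T: "T \<in> carrier BO" and S: "S \<in> carrier BO" for T S
  proof -
    have "restrict (\<lambda>x. T x \<oplus> S x) (carrier V) \<in> carrier BO \<and>
        nrm BO (restrict (\<lambda>x. T x \<oplus> S x) (carrier V)) \<le> nrm BO T + nrm BO S"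
    proof (rule BO_restrict[where c = "nrm BO T + nrm BO S"])
      show "nrm V (T x \<oplus> S x) \<le> (nrm BO T + nrm BO S) * nrm V x" if "x \<in> carrier V" for x
        using nrm_triangle[of "T x" "S x"] BO_norm[OF T that] BO_norm[OF S that] BO_linearD(1)[OF T that]
          BO_linearD(1)[OF S that] by (simp add: distrib_right)
      show "T (x \<oplus> y) \<oplus> S (x \<oplus> y) = T x \<oplus> S x \<oplus> (T y \<oplus> S y)" if "x \<in> carrier V" "y \<in> carrier V" for x y
        using that BO_linearD(1,2)[OF T] BO_linearD(1,2)[OF S] by (simp add: M.a_ac)
      show "T (c \<odot> x) \<oplus> S (c \<odot> x) = c \<odot> (T x \<oplus> S x)" if "x \<in> carrier V" for c x
        using that BO_linearD(1,3)[OF T] BO_linearD(1,3)[OF S] smult_r_distr[of c "T x" "S x"] by simp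
    qed (use BO_linearD(1)[OF T] BO_linearD(1)[OF S] BO_nonneg[OF T] BO_nonneg[OF S] in auto)
    then show ?thesis unfolding BO_simps(2) .
  qed
  have smult: "c \<odot>\<^bsub>BO\<^esub> T \<in> carrier BO \<and> nrm BO (c \<odot>\<^bsub>BO\<^esub> T) \<le> cmod c * nrm BO T"
    if T: "T \<in> carrier BO" for T c
  proof -
    have "restrict (\<lambda>x. c \<odot> T x) (carrier V) \<in> carrier BO \<and>
        nrm BO (restrict (\<lambda>x. c \<odot> T x) (carrier V)) \<le> cmod c * nrm BO T"
    proof (rule BO_restrict[where c = "cmod c * nrm BO T"])
      show "nrm V (c \<odot> T x) \<le> cmod c * nrm BO T * nrm V x" if "x \<in> carrier V" for x
        using that BO_norm[OF T that] BO_linearD(1)[OF T that]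
        by (simp add: nrm_smult mult.assoc mult_left_mono)
      show "c \<odot> T (x \<oplus> y) = c \<odot> T x \<oplus> c \<odot> T y" if "x \<in> carrier V" "y \<in> carrier V" for x y
        using that BO_linearD(1,2)[OF T] smult_r_distr[of c "T x" "T y"] by simp
      show "c \<odot> T (d \<odot> x) = d \<odot> (c \<odot> T x)" if "x \<in> carrier V" for d x
        using that BO_linearD(1,3)[OF T] smult_assoc1[of c d "T x"] smult_assoc1[of d c "T x"]
        by (simp add: mult.commute)
    qed (use BO_linearD(1)[OF T] BO_nonneg[OF T] in auto)
    then show ?thesis unfolding BO_simps(3) .
  qed
  note mem = zero conjunct1[OF add] conjunct1[OF smult]
  show "T \<oplus>\<^bsub>BO\<^esub> S \<in> carrier BO" "nrm BO (T \<oplus>\<^bsub>BO\<^esub> S) \<le> nrm BO T + nrm BO S"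
    if "T \<in> carrier BO" "S \<in> carrier BO" for T S using add that by auto
  show "c \<odot>\<^bsub>BO\<^esub> T \<in> carrier BO" if "T \<in> carrier BO" for T c using smult that by auto
  show "T \<oplus>\<^bsub>BO\<^esub> S \<oplus>\<^bsub>BO\<^esub> R = T \<oplus>\<^bsub>BO\<^esub> (S \<oplus>\<^bsub>BO\<^esub> R)"
    if T: "T \<in> carrier BO" "S \<in> carrier BO" "R \<in> carrier BO" for T S R
    by (intro BO_eqI mem T) (use T[THEN BO_linearD(1)] in \<open>simp add: BO_simps M.a_assoc\<close>)
  show "T \<oplus>\<^bsub>BO\<^esub> S = S \<oplus>\<^bsub>BO\<^esub> T" if T: "T \<in> carrier BO" "S \<in> carrier BO" for T S
    by (intro BO_eqI mem T) (use T[THEN BO_linearD(1)] in \<open>simp add: BO_simps M.a_comm\<close>)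
  show "\<zero>\<^bsub>BO\<^esub> \<oplus>\<^bsub>BO\<^esub> T = T" if T: "T \<in> carrier BO" for T
    by (intro BO_eqI mem T) (use T[THEN BO_linearD(1)] in \<open>simp add: BO_simps\<close>)
  show "(- 1) \<odot>\<^bsub>BO\<^esub> T \<oplus>\<^bsub>BO\<^esub> T = \<zero>\<^bsub>BO\<^esub>" if T: "T \<in> carrier BO" for T
    by (intro BO_eqI mem T)
      (use T[THEN BO_linearD(1)] in \<open>simp add: BO_simps uminus_conv[symmetric] M.l_neg\<close>)
  show "(a + b) \<odot>\<^bsub>BO\<^esub> T = a \<odot>\<^bsub>BO\<^esub> T \<oplus>\<^bsub>BO\<^esub> b \<odot>\<^bsub>BO\<^esub> T" if T: "T \<in> carrier BO" for a b T
    by (intro BO_eqI mem T)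
      (use T[THEN BO_linearD(1)] smult_l_distr[of a b] in \<open>simp add: BO_simps\<close>)
  show "a \<odot>\<^bsub>BO\<^esub> (T \<oplus>\<^bsub>BO\<^esub> S) = a \<odot>\<^bsub>BO\<^esub> T \<oplus>\<^bsub>BO\<^esub> a \<odot>\<^bsub>BO\<^esub> S"
    if T: "T \<in> carrier BO" "S \<in> carrier BO" for a T S
    by (intro BO_eqI mem T)
      (use T[THEN BO_linearD(1)] smult_r_distr[of a] in \<open>simp add: BO_simps\<close>)
  show "(a * b) \<odot>\<^bsub>BO\<^esub> T = a \<odot>\<^bsub>BO\<^esub> (b \<odot>\<^bsub>BO\<^esub> T)" if T: "T \<in> carrier BO" for a b T
    by (intro BO_eqI mem T)
      (use T[THEN BO_linearD(1)] smult_assoc1[of a b] in \<open>simp add: BO_simps\<close>)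
  show one: "1 \<odot>\<^bsub>BO\<^esub> T = T" if T: "T \<in> carrier BO" for T
    by (intro BO_eqI mem T) (use T[THEN BO_linearD(1)] smult_one in \<open>simp add: BO_simps\<close>)
  show "0 \<le> nrm BO T" if "T \<in> carrier BO" for T using that by (rule BO_nonneg)
  have nrm0: "nrm BO \<zero>\<^bsub>BO\<^esub> = 0"
  proof -
    have "nrm BO \<zero>\<^bsub>BO\<^esub> \<le> 0"
      unfolding BO_simps by (rule operator_norm_leI) auto
    then show ?thesis using BO_nonneg[OF zero] by simp
  qed
  show "nrm BO T = 0 \<longleftrightarrow> T = \<zero>\<^bsub>BO\<^esub>" if T: "T \<in> carrier BO" for T
  proof
    assume "nrm BO T = 0"
    then have "T x = \<zero>" if "x \<in> carrier V" for x
      using BO_norm[OF T that] BO_linearD(1)[OF T that] nrm_nonneg[of "T x"] nrm_eq_0_iff[of "T x"] by auto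
    then show "T = \<zero>\<^bsub>BO\<^esub>" by (intro BO_eqI mem T) (simp add: BO_simps)
  qed (use nrm0 in simp)
  show "nrm BO (c \<odot>\<^bsub>BO\<^esub> T) = cmod c * nrm BO T" if T: "T \<in> carrier BO" for c T
  proof (cases "c = 0")
    case True
    then have "nrm BO (c \<odot>\<^bsub>BO\<^esub> T) \<le> 0" using smult[OF T, of c] by simp
    then show ?thesis using BO_nonneg[of "c \<odot>\<^bsub>BO\<^esub> T"] smult[OF T, of c] True by simp
  next
    case False
    have "T = inverse c \<odot>\<^bsub>BO\<^esub> (c \<odot>\<^bsub>BO\<^esub> T)"
      by (intro BO_eqI mem T)
        (use T[THEN BO_linearD(1)] smult_assoc1[of "inverse c" c] smult_one False in \<open>simp add: BO_simps\<close>)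
    then have "nrm BO T \<le> cmod (inverse c) * nrm BO (c \<odot>\<^bsub>BO\<^esub> T)"
      using smult[of "c \<odot>\<^bsub>BO\<^esub> T" "inverse c"] smult[OF T, of c] by simp
    then have "cmod c * nrm BO T \<le> cmod c * (inverse (cmod c) * nrm BO (c \<odot>\<^bsub>BO\<^esub> T))"
      unfolding norm_inverse by (rule mult_left_mono) simp
    then have "cmod c * nrm BO T \<le> nrm BO (c \<odot>\<^bsub>BO\<^esub> T)"
      using False by (simp add: mult.assoc[symmetric])
    then show ?thesis using smult[OF T, of c] by simp
  qed
qed

lemma BO_minus:
  assumes "T \<in> carrier BO" "S \<in> carrier BO" "x \<in> carrier V"
  shows "(T \<ominus>\<^bsub>BO\<^esub> S) x = T x \<ominus> S x"
proof -
  interpret B: normed_space BO by (rule normed_space_BO)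
  show ?thesis
    using assms BO_linearD(1) by (simp add: B.minus_conv minus_conv) (simp add: BO_simps)
qed

end

context banach_space
begin

text \<open>A Cauchy sequence of operators converges pointwise, the pointwise limit is linear, and the Cauchy
estimate survives the passage to the limit at each vector, so convergence is in operator norm.\<close>

lemma banach_space_BO: "banach_space BO"
proof (rule banach_spaceI[OF normed_space_BO])
  interpret B: normed_space BO by (rule normed_space_BO)
  fix \<sigma> :: "nat \<Rightarrow> 'a \<Rightarrow> 'a"
  assume mem: "\<And>n. \<sigma> n \<in> carrier BO"
    and C: "\<And>e. 0 < e \<Longrightarrow> \<exists>N. \<forall>m\<ge>N. \<forall>n\<ge>N. nrm BO (\<sigma> m \<ominus>\<^bsub>BO\<^esub> \<sigma> n) < e"
  note S = BO_linearD[OF mem]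
  have le: "nrm V (\<sigma> m x \<ominus> \<sigma> n x) \<le> nrm BO (\<sigma> m \<ominus>\<^bsub>BO\<^esub> \<sigma> n) * nrm V x" if "x \<in> carrier V" for m n x
    using BO_norm[of "\<sigma> m \<ominus>\<^bsub>BO\<^esub> \<sigma> n" x] mem that by (simp add: BO_minus)
  have "\<exists>y\<in>carrier V. tends V (\<lambda>n. \<sigma> n x) y" if x: "x \<in> carrier V" for x
  proof -
    have "\<exists>N. \<forall>m\<ge>N. \<forall>n\<ge>N. nrm V (\<sigma> m x \<ominus> \<sigma> n x) < e" if "0 < e" for e
    proof -
      have "0 < e / (nrm V x + 1)" using \<open>0 < e\<close> nrm_nonneg[OF x] by simp
      from C[OF this] obtain N where N: "\<And>m n. \<lbrakk>N \<le> m; N \<le> n\<rbrakk> \<Longrightarrow> nrm BO (\<sigma> m \<ominus>\<^bsub>BO\<^esub> \<sigma> n) < e / (nrm V x + 1)" by blast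
      have "nrm V (\<sigma> m x \<ominus> \<sigma> n x) < e" if "N \<le> m" "N \<le> n" for m n
      proof -
        have "nrm V (\<sigma> m x \<ominus> \<sigma> n x) \<le> nrm BO (\<sigma> m \<ominus>\<^bsub>BO\<^esub> \<sigma> n) * (nrm V x + 1)"
          using le[OF x, of m n] B.nrm_nonneg[of "\<sigma> m \<ominus>\<^bsub>BO\<^esub> \<sigma> n"] mem by (simp add: distrib_left)
        also have "\<dots> < e / (nrm V x + 1) * (nrm V x + 1)"
          using N[OF that] nrm_nonneg[OF x] by (intro mult_strict_right_mono) auto
        finally show ?thesis using nrm_nonneg[OF x] by simp
      qed
      then show ?thesis by blast
    qed
    from Cauchy_converges[of "\<lambda>n. \<sigma> n x", OF S(1)[OF x] this] obtain y where
      y: "y \<in> carrier V" "\<And>e. 0 < e \<Longrightarrow> \<exists>N. \<forall>n\<ge>N. nrm V (\<sigma> n x \<ominus> y) < e" by blast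
    then have "tends V (\<lambda>n. \<sigma> n x) y"
      unfolding tends_def using S(1)[OF x] nrm_nonneg by (intro LIMSEQ_I) force
    then show ?thesis using y by blast
  qed
  then obtain L where L: "\<And>x. x \<in> carrier V \<Longrightarrow> L x \<in> carrier V"
    "\<And>x. x \<in> carrier V \<Longrightarrow> tends V (\<lambda>n. \<sigma> n x) (L x)" by metis
  have close: "nrm V (L x \<ominus> \<sigma> n x) \<le> e * nrm V x"
    if N: "\<And>m n. \<lbrakk>N \<le> m; N \<le> n\<rbrakk> \<Longrightarrow> nrm BO (\<sigma> m \<ominus>\<^bsub>BO\<^esub> \<sigma> n) < e" and n: "N \<le> n" and x: "x \<in> carrier V"
    for N n e x
  proof (rule LIMSEQ_le_const)
    have "(\<lambda>m. nrm V (\<sigma> m x \<ominus> L x) + e * nrm V x) \<longlonglongrightarrow> 0 + e * nrm V x"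
      using L(2)[OF x] unfolding tends_def by (intro tendsto_intros)
    then show "(\<lambda>m. nrm V (\<sigma> m x \<ominus> L x) + e * nrm V x) \<longlonglongrightarrow> e * nrm V x" by simp
    have "nrm V (L x \<ominus> \<sigma> n x) \<le> nrm V (\<sigma> m x \<ominus> L x) + e * nrm V x" if "N \<le> m" for m
    proof -
      have "nrm V (\<sigma> m x \<ominus> \<sigma> n x) \<le> e * nrm V x"
        using le[OF x, of m n] mult_right_mono[OF less_imp_le[OF N[OF that n]] nrm_nonneg[OF x]] by linarith
      then show ?thesis
        using ndist_triangle[of "L x" "\<sigma> m x" "\<sigma> n x"] nrm_minus_commute[of "L x" "\<sigma> m x"] L(1) S(1) x by simp
    qed
    then show "\<exists>N. \<forall>m\<ge>N. nrm V (L x \<ominus> \<sigma> n x) \<le> nrm V (\<sigma> m x \<ominus> L x) + e * nrm V x" by blast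
  qed
  have Ladd: "L (x \<oplus> y) = L x \<oplus> L y" if xy: "x \<in> carrier V" "y \<in> carrier V" for x y
  proof (rule tends_unique[of "\<lambda>n. \<sigma> n (x \<oplus> y)"])
    show "tends V (\<lambda>n. \<sigma> n (x \<oplus> y)) (L x \<oplus> L y)"
      using tends_add[OF S(1)[OF xy(1)] S(1)[OF xy(2)] L(1)[OF xy(1)] L(1)[OF xy(2)] L(2)[OF xy(1)] L(2)[OF xy(2)]]
        S(2)[OF xy] by simp
    show "tends V (\<lambda>n. \<sigma> n (x \<oplus> y)) (L (x \<oplus> y))" using L(2) xy by blast
  qed (use L(1) S(1) xy in auto)
  have Lsmult: "L (c \<odot> x) = c \<odot> L x" if x: "x \<in> carrier V" for c x
  proof (rule tends_unique[of "\<lambda>n. \<sigma> n (c \<odot> x)"])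
    show "tends V (\<lambda>n. \<sigma> n (c \<odot> x)) (c \<odot> L x)"
      using tends_smult[OF S(1)[OF x] L(1)[OF x] L(2)[OF x]] S(3)[OF x] by simp
    show "tends V (\<lambda>n. \<sigma> n (c \<odot> x)) (L (c \<odot> x))" using L(2) x by blast
  qed (use L(1) S(1) x in auto)
  define T where "T = restrict L (carrier V)"
  obtain M where M: "\<And>m n. \<lbrakk>M \<le> m; M \<le> n\<rbrakk> \<Longrightarrow> nrm BO (\<sigma> m \<ominus>\<^bsub>BO\<^esub> \<sigma> n) < 1"
    using C[of 1] by auto
  have T: "T \<in> carrier BO"
    unfolding T_def
  proof (rule BO_restrictI[OF L(1) Ladd Lsmult])
    show "0 \<le> 1 + nrm BO (\<sigma> M)" using B.nrm_nonneg[OF mem, of M] by simp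
    show "nrm V (L x) \<le> (1 + nrm BO (\<sigma> M)) * nrm V x" if x: "x \<in> carrier V" for x
      using nrm_le_minus[of "L x" "\<sigma> M x"] close[of M 1 M x, OF M order_refl x] BO_norm[OF mem x, of M] L(1)[OF x] S(1)[OF x]
      by (simp add: distrib_right)
  qed
  show "\<exists>T\<in>carrier BO. \<forall>e>0. \<exists>N. \<forall>n\<ge>N. nrm BO (\<sigma> n \<ominus>\<^bsub>BO\<^esub> T) < e"
  proof (intro bexI[OF _ T] allI impI)
    fix e :: real assume "0 < e"
    then have e2: "0 < e/2" by simp
    from C[OF this] obtain N where N: "\<And>m n. \<lbrakk>N \<le> m; N \<le> n\<rbrakk> \<Longrightarrow> nrm BO (\<sigma> m \<ominus>\<^bsub>BO\<^esub> \<sigma> n) < e/2" by blast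
    have "nrm BO (\<sigma> n \<ominus>\<^bsub>BO\<^esub> T) < e" if n: "N \<le> n" for n
    proof -
      have "nrm BO (T \<ominus>\<^bsub>BO\<^esub> \<sigma> n) \<le> e/2"
        unfolding BO_simps(5)
      proof (rule operator_norm_leI)
        show "nrm V ((T \<ominus>\<^bsub>BO\<^esub> \<sigma> n) x) \<le> e/2 * nrm V x" if x: "x \<in> carrier V" for x
          using close[OF N n x] x unfolding BO_minus[OF T mem x] by (simp add: T_def)
      qed (use e2 in simp)
      then show ?thesis using B.nrm_minus_commute[OF T mem] e2 by simp
    qed
    then show "\<exists>N. \<forall>n\<ge>N. nrm BO (\<sigma> n \<ominus>\<^bsub>BO\<^esub> T) < e" by blast
  qed
qed

lemma BO_mult:
  assumes T: "T \<in> carrier BO" and S: "S \<in> carrier BO"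
  shows "T \<otimes>\<^bsub>BO\<^esub> S \<in> carrier BO" "nrm BO (T \<otimes>\<^bsub>BO\<^esub> S) \<le> nrm BO T * nrm BO S"
proof -
  have le: "nrm V (T (S x)) \<le> nrm BO T * nrm BO S * nrm V x" if x: "x \<in> carrier V" for x
    using order_trans[OF BO_norm[OF T BO_linearD(1)[OF S x]] mult_left_mono[OF BO_norm[OF S x] BO_nonneg[OF T]]]
    by (simp add: mult.assoc)
  have "restrict (\<lambda>x. T (S x)) (carrier V) \<in> carrier BO \<and> nrm BO (restrict (\<lambda>x. T (S x)) (carrier V)) \<le> nrm BO T * nrm BO S"
    by (rule BO_restrict[where c = "nrm BO T * nrm BO S"])
      (use le BO_linearD[OF T] BO_linearD[OF S] BO_nonneg[OF T] BO_nonneg[OF S] in auto)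
  then show "T \<otimes>\<^bsub>BO\<^esub> S \<in> carrier BO" "nrm BO (T \<otimes>\<^bsub>BO\<^esub> S) \<le> nrm BO T * nrm BO S"
    unfolding BO_simps(4) by auto
qed

lemma banach_algebra_BO: "banach_algebra BO"
proof -
  interpret B: banach_space BO by (rule banach_space_BO)
  show ?thesis
  proof (intro banach_algebra.intro banach_algebra_axioms.intro B.banach_space_axioms)
    note BO_linearD[simp]
    show "contractive_bilinear BO BO BO (\<lambda>a b. a \<otimes>\<^bsub>BO\<^esub> b)"
      unfolding contractive_bilinear_def linear_map_def
    proof (intro conjI ballI allI)
      show "R \<otimes>\<^bsub>BO\<^esub> (T \<oplus>\<^bsub>BO\<^esub> S) = R \<otimes>\<^bsub>BO\<^esub> T \<oplus>\<^bsub>BO\<^esub> R \<otimes>\<^bsub>BO\<^esub> S"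
        if "R \<in> carrier BO" "T \<in> carrier BO" "S \<in> carrier BO" for R T S
        by (rule BO_eqI) ((intro BO_mult B.add_mem that)+, use that in \<open>simp add: BO_simps(2,4)\<close>)
      show "(T \<oplus>\<^bsub>BO\<^esub> S) \<otimes>\<^bsub>BO\<^esub> R = T \<otimes>\<^bsub>BO\<^esub> R \<oplus>\<^bsub>BO\<^esub> S \<otimes>\<^bsub>BO\<^esub> R"
        if "R \<in> carrier BO" "T \<in> carrier BO" "S \<in> carrier BO" for R T S
        by (rule BO_eqI) ((intro BO_mult B.add_mem that)+, use that in \<open>simp add: BO_simps(2,4)\<close>)
      show "R \<otimes>\<^bsub>BO\<^esub> (c \<odot>\<^bsub>BO\<^esub> T) = c \<odot>\<^bsub>BO\<^esub> (R \<otimes>\<^bsub>BO\<^esub> T)" "(c \<odot>\<^bsub>BO\<^esub> R) \<otimes>\<^bsub>BO\<^esub> T = c \<odot>\<^bsub>BO\<^esub> (R \<otimes>\<^bsub>BO\<^esub> T)"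
        if "R \<in> carrier BO" "T \<in> carrier BO" for R T c
        by (rule BO_eqI, (intro BO_mult B.smult_mem that)+, use that in \<open>simp add: BO_simps(3,4)\<close>)+
    qed (auto intro: BO_mult)
    show "(R \<otimes>\<^bsub>BO\<^esub> T) \<otimes>\<^bsub>BO\<^esub> S = R \<otimes>\<^bsub>BO\<^esub> (T \<otimes>\<^bsub>BO\<^esub> S)"
      if "R \<in> carrier BO" "T \<in> carrier BO" "S \<in> carrier BO" for R T S
      by (rule BO_eqI) ((intro BO_mult that)+, use that in \<open>simp add: BO_simps(4)\<close>)
  qed
qed

end

section \<open>Morita equivalence inside an ambient Banach algebra\<close>

lemma contractive_bilinearD:
  assumes "contractive_bilinear V W Z f"
  shows "x \<in> carrier V \<Longrightarrow> linear_map W Z (\<lambda>y. f x y)" "y \<in> carrier W \<Longrightarrow> linear_map V Z (\<lambda>x. f x y)"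
    "\<lbrakk>x \<in> carrier V; y \<in> carrier W\<rbrakk> \<Longrightarrow> nrm Z (f x y) \<le> nrm V x * nrm W y"
    "\<lbrakk>x \<in> carrier V; y \<in> carrier W\<rbrakk> \<Longrightarrow> f x y \<in> carrier Z"
  using assms unfolding contractive_bilinear_def linear_map_def by auto

text \<open>The homomorphism into the operators of the pair amounts to two contractive module actions, and
the conditions that it and the pair satisfy are associativity laws for products of three factors.\<close>

lemma banach_correspondenceI:
  assumes A: "normed_space A" and X: "banach_space X" and Y: "banach_space Y"
    and bx: "contractive_bilinear B X X bx" and yb: "contractive_bilinear Y B Y yb"
    and ip: "contractive_bilinear X Y B ip"
    and xa: "contractive_bilinear X A X xa" and ay: "contractive_bilinear A Y Y ay"
    and bbx: "\<And>b b' x. \<lbrakk>b \<in> carrier B; b' \<in> carrier B; x \<in> carrier X\<rbrakk> \<Longrightarrow> bx (b \<otimes>\<^bsub>B\<^esub> b') x = bx b (bx b' x)"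
    and ybb: "\<And>b b' y. \<lbrakk>b \<in> carrier B; b' \<in> carrier B; y \<in> carrier Y\<rbrakk> \<Longrightarrow> yb y (b \<otimes>\<^bsub>B\<^esub> b') = yb (yb y b) b'"
    and bxy: "\<And>b x y. \<lbrakk>b \<in> carrier B; x \<in> carrier X; y \<in> carrier Y\<rbrakk> \<Longrightarrow> ip (bx b x) y = b \<otimes>\<^bsub>B\<^esub> ip x y"
    and xyb: "\<And>b x y. \<lbrakk>b \<in> carrier B; x \<in> carrier X; y \<in> carrier Y\<rbrakk> \<Longrightarrow> ip x (yb y b) = ip x y \<otimes>\<^bsub>B\<^esub> b"
    and bxa: "\<And>b x a. \<lbrakk>b \<in> carrier B; x \<in> carrier X; a \<in> carrier A\<rbrakk> \<Longrightarrow> xa (bx b x) a = bx b (xa x a)"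
    and ayb: "\<And>a y b. \<lbrakk>b \<in> carrier B; y \<in> carrier Y; a \<in> carrier A\<rbrakk> \<Longrightarrow> ay a (yb y b) = yb (ay a y) b"
    and xay: "\<And>x a y. \<lbrakk>x \<in> carrier X; a \<in> carrier A; y \<in> carrier Y\<rbrakk> \<Longrightarrow> ip (xa x a) y = ip x (ay a y)"
    and xaa: "\<And>x a a'. \<lbrakk>x \<in> carrier X; a \<in> carrier A; a' \<in> carrier A\<rbrakk> \<Longrightarrow> xa x (a \<otimes>\<^bsub>A\<^esub> a') = xa (xa x a) a'"
    and aay: "\<And>y a a'. \<lbrakk>y \<in> carrier Y; a \<in> carrier A; a' \<in> carrier A\<rbrakk> \<Longrightarrow> ay (a \<otimes>\<^bsub>A\<^esub> a') y = ay a (ay a' y)"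
  shows "banach_correspondence A B X Y bx yb ip xa ay"
proof -
  interpret A: normed_space A by fact
  interpret X: banach_space X by fact
  interpret Y: banach_space Y by fact
  note bx = contractive_bilinearD[OF bx] and yb = contractive_bilinearD[OF yb]
    and xa' = contractive_bilinearD[OF xa] and ay' = contractive_bilinearD[OF ay]
  let ?P = "\<lambda>a. \<lambda>x\<in>carrier X. xa x a" and ?Q = "\<lambda>a. \<lambda>y\<in>carrier Y. ay a y"
  have P: "?P a \<in> carrier X.BO \<and> nrm X.BO (?P a) \<le> nrm A a" if a: "a \<in> carrier A" for a
    by (rule X.BO_restrict; use linear_mapD[OF xa'(2)[OF a]] A.nrm_nonneg[OF a] xa'(3)[OF _ a]
        in \<open>auto simp: mult.commute\<close>)
  have Q: "?Q a \<in> carrier Y.BO \<and> nrm Y.BO (?Q a) \<le> nrm A a" if a: "a \<in> carrier A" for a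
    by (rule Y.BO_restrict; use linear_mapD[OF ay'(1)[OF a]] A.nrm_nonneg[OF a] ay'(3)[OF a]
        in auto)
  let ?L = "pair_operators B X Y bx yb ip"
  have mem: "(?P a, ?Q a) \<in> carrier ?L" if a: "a \<in> carrier A" for a
    using P[OF a] Q[OF a] a bx(4) yb(4) xa'(4) ay'(4)
    by (auto simp: pair_operators_def bxa ayb xay)
  have "contractive_hom A ?L (\<lambda>a. (?P a, ?Q a))"
    unfolding contractive_hom_def linear_map_def
  proof (intro conjI ballI allI)
    fix a a' c assume a: "a \<in> carrier A" and a': "a' \<in> carrier A"
    show "(?P (a \<oplus>\<^bsub>A\<^esub> a'), ?Q (a \<oplus>\<^bsub>A\<^esub> a')) = (?P a, ?Q a) \<oplus>\<^bsub>?L\<^esub> (?P a', ?Q a')"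
      using linear_mapD(2)[OF xa'(1) a a'] linear_mapD(2)[OF ay'(2) a a']
      by (auto simp: pair_operators_def X.BO_simps Y.BO_simps intro!: restrict_ext)
    show "(?P (a \<otimes>\<^bsub>A\<^esub> a'), ?Q (a \<otimes>\<^bsub>A\<^esub> a')) = (?P a, ?Q a) \<otimes>\<^bsub>?L\<^esub> (?P a', ?Q a')"
      using a a' xa'(4) ay'(4)
      by (auto simp: pair_operators_def X.BO_simps Y.BO_simps xaa aay intro!: restrict_ext)
  next
    fix a c assume a: "a \<in> carrier A"
    show "(?P (c \<odot>\<^bsub>A\<^esub> a), ?Q (c \<odot>\<^bsub>A\<^esub> a)) = c \<odot>\<^bsub>?L\<^esub> (?P a, ?Q a)"
      using linear_mapD(3)[OF xa'(1) a] linear_mapD(3)[OF ay'(2) a]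
      by (auto simp: pair_operators_def X.BO_simps Y.BO_simps intro!: restrict_ext)
    show "nrm ?L (?P a, ?Q a) \<le> nrm A a"
      using P[OF a] Q[OF a] by (simp add: pair_operators_def X.BO_simps Y.BO_simps)
  qed (rule mem)
  moreover have "banach_pair B X Y bx yb ip"
    unfolding banach_pair_def left_banach_module_def right_banach_module_def
    by (intro conjI ballI; fact assms | rule bbx ybb bxy xyb; assumption)
  ultimately show ?thesis unfolding banach_correspondence_def by blast
qed

context banach_algebra
begin

lemma mult_mem: "\<lbrakk>a \<in> carrier A; b \<in> carrier A\<rbrakk> \<Longrightarrow> a \<otimes> b \<in> carrier A"
  using contractive_bilinearD(4)[OF mult_bilinear] by auto

text \<open>With one factor fixed, the factors whose product lands in \<open>K\<close> form a closed subspace.  Using this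
first in the right and then in the left factor extends the claim from generators to all elements.\<close>

lemma product_of_generated:
  assumes V: "normed_space V" and W: "normed_space W"
    and i: "isometric_embedding V A i" and j: "isometric_embedding W A j"
    and G: "generates V G" and G': "generates W G'"
    and K: "closed_subspace A K"
    and prod: "\<And>g h. \<lbrakk>g \<in> G; h \<in> G'\<rbrakk> \<Longrightarrow> i g \<otimes> j h \<in> K"
    and v: "v \<in> carrier V" and w: "w \<in> carrier W"
  shows "i v \<otimes> j w \<in> K"
proof -
  note mult = contractive_bilinearD[OF mult_bilinear]
  have lin: "linear_map V A i" "linear_map W A j"
    and nrm: "\<And>x. x \<in> carrier V \<Longrightarrow> nrm A (i x) = nrm V x" "\<And>x. x \<in> carrier W \<Longrightarrow> nrm A (j x) = nrm W x"
    using i j by (auto simp: isometric_embedding_def)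
  note iD = linear_mapD[OF lin(1)] and jD = linear_mapD[OF lin(2)]
  have left: "bounded_linear_map W A (\<lambda>w. i v \<otimes> j w)" if v: "v \<in> carrier V" for v
  proof (rule bounded_linear_mapI[where c = "nrm V v"])
    show "linear_map W A (\<lambda>w. i v \<otimes> j w)"
      using linear_mapD[OF mult(1)[OF iD(1)[OF v]]] jD by (simp add: linear_map_def)
    show "nrm A (i v \<otimes> j w) \<le> nrm V v * nrm W w" if "w \<in> carrier W" for w
      using mult(3)[OF iD(1)[OF v] jD(1)[OF that]] v that by (simp add: nrm)
  qed
  have right: "bounded_linear_map V A (\<lambda>v. i v \<otimes> j w)" if w: "w \<in> carrier W" for w
  proof (rule bounded_linear_mapI[where c = "nrm W w"])
    show "linear_map V A (\<lambda>v. i v \<otimes> j w)"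
      using linear_mapD[OF mult(2)[OF jD(1)[OF w]]] iD by (simp add: linear_map_def)
    show "nrm A (i v \<otimes> j w) \<le> nrm W w * nrm V v" if "v \<in> carrier V" for v
      using mult(3)[OF iD(1)[OF that] jD(1)[OF w]] w that by (simp add: nrm mult.commute)
  qed
  have *: "i g \<otimes> j w \<in> K" if g: "g \<in> G" and w: "w \<in> carrier W" for g w
  proof -
    have gV: "g \<in> carrier V" using g G by (auto simp: generates_def)
    have "closed_subspace W {w \<in> carrier W. i g \<otimes> j w \<in> K}"
      by (rule closed_subspace_vimage[OF W normed_space_axioms left[OF gV] K])
    moreover have "G' \<subseteq> {w \<in> carrier W. i g \<otimes> j w \<in> K}" using prod[OF g] G' by (auto simp: generates_def)
    ultimately show ?thesis using G' w unfolding generates_def by blast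
  qed
  have "closed_subspace V {v \<in> carrier V. i v \<otimes> j w \<in> K}"
    by (rule closed_subspace_vimage[OF V normed_space_axioms right[OF w] K])
  moreover have "G \<subseteq> {v \<in> carrier V. i v \<otimes> j w \<in> K}" using *[OF _ w] G by (auto simp: generates_def)
  ultimately show ?thesis using G v unfolding generates_def by blast
qed

text \<open>The map \<open>m\<close> is the multiplication of the ambient algebra read through the three embeddings.\<close>

lemma pulled_back_product:
  assumes Z: "normed_space Z" and V: "normed_space V" and W: "normed_space W"
    and i: "isometric_embedding V A i" and j: "isometric_embedding W A j" and k: "isometric_embedding Z A k"
    and prod: "\<And>v w. \<lbrakk>v \<in> carrier V; w \<in> carrier W\<rbrakk> \<Longrightarrow> i v \<otimes> j w \<in> k ` carrier Z"
  obtains m where "contractive_bilinear V W Z m"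
    "\<forall>v\<in>carrier V. \<forall>w\<in>carrier W. k (m v w) = i v \<otimes> j w"
proof
  define m where "m v w = inv_into (carrier Z) k (i v \<otimes> j w)" for v w
  interpret V: normed_space V by fact
  interpret W: normed_space W by fact
  interpret Z: normed_space Z by fact
  note mult = contractive_bilinearD[OF mult_bilinear]
  have lin: "linear_map V A i" "linear_map W A j" "linear_map Z A k"
    and nrm: "\<And>x. x \<in> carrier V \<Longrightarrow> nrm A (i x) = nrm V x" "\<And>x. x \<in> carrier W \<Longrightarrow> nrm A (j x) = nrm W x"
      "\<And>x. x \<in> carrier Z \<Longrightarrow> nrm A (k x) = nrm Z x"
    using i j k by (auto simp: isometric_embedding_def)
  note iD = linear_mapD[OF lin(1)] and jD = linear_mapD[OF lin(2)] and kD = linear_mapD[OF lin(3)]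
  have km: "k (m v w) = i v \<otimes> j w" if "v \<in> carrier V" "w \<in> carrier W" for v w
    unfolding m_def by (rule f_inv_into_f[OF prod[OF that]])
  have mZ: "m v w \<in> carrier Z" if "v \<in> carrier V" "w \<in> carrier W" for v w
    unfolding m_def by (rule inv_into_into[OF prod[OF that]])
  have eqI: "x = y" if "k x = k y" "x \<in> carrier Z" "y \<in> carrier Z" for x y
    using isometric_embedding_inj[OF Z normed_space_axioms k] that by (auto dest: inj_onD)
  show "\<forall>v\<in>carrier V. \<forall>w\<in>carrier W. k (m v w) = i v \<otimes> j w" using km by blast
  show "contractive_bilinear V W Z m"
    unfolding contractive_bilinear_def linear_map_def
  proof (intro conjI ballI allI)
    fix v w assume v: "v \<in> carrier V" and w: "w \<in> carrier W"
    show "m v w \<in> carrier Z" by (rule mZ[OF v w])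
    show "m v w \<in> carrier Z" by (rule mZ[OF v w])
    show "nrm Z (m v w) \<le> nrm V v * nrm W w"
      using mult(3)[OF iD(1)[OF v] jD(1)[OF w]] v w by (simp add: nrm(3)[symmetric] mZ km) (simp add: nrm)
    fix c
    show "m v (c \<odot>\<^bsub>W\<^esub> w) = c \<odot>\<^bsub>Z\<^esub> m v w"
      using v w linear_mapD(3)[OF mult(1)[OF iD(1)[OF v]] jD(1)[OF w], of c]
      by (intro eqI) (simp_all add: mZ km kD jD)
    show "m (c \<odot>\<^bsub>V\<^esub> v) w = c \<odot>\<^bsub>Z\<^esub> m v w"
      using v w linear_mapD(3)[OF mult(2)[OF jD(1)[OF w]] iD(1)[OF v], of c]
      by (intro eqI) (simp_all add: mZ km kD iD)
  next
    fix v w w' assume v: "v \<in> carrier V" and w: "w \<in> carrier W" "w' \<in> carrier W"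
    show "m v (w \<oplus>\<^bsub>W\<^esub> w') = m v w \<oplus>\<^bsub>Z\<^esub> m v w'"
      using v w linear_mapD(2)[OF mult(1)[OF iD(1)[OF v]] jD(1)[OF w(1)] jD(1)[OF w(2)]]
      by (intro eqI) (simp_all add: mZ km kD jD)
  next
    fix v v' w assume v: "v \<in> carrier V" "v' \<in> carrier V" and w: "w \<in> carrier W"
    show "m (v \<oplus>\<^bsub>V\<^esub> v') w = m v w \<oplus>\<^bsub>Z\<^esub> m v' w"
      using v w linear_mapD(2)[OF mult(2)[OF jD(1)[OF w]] iD(1)[OF v(1)] iD(1)[OF v(2)]]
      by (intro eqI) (simp_all add: mZ km kD iD)
  qed
qed

end

definition transport :: "('a \<Rightarrow> 'b) \<Rightarrow> 'a cnormed \<Rightarrow> 'a set \<Rightarrow> 'b cnormed" where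
  "transport \<phi> E U = (let \<psi> = inv_into (carrier E) \<phi> in
     \<lparr>carrier = \<phi> ` U, mult = (\<lambda>x y. \<phi> (\<psi> x \<otimes>\<^bsub>E\<^esub> \<psi> y)), one = \<phi> \<one>\<^bsub>E\<^esub>, zero = \<phi> \<zero>\<^bsub>E\<^esub>,
      add = (\<lambda>x y. \<phi> (\<psi> x \<oplus>\<^bsub>E\<^esub> \<psi> y)), smult = (\<lambda>c x. \<phi> (c \<odot>\<^bsub>E\<^esub> \<psi> x)), nrm = (\<lambda>x. nrm E (\<psi> x))\<rparr>)"

lemma transported_subspace:
  assumes E: "banach_space E" and inj: "inj_on \<phi> (carrier E)" and G: "G \<subseteq> carrier E"
  defines "V \<equiv> transport \<phi> E (closed_span E G)" and "i \<equiv> inv_into (carrier E) \<phi>"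
  shows "banach_space V" "isometric_embedding V E i" "generates V (\<phi> ` G)"
    "\<And>g. g \<in> G \<Longrightarrow> i (\<phi> g) = g"
proof -
  interpret E: banach_space E by fact
  have U: "closed_subspace E (closed_span E G)" (is "closed_subspace E ?U") by (rule E.closed_span_closed[OF G])
  note UD = closed_subspaceD[OF U]
  have i[simp]: "i (\<phi> x) = x" if "x \<in> carrier E" for x
    unfolding i_def by (rule inv_into_f_f[OF inj that])
  have iU[simp]: "i (\<phi> x) = x" if "x \<in> ?U" for x using that UD(1) by auto
  have V: "carrier V = \<phi> ` ?U" "\<zero>\<^bsub>V\<^esub> = \<phi> \<zero>\<^bsub>E\<^esub>" "\<And>x y. x \<oplus>\<^bsub>V\<^esub> y = \<phi> (i x \<oplus>\<^bsub>E\<^esub> i y)"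
    "\<And>c x. c \<odot>\<^bsub>V\<^esub> x = \<phi> (c \<odot>\<^bsub>E\<^esub> i x)" "\<And>x. nrm V x = nrm E (i x)"
    by (simp_all add: V_def transport_def i_def Let_def)
  have im: "i ` carrier V = ?U" unfolding V by (force simp: image_image)
  have bs: "banach_space V" and iso: "isometric_embedding V E i"
  proof -
    have inj_i: "inj_on i (carrier V)" unfolding V by (auto intro!: inj_onI)
    have ops: "i \<zero>\<^bsub>V\<^esub> = \<zero>\<^bsub>E\<^esub>" "\<zero>\<^bsub>V\<^esub> \<in> carrier V"
      "\<And>x y. \<lbrakk>x \<in> carrier V; y \<in> carrier V\<rbrakk> \<Longrightarrow> x \<oplus>\<^bsub>V\<^esub> y \<in> carrier V"
      "\<And>x y. \<lbrakk>x \<in> carrier V; y \<in> carrier V\<rbrakk> \<Longrightarrow> i (x \<oplus>\<^bsub>V\<^esub> y) = i x \<oplus>\<^bsub>E\<^esub> i y"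
      "\<And>c x. x \<in> carrier V \<Longrightarrow> c \<odot>\<^bsub>V\<^esub> x \<in> carrier V"
      "\<And>c x. x \<in> carrier V \<Longrightarrow> i (c \<odot>\<^bsub>V\<^esub> x) = c \<odot>\<^bsub>E\<^esub> i x"
      using UD(2-4) by (auto simp: V)
    have cl: "closed_subspace E (i ` carrier V)" unfolding im by (rule U)
    note * = banach_space_pullback[OF E cl inj_i ops(2,3,5,1,4,6) V(5)]
    show "banach_space V" by (rule *(1))
    show "isometric_embedding V E i" by (rule *(2))
  qed
  show "banach_space V" "isometric_embedding V E i" by fact+
  show "i (\<phi> g) = g" if "g \<in> G" for g using that G by auto
  have GU: "G \<subseteq> ?U" unfolding closed_span_def by (rule hull_subset)
  show "generates V (\<phi> ` G)"
    unfolding generates_def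
  proof (intro conjI allI impI; (elim conjE)?)
    show "\<phi> ` G \<subseteq> carrier V" using GU V by auto
    fix H assume H: "closed_subspace V H" "\<phi> ` G \<subseteq> H"
    have cl: "closed_subspace E (i ` H)" by (rule isometric_embedding_image[OF bs E.normed_space_axioms iso H(1)])
    have "G \<subseteq> i ` H" using H(2) G by force
    then have "?U \<subseteq> i ` H" unfolding closed_span_def by (rule hull_minimal) (fact cl)
    then show "carrier V \<subseteq> H"
      using closed_subspaceD(1)[OF H(1)] inj_onD[OF isometric_embedding_inj[OF banach_space.axioms(1)[OF bs] E.normed_space_axioms iso]]
      unfolding im[symmetric] by blast
  qed
qed

text \<open>The bimodules are the closed spans of \<open>U\<close> and \<open>V\<close>, moved along the injections \<open>\<phi>\<close> and \<open>\<psi>\<close> into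
the types required of them.  All six products are multiplication in \<open>E\<close>, so that every associativity
law follows by injectivity of the embeddings from associativity in \<open>E\<close>; the products of generators
make the products land in the right subspaces and make the required spans dense.\<close>

theorem morita_equivalent_of_embeddings:
  fixes E :: "'e cnormed" and A :: "'a cnormed" and B :: "'b cnormed"
    and \<phi> :: "'e \<Rightarrow> 'x" and \<psi> :: "'e \<Rightarrow> 'y"
  assumes E: "banach_algebra E" and A: "banach_algebra A" and B: "banach_algebra B"
    and iA: "isometric_embedding A E i"
    and iA_mult: "\<And>a a'. \<lbrakk>a \<in> carrier A; a' \<in> carrier A\<rbrakk> \<Longrightarrow> i (a \<otimes>\<^bsub>A\<^esub> a') = i a \<otimes>\<^bsub>E\<^esub> i a'"
    and iB: "isometric_embedding B E j"
    and iB_mult: "\<And>b b'. \<lbrakk>b \<in> carrier B; b' \<in> carrier B\<rbrakk> \<Longrightarrow> j (b \<otimes>\<^bsub>B\<^esub> b') = j b \<otimes>\<^bsub>E\<^esub> j b'"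
    and GA: "generates A GA" and GB: "generates B GB"
    and UE: "U \<subseteq> carrier E" and VE: "V \<subseteq> carrier E"
    and \<phi>: "inj_on \<phi> (carrier E)" and \<psi>: "inj_on \<psi> (carrier E)"
    and BU: "\<And>b u. \<lbrakk>b \<in> GB; u \<in> U\<rbrakk> \<Longrightarrow> j b \<otimes>\<^bsub>E\<^esub> u \<in> U"
    and UA: "\<And>a u. \<lbrakk>a \<in> GA; u \<in> U\<rbrakk> \<Longrightarrow> u \<otimes>\<^bsub>E\<^esub> i a \<in> U"
    and AV: "\<And>a v. \<lbrakk>a \<in> GA; v \<in> V\<rbrakk> \<Longrightarrow> i a \<otimes>\<^bsub>E\<^esub> v \<in> V"
    and VB: "\<And>b v. \<lbrakk>b \<in> GB; v \<in> V\<rbrakk> \<Longrightarrow> v \<otimes>\<^bsub>E\<^esub> j b \<in> V"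
    and UV: "\<And>u v. \<lbrakk>u \<in> U; v \<in> V\<rbrakk> \<Longrightarrow> u \<otimes>\<^bsub>E\<^esub> v \<in> j ` GB"
    and VU: "\<And>u v. \<lbrakk>u \<in> U; v \<in> V\<rbrakk> \<Longrightarrow> v \<otimes>\<^bsub>E\<^esub> u \<in> i ` GA"
    and fullB: "\<And>b. b \<in> GB \<Longrightarrow> \<exists>u\<in>U. \<exists>v\<in>V. u \<otimes>\<^bsub>E\<^esub> v = j b"
    and fullA: "\<And>a. a \<in> GA \<Longrightarrow> \<exists>v\<in>V. \<exists>u\<in>U. v \<otimes>\<^bsub>E\<^esub> u = i a"
    and ndBU: "\<And>u. u \<in> U \<Longrightarrow> \<exists>b\<in>GB. \<exists>u'\<in>U. j b \<otimes>\<^bsub>E\<^esub> u' = u"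
    and ndUA: "\<And>u. u \<in> U \<Longrightarrow> \<exists>u'\<in>U. \<exists>a\<in>GA. u' \<otimes>\<^bsub>E\<^esub> i a = u"
    and ndAV: "\<And>v. v \<in> V \<Longrightarrow> \<exists>a\<in>GA. \<exists>v'\<in>V. i a \<otimes>\<^bsub>E\<^esub> v' = v"
    and ndVB: "\<And>v. v \<in> V \<Longrightarrow> \<exists>v'\<in>V. \<exists>b\<in>GB. v' \<otimes>\<^bsub>E\<^esub> j b = v"
  shows "morita_equivalent TYPE('x) TYPE('y) A B"
proof -
  interpret E: banach_algebra E by fact
  interpret A: banach_algebra A by fact
  interpret B: banach_algebra B by fact
  define X where "X = transport \<phi> E (closed_span E U)"
  define Y where "Y = transport \<psi> E (closed_span E V)"
  define k where "k = inv_into (carrier E) \<phi>"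
  define l where "l = inv_into (carrier E) \<psi>"
  note X = transported_subspace[OF E.banach_space_axioms \<phi> UE, folded X_def k_def]
  note Y = transported_subspace[OF E.banach_space_axioms \<psi> VE, folded Y_def l_def]
  interpret X: banach_space X by (rule X(1))
  interpret Y: banach_space Y by (rule Y(1))
  note spaces = A.normed_space_axioms B.normed_space_axioms X.normed_space_axioms Y.normed_space_axioms
  note emb = iA iB X(2) Y(2)
  have GA': "GA \<subseteq> carrier A" "GB \<subseteq> carrier B" "\<phi> ` U \<subseteq> carrier X" "\<psi> ` V \<subseteq> carrier Y"
    using GA GB X(3) Y(3) by (auto simp: generates_def)
  have KA: "closed_subspace E (i ` carrier A)" and KB: "closed_subspace E (j ` carrier B)"
    and KX: "closed_subspace E (k ` carrier X)" and KY: "closed_subspace E (l ` carrier Y)"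
    using isometric_embedding_image[OF _ E.normed_space_axioms] emb A.banach_space_axioms B.banach_space_axioms
      X(1) Y(1) spaces[THEN normed_space.closed_subspace_carrier] by blast+
  have UX: "u \<in> k ` carrier X" if "u \<in> U" for u using X(4)[OF that] GA'(3) that by (metis image_eqI image_subset_iff)
  have VY: "v \<in> l ` carrier Y" if "v \<in> V" for v using Y(4)[OF that] GA'(4) that by (metis image_eqI image_subset_iff)
  obtain bx where bx: "contractive_bilinear B X X bx"
    "\<forall>b\<in>carrier B. \<forall>x\<in>carrier X. k (bx b x) = j b \<otimes>\<^bsub>E\<^esub> k x"
  proof (rule E.pulled_back_product[OF spaces(3,2,3) emb(2,3,3)])
    show "j b \<otimes>\<^bsub>E\<^esub> k x \<in> k ` carrier X" if "b \<in> carrier B" "x \<in> carrier X" for b x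
      by (rule E.product_of_generated[OF spaces(2,3) emb(2,3) GB X(3) KX _ that]) (auto simp: X(4) intro!: UX BU)
  qed
  obtain xa where xa: "contractive_bilinear X A X xa"
    "\<forall>x\<in>carrier X. \<forall>a\<in>carrier A. k (xa x a) = k x \<otimes>\<^bsub>E\<^esub> i a"
  proof (rule E.pulled_back_product[OF spaces(3,3,1) emb(3,1,3)])
    show "k x \<otimes>\<^bsub>E\<^esub> i a \<in> k ` carrier X" if "x \<in> carrier X" "a \<in> carrier A" for a x
      by (rule E.product_of_generated[OF spaces(3,1) emb(3,1) X(3) GA KX _ that]) (auto simp: X(4) intro!: UX UA)
  qed
  obtain ay where ay: "contractive_bilinear A Y Y ay"
    "\<forall>a\<in>carrier A. \<forall>y\<in>carrier Y. l (ay a y) = i a \<otimes>\<^bsub>E\<^esub> l y"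
  proof (rule E.pulled_back_product[OF spaces(4,1,4) emb(1,4,4)])
    show "i a \<otimes>\<^bsub>E\<^esub> l y \<in> l ` carrier Y" if "a \<in> carrier A" "y \<in> carrier Y" for a y
      by (rule E.product_of_generated[OF spaces(1,4) emb(1,4) GA Y(3) KY _ that]) (auto simp: Y(4) intro!: VY AV)
  qed
  obtain yb where yb: "contractive_bilinear Y B Y yb"
    "\<forall>y\<in>carrier Y. \<forall>b\<in>carrier B. l (yb y b) = l y \<otimes>\<^bsub>E\<^esub> j b"
  proof (rule E.pulled_back_product[OF spaces(4,4,2) emb(4,2,4)])
    show "l y \<otimes>\<^bsub>E\<^esub> j b \<in> l ` carrier Y" if "y \<in> carrier Y" "b \<in> carrier B" for b y
      by (rule E.product_of_generated[OF spaces(4,2) emb(4,2) Y(3) GB KY _ that]) (auto simp: Y(4) intro!: VY VB)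
  qed
  obtain ipB where ipB: "contractive_bilinear X Y B ipB"
    "\<forall>x\<in>carrier X. \<forall>y\<in>carrier Y. j (ipB x y) = k x \<otimes>\<^bsub>E\<^esub> l y"
  proof (rule E.pulled_back_product[OF spaces(2,3,4) emb(3,4,2)])
    show "k x \<otimes>\<^bsub>E\<^esub> l y \<in> j ` carrier B" if "x \<in> carrier X" "y \<in> carrier Y" for x y
      by (rule E.product_of_generated[OF spaces(3,4) emb(3,4) X(3) Y(3) KB _ that])
        (use UV GA' in \<open>auto simp: X(4) Y(4) intro: set_mp[OF image_mono]\<close>)
  qed
  obtain ipA where ipA: "contractive_bilinear Y X A ipA"
    "\<forall>y\<in>carrier Y. \<forall>x\<in>carrier X. i (ipA y x) = l y \<otimes>\<^bsub>E\<^esub> k x"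
  proof (rule E.pulled_back_product[OF spaces(1,4,3) emb(4,3,1)])
    show "l y \<otimes>\<^bsub>E\<^esub> k x \<in> i ` carrier A" if "y \<in> carrier Y" "x \<in> carrier X" for x y
      by (rule E.product_of_generated[OF spaces(4,3) emb(4,3) Y(3) X(3) KA _ that])
        (use VU GA' in \<open>auto simp: X(4) Y(4) intro: set_mp[OF image_mono]\<close>)
  qed
  note mem[simp] = bx(1)[THEN contractive_bilinearD(4)] xa(1)[THEN contractive_bilinearD(4)]
    ay(1)[THEN contractive_bilinearD(4)] yb(1)[THEN contractive_bilinearD(4)]
    ipA(1)[THEN contractive_bilinearD(4)] ipB(1)[THEN contractive_bilinearD(4)]
    A.mult_mem B.mult_mem
  have emb_mem[simp]: "\<And>a. a \<in> carrier A \<Longrightarrow> i a \<in> carrier E" "\<And>a. a \<in> carrier B \<Longrightarrow> j a \<in> carrier E"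
    "\<And>a. a \<in> carrier X \<Longrightarrow> k a \<in> carrier E" "\<And>a. a \<in> carrier Y \<Longrightarrow> l a \<in> carrier E"
    using emb by (auto simp: isometric_embedding_def linear_map_def)
  have eqA: "a = a'" if "i a = i a'" "a \<in> carrier A" "a' \<in> carrier A" for a a'
    using inj_onD[OF isometric_embedding_inj[OF spaces(1) E.normed_space_axioms iA] that] .
  have eqB: "a = a'" if "j a = j a'" "a \<in> carrier B" "a' \<in> carrier B" for a a'
    using inj_onD[OF isometric_embedding_inj[OF spaces(2) E.normed_space_axioms iB] that] .
  have eqX: "a = a'" if "k a = k a'" "a \<in> carrier X" "a' \<in> carrier X" for a a'
    using inj_onD[OF isometric_embedding_inj[OF spaces(3) E.normed_space_axioms X(2)] that] .
  have eqY: "a = a'" if "l a = l a'" "a \<in> carrier Y" "a' \<in> carrier Y" for a a'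
    using inj_onD[OF isometric_embedding_inj[OF spaces(4) E.normed_space_axioms Y(2)] that] .
  note hom = iA_mult iB_mult bx(2) xa(2) ay(2) yb(2) ipA(2) ipB(2) E.mult_assoc
  have "banach_correspondence A B X Y bx yb ipB xa ay"
    by (rule banach_correspondenceI[OF spaces(1) X(1) Y(1) bx(1) yb(1) ipB(1) xa(1) ay(1)];
        (rule eqA eqB eqX eqY, simp_all add: hom))
  moreover have "banach_correspondence B A Y X ay xa ipA yb bx"
    by (rule banach_correspondenceI[OF spaces(2) Y(1) X(1) ay(1) xa(1) ipA(1) yb(1) bx(1)];
        (rule eqA eqB eqX eqY, simp_all add: hom))
  moreover have "full_pair B X Y ipB"
    unfolding full_pair_def
  proof (rule B.dense_spanI[OF GB])
    show "GB \<subseteq> {ipB x y |x y. x \<in> carrier X \<and> y \<in> carrier Y}"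
    proof
      fix b assume b: "b \<in> GB"
      then obtain u v where uv: "u \<in> U" "v \<in> V" "u \<otimes>\<^bsub>E\<^esub> v = j b" using fullB by blast
      then have m: "\<phi> u \<in> carrier X" "\<psi> v \<in> carrier Y" using GA' by auto
      then have "b = ipB (\<phi> u) (\<psi> v)"
        using uv b GA' by (intro eqB) (auto simp: hom X(4) Y(4))
      then show "b \<in> {ipB x y |x y. x \<in> carrier X \<and> y \<in> carrier Y}" using m by blast
    qed
  qed auto
  moreover have "full_pair A Y X ipA"
    unfolding full_pair_def
  proof (rule A.dense_spanI[OF GA])
    show "GA \<subseteq> {ipA y x |y x. y \<in> carrier Y \<and> x \<in> carrier X}"
    proof
      fix a assume a: "a \<in> GA"
      then obtain u v where uv: "u \<in> U" "v \<in> V" "v \<otimes>\<^bsub>E\<^esub> u = i a" using fullA by blast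
      then have m: "\<phi> u \<in> carrier X" "\<psi> v \<in> carrier Y" using GA' by auto
      then have "a = ipA (\<psi> v) (\<phi> u)"
        using uv a GA' by (intro eqA) (auto simp: hom X(4) Y(4))
      then show "a \<in> {ipA y x |y x. y \<in> carrier Y \<and> x \<in> carrier X}" using m by blast
    qed
  qed auto
  moreover have "dense_span X {bx b x |b x. b \<in> carrier B \<and> x \<in> carrier X}"
  proof (rule X.dense_spanI[OF X(3)])
    show "\<phi> ` U \<subseteq> {bx b x |b x. b \<in> carrier B \<and> x \<in> carrier X}"
    proof
      fix x assume "x \<in> \<phi> ` U"
      then obtain u where u: "u \<in> U" "x = \<phi> u" by blast
      then obtain b u' where uv: "b \<in> GB" "u' \<in> U" "j b \<otimes>\<^bsub>E\<^esub> u' = u" using ndBU by blast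
      then have m: "\<phi> u \<in> carrier X" "\<phi> u' \<in> carrier X" "b \<in> carrier B" using GA' u by auto
      then have "x = bx b (\<phi> u')"
        using uv u by (intro eqX) (auto simp: hom X(4))
      then show "x \<in> {bx b x |b x. b \<in> carrier B \<and> x \<in> carrier X}" using m by blast
    qed
  qed auto
  moreover have "dense_span X {xa x a |x a. x \<in> carrier X \<and> a \<in> carrier A}"
  proof (rule X.dense_spanI[OF X(3)])
    show "\<phi> ` U \<subseteq> {xa x a |x a. x \<in> carrier X \<and> a \<in> carrier A}"
    proof
      fix x assume "x \<in> \<phi> ` U"
      then obtain u where u: "u \<in> U" "x = \<phi> u" by blast
      then obtain a u' where uv: "a \<in> GA" "u' \<in> U" "u' \<otimes>\<^bsub>E\<^esub> i a = u" using ndUA by blast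
      then have m: "\<phi> u \<in> carrier X" "\<phi> u' \<in> carrier X" "a \<in> carrier A" using GA' u by auto
      then have "x = xa (\<phi> u') a"
        using uv u by (intro eqX) (auto simp: hom X(4))
      then show "x \<in> {xa x a |x a. x \<in> carrier X \<and> a \<in> carrier A}" using m by blast
    qed
  qed auto
  moreover have "dense_span Y {ay a y |a y. a \<in> carrier A \<and> y \<in> carrier Y}"
  proof (rule Y.dense_spanI[OF Y(3)])
    show "\<psi> ` V \<subseteq> {ay a y |a y. a \<in> carrier A \<and> y \<in> carrier Y}"
    proof
      fix y assume "y \<in> \<psi> ` V"
      then obtain v where v: "v \<in> V" "y = \<psi> v" by blast
      then obtain a v' where uv: "a \<in> GA" "v' \<in> V" "i a \<otimes>\<^bsub>E\<^esub> v' = v" using ndAV by blast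
      then have m: "\<psi> v \<in> carrier Y" "\<psi> v' \<in> carrier Y" "a \<in> carrier A" using GA' v by auto
      then have "y = ay a (\<psi> v')"
        using uv v by (intro eqY) (auto simp: hom Y(4))
      then show "y \<in> {ay a y |a y. a \<in> carrier A \<and> y \<in> carrier Y}" using m by blast
    qed
  qed auto
  moreover have "dense_span Y {yb y b |y b. y \<in> carrier Y \<and> b \<in> carrier B}"
  proof (rule Y.dense_spanI[OF Y(3)])
    show "\<psi> ` V \<subseteq> {yb y b |y b. y \<in> carrier Y \<and> b \<in> carrier B}"
    proof
      fix y assume "y \<in> \<psi> ` V"
      then obtain v where v: "v \<in> V" "y = \<psi> v" by blast
      then obtain b v' where uv: "b \<in> GB" "v' \<in> V" "v' \<otimes>\<^bsub>E\<^esub> j b = v" using ndVB by blast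
      then have m: "\<psi> v \<in> carrier Y" "\<psi> v' \<in> carrier Y" "b \<in> carrier B" using GA' v by auto
      then have "y = yb (\<psi> v') b"
        using uv v by (intro eqY) (auto simp: hom Y(4))
      then show "y \<in> {yb y b |y b. y \<in> carrier Y \<and> b \<in> carrier B}" using m by blast
    qed
  qed auto
  moreover have "bx (ipB x\<^sub>1 y) x\<^sub>2 = xa x\<^sub>1 (ipA y x\<^sub>2)"
    if "x\<^sub>1 \<in> carrier X" "x\<^sub>2 \<in> carrier X" "y \<in> carrier Y" for x\<^sub>1 x\<^sub>2 y
    using that by (intro eqX) (simp_all add: hom)
  moreover have "yb y\<^sub>1 (ipB x y\<^sub>2) = ay (ipA y\<^sub>1 x) y\<^sub>2"
    if "y\<^sub>1 \<in> carrier Y" "y\<^sub>2 \<in> carrier Y" "x \<in> carrier X" for y\<^sub>1 y\<^sub>2 x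
    using that by (intro eqY) (simp_all add: hom)
  ultimately show ?thesis
    unfolding morita_equivalent_def nondegenerate_pair_def
    using A B by blast
qed

section \<open>The spaces \<open>\<ell>\<^sup>p\<close> and their operators\<close>

lemma ell_simps:
  "carrier (ell p) = {f. (\<lambda>t. cmod (f t) powr p) summable_on UNIV}"
  "\<zero>\<^bsub>ell p\<^esub> = (\<lambda>_. 0)" "f \<oplus>\<^bsub>ell p\<^esub> g = (\<lambda>t. f t + g t)" "c \<odot>\<^bsub>ell p\<^esub> f = (\<lambda>t. c * f t)"
  by (simp_all add: ell_def)

abbreviation ell_ops :: "real \<Rightarrow> (('w \<Rightarrow> complex) \<Rightarrow> ('w \<Rightarrow> complex)) cnormed" where
  "ell_ops p \<equiv> bounded_operators (ell p)"

text \<open>The operator on functions induced by a partial map \<open>g\<close> with domain \<open>P\<close>.  If \<open>g\<close> is injective on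
\<open>P\<close>, its inverse is a partial bijection and \<open>pull P g\<close> is the operator that moves the basis vector of
\<open>g w\<close> to that of \<open>w\<close>.\<close>

definition pull :: "('w \<Rightarrow> bool) \<Rightarrow> ('w \<Rightarrow> 'v) \<Rightarrow> ('v \<Rightarrow> complex) \<Rightarrow> 'w \<Rightarrow> complex" where
  "pull P g f = (\<lambda>w. if P w then f (g w) else 0)"

context
  fixes p :: real
  assumes p: "1 \<le> p"
begin

lemma powr_cancel: "0 \<le> x \<Longrightarrow> (x powr p) powr (1 / p) = x" "0 \<le> x \<Longrightarrow> (x powr (1 / p)) powr p = x"
  using p by (simp_all add: powr_powr)

lemma ell_nrm: "nrm (ell p) f = (\<Sum>\<^sub>\<infinity>t. cmod (f t) powr p) powr (1 / p)"
  by (simp add: ell_def)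

lemma ell_nrm_nonneg: "0 \<le> nrm (ell p) f"
  by (simp add: ell_nrm)

lemma ell_nrm_powr: "nrm (ell p) f powr p = (\<Sum>\<^sub>\<infinity>t. cmod (f t) powr p)"
  unfolding ell_nrm by (rule powr_cancel) (rule infsum_nonneg, simp)

lemma ell_sum_le:
  assumes "f \<in> carrier (ell p)" "finite F"
  shows "(\<Sum>t\<in>F. cmod (f t) powr p) \<le> nrm (ell p) f powr p"
  unfolding ell_nrm_powr using assms by (intro finite_sum_le_infsum) (auto simp: ell_simps)

text \<open>Membership and norm bounds in \<open>\<ell>\<^sup>p\<close> reduce to finite partial sums; the estimates below are
made there.\<close>

lemma ell_memI:
  assumes c: "0 \<le> c" and le: "\<And>F. finite F \<Longrightarrow> (\<Sum>t\<in>F. cmod (f t) powr p) \<le> c powr p"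
  shows "f \<in> carrier (ell p) \<and> nrm (ell p) f \<le> c"
proof
  have s: "(\<lambda>t. cmod (f t) powr p) summable_on UNIV"
    by (rule nonneg_bdd_above_summable_on) (use le in \<open>auto intro!: bdd_aboveI2\<close>)
  then show "f \<in> carrier (ell p)" by (simp add: ell_simps)
  have "(\<Sum>\<^sub>\<infinity>t. cmod (f t) powr p) \<le> c powr p"
    using s le by (rule infsum_le_finite_sums)
  then have "nrm (ell p) f \<le> (c powr p) powr (1 / p)"
    unfolding ell_nrm using p by (intro powr_mono2) (auto intro: infsum_nonneg)
  then show "nrm (ell p) f \<le> c" using c by (simp add: powr_cancel)
qed

lemma ell_coord_le:
  assumes "f \<in> carrier (ell p)" shows "cmod (f t) \<le> nrm (ell p) f"
proof -
  have "cmod (f t) powr p \<le> nrm (ell p) f powr p" using ell_sum_le[OF assms, of "{t}"] by simp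
  then show ?thesis using p ell_nrm_nonneg[of f]
    by (meson norm_ge_zero not_le powr_less_mono2 less_le_trans zero_less_one)
qed

text \<open>Minkowski's inequality from convexity of \<open>x \<mapsto> x\<^sup>p\<close>: for \<open>a > \<parallel>f\<parallel>\<close> and \<open>b > \<parallel>g\<parallel>\<close>, the vector
\<open>(f + g) / (a + b)\<close> is a convex combination of \<open>f / a\<close> and \<open>g / b\<close>, which lie in the unit ball.
Strict bounds keep the denominators positive also when \<open>f\<close> or \<open>g\<close> vanishes.\<close>

lemma ell_add:
  assumes f: "f \<in> carrier (ell p)" and g: "g \<in> carrier (ell p)"
  shows "(\<lambda>t. f t + g t) \<in> carrier (ell p) \<and> nrm (ell p) (\<lambda>t. f t + g t) \<le> nrm (ell p) f + nrm (ell p) g"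
proof -
  have *: "(\<lambda>t. f t + g t) \<in> carrier (ell p) \<and> nrm (ell p) (\<lambda>t. f t + g t) \<le> a + b"
    if a: "nrm (ell p) f < a" and b: "nrm (ell p) g < b" for a b
  proof (rule ell_memI)
    have ab: "0 < a" "0 < b" using a b ell_nrm_nonneg[of f] ell_nrm_nonneg[of g] by linarith+
    then show "0 \<le> a + b" by simp
    fix F :: "'a set" assume F: "finite F"
    have conv: "(u * x + v * y) powr p \<le> u * x powr p + v * y powr p"
      if "0 < u" "0 < v" "u + v = 1" "0 \<le> x" "0 \<le> y" for u v x y :: real
    proof -
      have le: "w powr p \<le> w" if "0 < w" "w \<le> 1" for w :: real
        using powr_mono'[of 1 p w] that p by simp
      consider "x = 0" | "y = 0" | "0 < x" "0 < y" using \<open>0 \<le> x\<close> \<open>0 \<le> y\<close> by fastforce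
      then show ?thesis
      proof cases
        case 1
        then show ?thesis using that le[of v] p by (simp add: powr_mult mult_right_mono)
      next
        case 2
        then show ?thesis using that le[of u] p by (simp add: powr_mult mult_right_mono)
      next
        case 3
        then show ?thesis using convex_onD[OF powr_convex[OF p], of v x y] that by (simp add: eq_diff_eq[symmetric])
      qed
    qed
    have pt: "cmod (f t + g t) powr p \<le> (a + b) powr p *
       (a / (a + b) * (cmod (f t) powr p / a powr p) + b / (a + b) * (cmod (g t) powr p / b powr p))" for t
    proof -
      have "cmod (f t + g t) powr p \<le> ((a + b) * (a / (a + b) * (cmod (f t) / a) + b / (a + b) * (cmod (g t) / b))) powr p"
      proof -
        have "(a + b) * (a / (a + b) * (cmod (f t) / a) + b / (a + b) * (cmod (g t) / b)) = cmod (f t) + cmod (g t)"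
          using ab by (simp add: distrib_left)
        then show ?thesis using p norm_triangle_ineq[of "f t" "g t"] by (simp add: powr_mono2)
      qed
      also have "\<dots> = (a + b) powr p * (a / (a + b) * (cmod (f t) / a) + b / (a + b) * (cmod (g t) / b)) powr p"
        using ab by (intro powr_mult)
      also have "\<dots> \<le> (a + b) powr p * (a / (a + b) * (cmod (f t) / a) powr p + b / (a + b) * (cmod (g t) / b) powr p)"
        using ab by (intro mult_left_mono conv) (auto simp: add_divide_distrib[symmetric])
      finally show ?thesis using ab by (simp add: powr_divide)
    qed
    have "(\<Sum>t\<in>F. cmod (f t) powr p) / a powr p \<le> 1"
      using ell_sum_le[OF f F] powr_mono2[of p "nrm (ell p) f" a] a ell_nrm_nonneg[of f] p ab by simp
    moreover have "(\<Sum>t\<in>F. cmod (g t) powr p) / b powr p \<le> 1"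
      using ell_sum_le[OF g F] powr_mono2[of p "nrm (ell p) g" b] b ell_nrm_nonneg[of g] p ab by simp
    ultimately have "a / (a + b) * ((\<Sum>t\<in>F. cmod (f t) powr p) / a powr p) +
        b / (a + b) * ((\<Sum>t\<in>F. cmod (g t) powr p) / b powr p) \<le> a / (a + b) * 1 + b / (a + b) * 1"
      using ab by (intro add_mono mult_left_mono) auto
    also have "\<dots> = 1" using ab by (simp add: add_divide_distrib[symmetric])
    finally have s: "a / (a + b) * ((\<Sum>t\<in>F. cmod (f t) powr p) / a powr p) +
        b / (a + b) * ((\<Sum>t\<in>F. cmod (g t) powr p) / b powr p) \<le> 1" .
    have "(\<Sum>t\<in>F. cmod (f t + g t) powr p) \<le> (\<Sum>t\<in>F. (a + b) powr p *
       (a / (a + b) * (cmod (f t) powr p / a powr p) + b / (a + b) * (cmod (g t) powr p / b powr p)))"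
      by (rule sum_mono) (rule pt)
    also have "\<dots> = (a + b) powr p * (a / (a + b) * ((\<Sum>t\<in>F. cmod (f t) powr p) / a powr p) +
        b / (a + b) * ((\<Sum>t\<in>F. cmod (g t) powr p) / b powr p))"
      by (simp only: sum_distrib_left[symmetric] sum.distrib sum_divide_distrib[symmetric])
    also have "\<dots> \<le> (a + b) powr p" using mult_left_mono[OF s, of "(a + b) powr p"] by simp
    finally show "(\<Sum>t\<in>F. cmod (f t + g t) powr p) \<le> (a + b) powr p" .
  qed
  have "nrm (ell p) (\<lambda>t. f t + g t) \<le> nrm (ell p) f + nrm (ell p) g + e" if "0 < e" for e
    using *[of "nrm (ell p) f + e/2" "nrm (ell p) g + e/2"] that by simp
  then show ?thesis
    using *[of "nrm (ell p) f + 1" "nrm (ell p) g + 1"] by (auto intro: field_le_epsilon)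
qed

lemma ell_smult:
  assumes f: "f \<in> carrier (ell p)"
  shows "(\<lambda>t. c * f t) \<in> carrier (ell p)" "nrm (ell p) (\<lambda>t. c * f t) = cmod c * nrm (ell p) f"
proof -
  have eq: "cmod (c * f t) powr p = cmod c powr p * cmod (f t) powr p" for t
    by (simp add: norm_mult powr_mult)
  show "(\<lambda>t. c * f t) \<in> carrier (ell p)"
    using f unfolding ell_simps mem_Collect_eq eq by (rule summable_on_cmult_right)
  show "nrm (ell p) (\<lambda>t. c * f t) = cmod c * nrm (ell p) f"
    unfolding ell_nrm eq infsum_cmult_right' by (simp add: powr_mult infsum_nonneg powr_cancel)
qed

lemma normed_space_ell: "normed_space (ell p)"
proof (rule normed_spaceI)
  show "\<zero>\<^bsub>ell p\<^esub> \<in> carrier (ell p)" using p by (simp add: ell_simps)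
  show "nrm (ell p) f = 0 \<longleftrightarrow> f = \<zero>\<^bsub>ell p\<^esub>" if "f \<in> carrier (ell p)" for f :: "'a \<Rightarrow> complex"
  proof
    assume "nrm (ell p) f = 0"
    then have "f t = 0" for t using ell_coord_le[OF that, of t] by simp
    then show "f = \<zero>\<^bsub>ell p\<^esub>" by (auto simp: ell_simps)
  qed (use p in \<open>simp add: ell_simps ell_nrm\<close>)
  show "f \<oplus>\<^bsub>ell p\<^esub> g \<in> carrier (ell p)" "nrm (ell p) (f \<oplus>\<^bsub>ell p\<^esub> g) \<le> nrm (ell p) f + nrm (ell p) g"
    if "f \<in> carrier (ell p)" "g \<in> carrier (ell p)" for f g :: "'a \<Rightarrow> complex"
    using ell_add[OF that] by (simp_all add: ell_simps(3))
  show "c \<odot>\<^bsub>ell p\<^esub> f \<in> carrier (ell p)" "nrm (ell p) (c \<odot>\<^bsub>ell p\<^esub> f) = cmod c * nrm (ell p) f"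
    if "f \<in> carrier (ell p)" for c and f :: "'a \<Rightarrow> complex"
    using ell_smult[OF that, of c] by (simp_all add: ell_simps(4))
qed (simp_all add: ell_simps(2-4) ell_nrm_nonneg algebra_simps)

lemma ell_minus:
  assumes "f \<in> carrier (ell p)" "g \<in> carrier (ell p)"
  shows "f \<ominus>\<^bsub>ell p\<^esub> g = (\<lambda>t. f t - g t)"
  using normed_space.minus_conv[OF normed_space_ell assms] by (simp add: ell_simps)

text \<open>A Cauchy sequence converges in every coordinate, and on finite sets of coordinates the Cauchy
estimate passes to the limit.\<close>

lemma banach_space_ell: "banach_space (ell p)"
proof (rule banach_spaceI[OF normed_space_ell])
  interpret normed_space "ell p :: ('a \<Rightarrow> complex) cnormed" by (rule normed_space_ell)
  fix \<sigma> :: "nat \<Rightarrow> 'a \<Rightarrow> complex"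
  assume mem: "\<And>n. \<sigma> n \<in> carrier (ell p)"
    and C: "\<And>e. 0 < e \<Longrightarrow> \<exists>N. \<forall>m\<ge>N. \<forall>n\<ge>N. nrm (ell p) (\<sigma> m \<ominus>\<^bsub>ell p\<^esub> \<sigma> n) < e"
  have "Cauchy (\<lambda>n. \<sigma> n t)" for t
  proof (rule CauchyI)
    fix e :: real assume "0 < e"
    then obtain N where N: "\<And>m n. \<lbrakk>N \<le> m; N \<le> n\<rbrakk> \<Longrightarrow> nrm (ell p) (\<sigma> m \<ominus>\<^bsub>ell p\<^esub> \<sigma> n) < e" using C by meson
    have "cmod (\<sigma> m t - \<sigma> n t) < e" if "N \<le> m" "N \<le> n" for m n
      using ell_coord_le[OF minus_mem[OF mem mem], of m n t] N[OF that] by (simp add: ell_minus mem)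
    then show "\<exists>M. \<forall>m\<ge>M. \<forall>n\<ge>M. norm (\<sigma> m t - \<sigma> n t) < e" by blast
  qed
  then have "\<exists>l. (\<lambda>n. \<sigma> n t) \<longlonglongrightarrow> l" for t by (simp add: Cauchy_convergent_iff convergent_def)
  then obtain f where f: "\<And>t. (\<lambda>n. \<sigma> n t) \<longlonglongrightarrow> f t" by metis
  have close: "(\<lambda>t. \<sigma> m t - f t) \<in> carrier (ell p) \<and> nrm (ell p) (\<lambda>t. \<sigma> m t - f t) \<le> e"
    if N: "\<And>m n. \<lbrakk>N \<le> m; N \<le> n\<rbrakk> \<Longrightarrow> nrm (ell p) (\<sigma> m \<ominus>\<^bsub>ell p\<^esub> \<sigma> n) < e" and e: "0 < e" and m: "N \<le> m" for e N m
  proof (rule ell_memI)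
    fix F :: "'a set" assume F: "finite F"
    have "(\<lambda>n. \<Sum>t\<in>F. cmod (\<sigma> m t - \<sigma> n t) powr p) \<longlonglongrightarrow> (\<Sum>t\<in>F. cmod (\<sigma> m t - f t) powr p)"
      using p f by (intro tendsto_sum tendsto_powr' tendsto_norm tendsto_diff tendsto_const) auto
    moreover have "(\<Sum>t\<in>F. cmod (\<sigma> m t - \<sigma> n t) powr p) \<le> e powr p" if "N \<le> n" for n
    proof -
      have "(\<Sum>t\<in>F. cmod ((\<sigma> m \<ominus>\<^bsub>ell p\<^esub> \<sigma> n) t) powr p) \<le> nrm (ell p) (\<sigma> m \<ominus>\<^bsub>ell p\<^esub> \<sigma> n) powr p"
        using ell_sum_le[OF minus_mem[OF mem mem] F] .
      also have "\<dots> \<le> e powr p"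
        using N[OF m that] ell_nrm_nonneg p by (intro powr_mono2) auto
      finally show ?thesis by (simp add: ell_minus mem)
    qed
    ultimately show "(\<Sum>t\<in>F. cmod (\<sigma> m t - f t) powr p) \<le> e powr p"
      by (intro LIMSEQ_le_const2) auto
  qed (use e in simp)
  obtain M where "\<And>m n. \<lbrakk>M \<le> m; M \<le> n\<rbrakk> \<Longrightarrow> nrm (ell p) (\<sigma> m \<ominus>\<^bsub>ell p\<^esub> \<sigma> n) < 1" using C[of 1] by auto
  from close[of M 1 M, OF this] have d: "(\<lambda>t. \<sigma> M t - f t) \<in> carrier (ell p)" by simp
  from minus_mem[OF mem[of M] d] have fmem: "f \<in> carrier (ell p)"
    unfolding ell_minus[OF mem[of M] d] by simp
  show "\<exists>x\<in>carrier (ell p). \<forall>e>0. \<exists>N. \<forall>n\<ge>N. nrm (ell p) (\<sigma> n \<ominus>\<^bsub>ell p\<^esub> x) < e"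
  proof (intro bexI[OF _ fmem] allI impI)
    fix e :: real assume "0 < e"
    then have e: "0 < e/2" by simp
    from C[OF this] obtain N where N: "\<And>m n. \<lbrakk>N \<le> m; N \<le> n\<rbrakk> \<Longrightarrow> nrm (ell p) (\<sigma> m \<ominus>\<^bsub>ell p\<^esub> \<sigma> n) < e/2" by meson
    show "\<exists>N. \<forall>n\<ge>N. nrm (ell p) (\<sigma> n \<ominus>\<^bsub>ell p\<^esub> f) < e"
      using close[OF N e] e by (intro exI[of _ N]) (force simp: ell_minus mem fmem)
  qed
qed

lemma pull_ell:
  assumes "inj_on g {w. P w}" "f \<in> carrier (ell p)"
  shows "pull P g f \<in> carrier (ell p) \<and> nrm (ell p) (pull P g f) \<le> nrm (ell p) f"
proof (rule ell_memI[OF ell_nrm_nonneg])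
  fix F :: "'a set" assume F: "finite F"
  have "(\<Sum>w\<in>F. cmod (pull P g f w) powr p) = (\<Sum>w\<in>{w\<in>F. P w}. cmod (f (g w)) powr p)"
    using F p by (subst sum.inter_filter) (auto simp: pull_def intro!: sum.cong)
  also have "\<dots> = (\<Sum>v\<in>g ` {w\<in>F. P w}. cmod (f v) powr p)"
    using assms(1) by (subst sum.reindex) (auto elim: inj_on_subset)
  also have "\<dots> \<le> nrm (ell p) f powr p"
    using F assms(2) by (intro ell_sum_le) auto
  finally show "(\<Sum>w\<in>F. cmod (pull P g f w) powr p) \<le> nrm (ell p) f powr p" .
qed

lemma pull_operator:
  fixes g :: "'w \<Rightarrow> 'w"
  assumes "inj_on g {w. P w}"
  shows "restrict (pull P g) (carrier (ell p)) \<in> carrier (ell_ops p)"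
  by (rule normed_space.BO_restrict[OF normed_space_ell, THEN conjunct1, of _ 1])
    (use pull_ell[OF assms] in \<open>auto simp: ell_simps(3,4) pull_def fun_eq_iff\<close>)

lemma indicator_ell: "indicator {w} \<in> carrier (ell p)"
proof -
  have "(\<Sum>t\<in>F. cmod (indicator {w} t) powr p) \<le> 1 powr p" if "finite F" for F :: "'a set"
  proof -
    have "(\<Sum>t\<in>F. cmod (indicator {w} t) powr p) = (\<Sum>t\<in>F. if t = w then 1 else 0)"
      using p by (intro sum.cong) (auto simp: indicator_def)
    then show ?thesis using that by (simp add: sum.delta)
  qed
  from ell_memI[OF _ this] show ?thesis by simp
qed

text \<open>This is where the exponent must be finite: the tail of a convergent series is small, so
restrictions to finite sets approximate.\<close>

lemma generates_ell: "generates (ell p) (range (\<lambda>w. indicator {w}))"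
  unfolding generates_def
proof (intro conjI allI impI; (elim conjE)?)
  show "range (\<lambda>w. indicator {w}) \<subseteq> carrier (ell p)" using indicator_ell by auto
  fix H :: "('a \<Rightarrow> complex) set"
  assume H: "closed_subspace (ell p) H" and ind: "range (\<lambda>w. indicator {w}) \<subseteq> H"
  note HD = closed_subspaceD[OF H, unfolded ell_simps(2-4)]
  have fin: "(\<lambda>t. if t \<in> F then f t else 0) \<in> H" if "finite F" for F and f :: "'a \<Rightarrow> complex"
    using that
  proof induction
    case empty
    then show ?case using HD(2) by simp
  next
    case (insert w F)
    have "(\<lambda>t. f w * indicator {w} t) \<in> H" by (rule HD(4)) (use ind in blast)
    from HD(3)[OF this insert.IH]
    have "(\<lambda>t. f w * indicator {w} t + (if t \<in> F then f t else 0)) \<in> H" .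
    also have "(\<lambda>t. f w * indicator {w} t + (if t \<in> F then f t else 0)) = (\<lambda>t. if t \<in> insert w F then f t else 0)"
      using insert.hyps by (auto simp: fun_eq_iff indicator_def)
    finally show ?case .
  qed
  show "carrier (ell p) \<subseteq> H"
  proof
    fix f :: "'a \<Rightarrow> complex" assume f: "f \<in> carrier (ell p)"
    show "f \<in> H"
    proof (rule closed_subspaceD(5)[OF H f])
      fix r :: real assume r: "0 < r"
      let ?h = "\<lambda>t. cmod (f t) powr p"
      have s: "?h summable_on UNIV" using f by (simp add: ell_simps)
      have d: "0 < (r/2) powr p" using r by simp
      obtain F where F: "finite F" "dist (sum ?h F) (infsum ?h UNIV) \<le> (r/2) powr p"
        using infsum_finite_approximation[OF s d] by blast
      let ?g = "\<lambda>t. if t \<in> F then f t else 0"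
      have gH: "?g \<in> H" by (rule fin[OF F(1)])
      have "(\<lambda>t. f t - ?g t) \<in> carrier (ell p) \<and> nrm (ell p) (\<lambda>t. f t - ?g t) \<le> r/2"
      proof (rule ell_memI)
        fix G :: "'a set" assume G: "finite G"
        have "(\<Sum>t\<in>G. cmod (f t - ?g t) powr p) = sum ?h (G - F)"
          using G p by (intro sum.mono_neutral_cong_right) auto
        also have "\<dots> = sum ?h (G \<union> F) - sum ?h F"
          using G F(1) by (simp add: sum_diff[symmetric] Un_Diff)
        also have "\<dots> \<le> infsum ?h UNIV - sum ?h F"
          using s G F(1) by (intro diff_right_mono finite_sum_le_infsum) auto
        also have "\<dots> \<le> (r/2) powr p" using F(2) by (simp add: dist_real_def)
        finally show "(\<Sum>t\<in>G. cmod (f t - ?g t) powr p) \<le> (r/2) powr p" .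
      qed (use r in simp)
      moreover have "?g \<in> carrier (ell p)" using gH HD(1) by blast
      ultimately show "\<exists>g\<in>H. nrm (ell p) (f \<ominus>\<^bsub>ell p\<^esub> g) < r"
        using gH r f by (intro bexI[of _ ?g]) (auto simp: ell_minus)
    qed
  qed
qed

lemma operator_eq_on_indicators:
  assumes T: "T \<in> carrier (ell_ops p)" and S: "S \<in> carrier (ell_ops p)"
    and eq: "\<And>w. T (indicator {w}) = S (indicator {w})"
  shows "T = S"
proof -
  interpret banach_space "ell p :: ('a \<Rightarrow> complex) cnormed" by (rule banach_space_ell)
  have "closed_subspace (ell p) {f \<in> carrier (ell p). T f = S f}"
    using T S by (intro closed_subspace_equalizer[OF normed_space_axioms normed_space_axioms]) (simp_all add: BO_iff)
  moreover have "range (\<lambda>w. indicator {w}) \<subseteq> {f \<in> carrier (ell p). T f = S f}"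
    using eq indicator_ell by auto
  ultimately have "carrier (ell p) \<subseteq> {f \<in> carrier (ell p). T f = S f}"
    using generates_ell unfolding generates_def by blast
  then show ?thesis by (intro BO_eqI[OF T S]) blast
qed

text \<open>The number \<open>k\<close> codes a pair of indices, and the \<open>k\<close>-th value is the matrix entry at that pair.\<close>

lemma matrix_coefficients_inj:
  assumes "countable (UNIV :: 'w set)"
  obtains \<phi> :: "(('w \<Rightarrow> complex) \<Rightarrow> ('w \<Rightarrow> complex)) \<Rightarrow> nat \<Rightarrow> complex"
  where "inj_on \<phi> (carrier (ell_ops p))"
proof
  define e :: "nat \<Rightarrow> 'w" where "e = from_nat_into UNIV"
  have e: "\<exists>n. e n = w" for w
    unfolding e_def using range_from_nat_into[OF UNIV_not_empty assms] by (metis UNIV_I imageE)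
  show "inj_on (\<lambda>T k. T (indicator {e (fst (prod_decode k))}) (e (snd (prod_decode k))))
      (carrier (ell_ops p))"
  proof (rule inj_onI)
    fix T S assume TS: "T \<in> carrier (ell_ops p)" "S \<in> carrier (ell_ops p)"
      and eq: "(\<lambda>k. T (indicator {e (fst (prod_decode k))}) (e (snd (prod_decode k)))) =
        (\<lambda>k. S (indicator {e (fst (prod_decode k))}) (e (snd (prod_decode k))))"
    have "T (indicator {e m}) (e n) = S (indicator {e m}) (e n)" for m n
      using fun_cong[OF eq, of "prod_encode (m, n)"] by simp
    then have "T (indicator {w}) v = S (indicator {w}) v" for w v using e by metis
    then show "T = S" by (intro operator_eq_on_indicators[OF TS]) auto
  qed
qed

end

section \<open>Inverse semigroups\<close>

lemma star_unique:
  fixes s t :: "'s::inverse_semigroup"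
  assumes "s * t * s = s" "t * s * t = t" shows "s\<^sup>\<star> = t"
  unfolding star_def by (rule the1_equality[OF ex1_generalized_inverse]) (use assms in simp)

lemma star_star [simp]: "((s::'s::inverse_semigroup)\<^sup>\<star>)\<^sup>\<star> = s"
  by (rule star_unique) (rule star_props)+

lemma star_idem: "(e::'s::inverse_semigroup) * e = e \<Longrightarrow> e\<^sup>\<star> = e"
  by (rule star_unique) simp_all

lemma star_cancel [simp]:
  fixes s t :: "'s::inverse_semigroup"
  shows "s * (s\<^sup>\<star> * (s * t)) = s * t" "s\<^sup>\<star> * (s * (s\<^sup>\<star> * t)) = s\<^sup>\<star> * t"
    "s * (s\<^sup>\<star> * s) = s" "s\<^sup>\<star> * (s * s\<^sup>\<star>) = s\<^sup>\<star>"
  using star_props[of s] by (metis mult.assoc)+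

text \<open>Write \<open>x\<close> for \<open>(e f)\<^sup>\<star>\<close>.  Then \<open>f x e\<close> is also a generalized inverse of \<open>e f\<close>, so it equals \<open>x\<close>.
This form makes \<open>x\<close> idempotent, hence its own inverse, hence equal to \<open>e f\<close>.\<close>

lemma idem_mult:
  fixes e f :: "'s::inverse_semigroup"
  assumes e: "e * e = e" and f: "f * f = f"
  shows "(e * f) * (e * f) = e * f"
proof -
  define x where "x = (e * f)\<^sup>\<star>"
  have 1: "e * f * x * (e * f) = e * f" "x * (e * f) * x = x"
    unfolding x_def by (rule star_props)+
  have a: "e * (e * w) = e * w" "f * (f * w) = f * w" for w
    by (simp_all only: mult.assoc[symmetric] e f)
  have b: "x * (e * (f * (x * w))) = x * w" for w
    using arg_cong[OF 1(2), of "\<lambda>y. y * w"] by (simp only: mult.assoc)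
  have "(e * f)\<^sup>\<star> = f * x * e"
  proof (rule star_unique)
    show "e * f * (f * x * e) * (e * f) = e * f"
      using 1(1) by (simp add: mult.assoc a)
    show "f * x * e * (e * f) * (f * x * e) = f * x * e"
      by (simp add: mult.assoc a b)
  qed
  then have x: "x = f * x * e" by (simp add: x_def)
  have "x * x = f * (x * (e * f) * x) * e"
    using x by (metis mult.assoc)
  then have "x * x = x" using x 1(2) by simp
  then have "x\<^sup>\<star> = x" by (rule star_idem)
  then have "x = e * f" unfolding x_def by simp
  with \<open>x * x = x\<close> show ?thesis by simp
qed

text \<open>Both \<open>e f\<close> and \<open>f e\<close> are idempotent, which makes \<open>f e\<close> an inverse of \<open>e f\<close>; but an idempotent
is its own inverse.\<close>

lemma idem_commute:
  fixes e f :: "'s::inverse_semigroup"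
  assumes e: "e * e = e" and f: "f * f = f"
  shows "e * f = f * e"
proof -
  have a: "e * (e * w) = e * w" "f * (f * w) = f * w" for w
    by (simp_all only: mult.assoc[symmetric] e f)
  have "(e * f)\<^sup>\<star> = f * e"
  proof (rule star_unique)
    show "e * f * (f * e) * (e * f) = e * f"
      using idem_mult[OF e f] by (simp add: mult.assoc a)
    show "f * e * (e * f) * (f * e) = f * e"
      using idem_mult[OF f e] by (simp add: mult.assoc a)
  qed
  then show ?thesis using star_idem[OF idem_mult[OF e f]] by simp
qed

lemma idem_star_mult [simp]:
  fixes s :: "'s::inverse_semigroup"
  shows "(s\<^sup>\<star> * s) * (s\<^sup>\<star> * s) = s\<^sup>\<star> * s" "(s * s\<^sup>\<star>) * (s * s\<^sup>\<star>) = s * s\<^sup>\<star>"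
  by (simp_all add: mult.assoc)

lemma star_mult:
  fixes s t :: "'s::inverse_semigroup"
  shows "(s * t)\<^sup>\<star> = t\<^sup>\<star> * s\<^sup>\<star>"
proof (rule star_unique)
  have c: "(t * t\<^sup>\<star>) * (s\<^sup>\<star> * s) = (s\<^sup>\<star> * s) * (t * t\<^sup>\<star>)"
    by (rule idem_commute) simp_all
  have "s * t * (t\<^sup>\<star> * s\<^sup>\<star>) * (s * t) = s * ((t * t\<^sup>\<star>) * (s\<^sup>\<star> * s)) * t"
    by (simp only: mult.assoc)
  also have "\<dots> = s * t" unfolding c by (simp add: mult.assoc)
  finally show "s * t * (t\<^sup>\<star> * s\<^sup>\<star>) * (s * t) = s * t" .
  have "t\<^sup>\<star> * s\<^sup>\<star> * (s * t) * (t\<^sup>\<star> * s\<^sup>\<star>) = t\<^sup>\<star> * ((s\<^sup>\<star> * s) * (t * t\<^sup>\<star>)) * s\<^sup>\<star>"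
    by (simp only: mult.assoc)
  also have "\<dots> = t\<^sup>\<star> * s\<^sup>\<star>" unfolding c[symmetric] by (simp add: mult.assoc)
  finally show "t\<^sup>\<star> * s\<^sup>\<star> * (s * t) * (t\<^sup>\<star> * s\<^sup>\<star>) = t\<^sup>\<star> * s\<^sup>\<star>" .
qed

text \<open>Both sides say that the range of \<open>u\<close> lies below \<open>s f s\<^sup>\<star>\<close>: first below \<open>s s\<^sup>\<star>\<close>, and below \<open>f\<close> after
it is moved by \<open>s\<^sup>\<star>\<close>.  This is how the domain conditions of two composed translations combine.\<close>

lemma idem_conj_fix:
  fixes s f u :: "'s::inverse_semigroup"
  assumes f: "f * f = f"
  shows "s * f * s\<^sup>\<star> * u = u \<longleftrightarrow> s * s\<^sup>\<star> * u = u \<and> f * (s\<^sup>\<star> * u) = s\<^sup>\<star> * u"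
proof
  assume u: "s * f * s\<^sup>\<star> * u = u"
  have c: "s\<^sup>\<star> * s * f = f * (s\<^sup>\<star> * s)" by (rule idem_commute) (use f in simp_all)
  have "s * s\<^sup>\<star> * (s * f * s\<^sup>\<star> * u) = s * f * s\<^sup>\<star> * u" by (simp add: mult.assoc)
  then have 1: "s * s\<^sup>\<star> * u = u" using u by simp
  have "f * (s\<^sup>\<star> * (s * f * s\<^sup>\<star> * u)) = f * (s\<^sup>\<star> * s * f) * (s\<^sup>\<star> * u)" by (simp add: mult.assoc)
  also have "\<dots> = (f * f) * (s\<^sup>\<star> * s) * (s\<^sup>\<star> * u)" unfolding c by (simp only: mult.assoc)
  also have "\<dots> = (s\<^sup>\<star> * s * f) * (s\<^sup>\<star> * u)" unfolding c f by (simp only: mult.assoc)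
  also have "\<dots> = s\<^sup>\<star> * (s * f * s\<^sup>\<star> * u)" by (simp only: mult.assoc)
  finally show "s * s\<^sup>\<star> * u = u \<and> f * (s\<^sup>\<star> * u) = s\<^sup>\<star> * u" using u 1 by simp
next
  assume "s * s\<^sup>\<star> * u = u \<and> f * (s\<^sup>\<star> * u) = s\<^sup>\<star> * u"
  then show "s * f * s\<^sup>\<star> * u = u" by (simp add: mult.assoc)
qed

lemma star_mult_fixed:
  fixes s u :: "'s::inverse_semigroup"
  assumes "s * s\<^sup>\<star> * u = u" shows "(s\<^sup>\<star> * u)\<^sup>\<star> * (s\<^sup>\<star> * u) = u\<^sup>\<star> * u"
proof -
  have "(s\<^sup>\<star> * u)\<^sup>\<star> * (s\<^sup>\<star> * u) = u\<^sup>\<star> * (s * s\<^sup>\<star> * u)" by (simp add: star_mult mult.assoc)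
  then show ?thesis using assms by simp
qed

section \<open>The reduced algebra as a Banach algebra\<close>

text \<open>In terms of functions, \<open>\<lambda>(s)\<close> is \<open>f \<mapsto> f(s\<^sup>\<star> \<cdot>)\<close> on the set \<open>{u. s s\<^sup>\<star> u = u}\<close>, the range of
left translation by \<open>s\<close>.\<close>

lemma left_regular_conv:
  "left_regular s = pull (\<lambda>u. s * s\<^sup>\<star> * u = u) (\<lambda>u. s\<^sup>\<star> * u)"
proof (intro ext)
  fix f and u :: 'a
  have dom: "t * t\<^sup>\<star> \<preceq> s\<^sup>\<star> * s \<longleftrightarrow> s\<^sup>\<star> * s * t = t" for t
  proof
    assume "t * t\<^sup>\<star> \<preceq> s\<^sup>\<star> * s"
    then show "s\<^sup>\<star> * s * t = t" using left_regular_inj by (simp add: mult.assoc)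
  next
    assume "s\<^sup>\<star> * s * t = t"
    then have "t * t\<^sup>\<star> = s\<^sup>\<star> * s * (t * t\<^sup>\<star>)" by (simp add: mult.assoc[symmetric])
    then show "t * t\<^sup>\<star> \<preceq> s\<^sup>\<star> * s" unfolding natural_le_def using idem_star_mult(2) by blast
  qed
  have "{t. t * t\<^sup>\<star> \<preceq> s\<^sup>\<star> * s \<and> s * t = u} = (if s * s\<^sup>\<star> * u = u then {s\<^sup>\<star> * u} else {})"
    unfolding dom by (auto simp: mult.assoc)
  then show "left_regular s f u = pull (\<lambda>u. s * s\<^sup>\<star> * u = u) (\<lambda>u. s\<^sup>\<star> * u) f u"
    unfolding left_regular_def pull_def by simp
qed

definition reg :: "real \<Rightarrow> 's::inverse_semigroup \<Rightarrow> ('s \<Rightarrow> complex) \<Rightarrow> 's \<Rightarrow> complex" where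
  "reg p s = restrict (left_regular s) (carrier (ell p))"

lemma F_red_simps:
  "\<zero>\<^bsub>F_red TYPE('s::inverse_semigroup) p\<^esub> = \<zero>\<^bsub>ell_ops p\<^esub>"
  "T \<oplus>\<^bsub>F_red TYPE('s) p\<^esub> S = T \<oplus>\<^bsub>ell_ops p\<^esub> S"
  "c \<odot>\<^bsub>F_red TYPE('s) p\<^esub> T = c \<odot>\<^bsub>ell_ops p\<^esub> T"
  "T \<otimes>\<^bsub>F_red TYPE('s) p\<^esub> S = T \<otimes>\<^bsub>ell_ops p\<^esub> S"
  "nrm (F_red TYPE('s) p) T = nrm (ell_ops p) T"
  by (simp_all add: F_red_def)

context
  fixes p :: real
  assumes p: "1 \<le> p"
begin

interpretation ell: banach_space "ell p :: ('v \<Rightarrow> complex) cnormed" by (rule banach_space_ell[OF p])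
interpretation BO: banach_algebra "bounded_operators (ell p :: ('v \<Rightarrow> complex) cnormed)"
  by (rule ell.banach_algebra_BO)

lemma reg_mem: "reg p s \<in> carrier (ell_ops p)"
  unfolding reg_def left_regular_conv
proof (rule pull_operator[OF p], rule inj_onI, clarify)
  fix u v assume "s * s\<^sup>\<star> * u = u" "s * s\<^sup>\<star> * v = v" "s\<^sup>\<star> * u = s\<^sup>\<star> * v"
  then show "u = v" by (metis mult.assoc)
qed

lemma reg_apply: "f \<in> carrier (ell p) \<Longrightarrow>
    reg p s f u = (if s * s\<^sup>\<star> * u = u then f (s\<^sup>\<star> * u) else 0)"
  by (simp add: reg_def left_regular_conv pull_def)

lemma reg_mult: "reg p s \<otimes>\<^bsub>ell_ops p\<^esub> reg p t = reg p (s * t)"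
proof (rule ell.BO_eqI)
  show "reg p s \<otimes>\<^bsub>ell_ops p\<^esub> reg p t \<in> carrier (ell_ops p)"
    by (intro ell.BO_mult reg_mem)
  show "(reg p s \<otimes>\<^bsub>ell_ops p\<^esub> reg p t) f = reg p (s * t) f" if f: "f \<in> carrier (ell p)" for f
  proof
    have rt: "reg p t f \<in> carrier (ell p)" using ell.BO_linearD(1)[OF reg_mem f] .
    show "(reg p s \<otimes>\<^bsub>ell_ops p\<^esub> reg p t) f u = reg p (s * t) f u" for u
      using f idem_conj_fix[of "t * t\<^sup>\<star>" s u]
      by (simp add: ell.BO_simps reg_apply[OF rt] reg_apply[OF f] star_mult) (simp add: mult.assoc)
  qed
qed (rule reg_mem)

text \<open>The image of the semigroup algebra is the linear span of the operators \<open>reg p s\<close>.\<close>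

lemma left_regular_alg_in:
  assumes H: "\<zero>\<^bsub>ell_ops p\<^esub> \<in> H"
      "\<And>S T. \<lbrakk>S \<in> H; T \<in> H\<rbrakk> \<Longrightarrow> S \<oplus>\<^bsub>ell_ops p\<^esub> T \<in> H"
      "\<And>c T. T \<in> H \<Longrightarrow> c \<odot>\<^bsub>ell_ops p\<^esub> T \<in> H"
    and G: "range (reg p) \<subseteq> H" and a: "finite {s. a s \<noteq> 0}"
  shows "left_regular_alg p a \<in> H"
proof -
  have "(\<lambda>f\<in>carrier (ell p). \<lambda>u. \<Sum>s\<in>F. a s * left_regular s f u) \<in> H" if "finite F" for F
    using that
  proof induction
    case empty
    then show ?case using H(1) by (simp add: ell.BO_simps ell_simps(2) restrict_def)
  next
    case (insert s F)
    have "(a s \<odot>\<^bsub>ell_ops p\<^esub> reg p s) \<oplus>\<^bsub>ell_ops p\<^esub>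
        (\<lambda>f\<in>carrier (ell p). \<lambda>u. \<Sum>s\<in>F. a s * left_regular s f u) \<in> H"
      using H G insert.IH by blast
    also have "(a s \<odot>\<^bsub>ell_ops p\<^esub> reg p s) \<oplus>\<^bsub>ell_ops p\<^esub>
        (\<lambda>f\<in>carrier (ell p). \<lambda>u. \<Sum>s\<in>F. a s * left_regular s f u) =
        (\<lambda>f\<in>carrier (ell p). \<lambda>u. \<Sum>s\<in>insert s F. a s * left_regular s f u)"
      using insert.hyps by (auto simp: ell.BO_simps ell_simps reg_def)
    finally show ?case .
  qed
  from this[OF a] show ?thesis unfolding left_regular_alg_def .
qed

lemma reg_in_alg: "reg p s \<in> left_regular_alg p ` {a. finite {s. a s \<noteq> 0}}"
proof (rule image_eqI[where x = "indicator {s}"])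
  have "{t. indicator {s} t \<noteq> (0::complex)} = {s}" by (auto simp: indicator_def)
  then show "indicator {s} \<in> {a. finite {s. a s \<noteq> (0::complex)}}" "reg p s = left_regular_alg p (indicator {s})"
    by (simp_all add: left_regular_alg_def reg_def restrict_def fun_eq_iff)
qed

lemma left_regular_alg_expand:
  assumes "finite F" "{s. a s \<noteq> 0} \<subseteq> F"
  shows "left_regular_alg p a = (\<lambda>f\<in>carrier (ell p). \<lambda>u. \<Sum>s\<in>F. a s * left_regular s f u)"
  unfolding left_regular_alg_def
  by (intro restrict_ext ext sum.mono_neutral_left) (use assms in auto)

lemma F_red_closed:
  "closed_subspace (ell_ops p) (carrier (F_red TYPE('s::inverse_semigroup) p))" (is "closed_subspace ?B _")
proof -
  let ?L = "left_regular_alg p ` {a :: 's \<Rightarrow> complex. finite {s. a s \<noteq> 0}}"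
  have "closed_subspace ?B (ntopology ?B closure_of ?L)"
  proof (rule BO.closed_subspace_closure)
    show "?L \<subseteq> carrier ?B"
      using left_regular_alg_in[of "carrier ?B"] reg_mem by auto
    show "\<zero>\<^bsub>?B\<^esub> \<in> ?L"
      by (rule image_eqI[where x = "\<lambda>_. 0"]) (auto simp: left_regular_alg_def ell.BO_simps ell_simps)
    show "S \<oplus>\<^bsub>?B\<^esub> T \<in> ?L" if ST: "S \<in> ?L" "T \<in> ?L" for S T
    proof -
      obtain a b where a: "finite {s. a s \<noteq> 0}" "S = left_regular_alg p a"
        and b: "finite {s. b s \<noteq> 0}" "T = left_regular_alg p b" using ST by blast
      let ?F = "{s. a s \<noteq> 0} \<union> {s. b s \<noteq> 0}"
      have F: "finite ?F" using a b by simp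
      have sub: "{s. a s + b s \<noteq> 0} \<subseteq> ?F" by auto
      have "S \<oplus>\<^bsub>?B\<^esub> T = left_regular_alg p (\<lambda>s. a s + b s)"
        unfolding a(2) b(2) left_regular_alg_expand[OF F sub]
        using left_regular_alg_expand[OF F, of a] left_regular_alg_expand[OF F, of b]
        by (auto simp: ell.BO_simps ell_simps sum.distrib distrib_right)
      then show ?thesis using finite_subset[OF sub F] by blast
    qed
    show "c \<odot>\<^bsub>?B\<^esub> T \<in> ?L" if T: "T \<in> ?L" for c T
    proof -
      obtain a where a: "finite {s. a s \<noteq> 0}" "T = left_regular_alg p a" using T by blast
      have sub: "{s. c * a s \<noteq> 0} \<subseteq> {s. a s \<noteq> 0}" by auto
      have "c \<odot>\<^bsub>?B\<^esub> T = left_regular_alg p (\<lambda>s. c * a s)"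
        unfolding a(2) left_regular_alg_expand[OF a(1) sub]
        by (auto simp: left_regular_alg_def ell.BO_simps ell_simps sum_distrib_left mult.assoc)
      then show ?thesis using finite_subset[OF sub a(1)] by blast
    qed
  qed
  then show ?thesis by (simp add: F_red_def)
qed

lemma F_red_sub: "T \<in> carrier (F_red TYPE('s::inverse_semigroup) p) \<Longrightarrow> T \<in> carrier (ell_ops p)"
  using closed_subspaceD(1)[OF F_red_closed] by blast

lemma F_red_banach_space: "banach_space (F_red TYPE('s::inverse_semigroup) p)"
  and F_red_inclusion: "isometric_embedding (F_red TYPE('s) p) (ell_ops p) (\<lambda>T. T)"
proof -
  note D = closed_subspaceD[OF F_red_closed]
  note * = banach_space_pullback[OF BO.banach_space_axioms, where i = "\<lambda>T. T" and V = "F_red TYPE('s) p"]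
  show "banach_space (F_red TYPE('s) p)"
    by (rule *(1)) (use D F_red_closed in \<open>simp_all add: F_red_simps\<close>)
  show "isometric_embedding (F_red TYPE('s) p) (ell_ops p) (\<lambda>T. T)"
    by (rule *(2)) (use D F_red_closed in \<open>simp_all add: F_red_simps\<close>)
qed

lemma F_red_generated: "generates (F_red TYPE('s::inverse_semigroup) p) (range (reg p))"
proof -
  interpret F: banach_space "F_red TYPE('s) p" by (rule F_red_banach_space)
  let ?L = "left_regular_alg p ` {a :: 's \<Rightarrow> complex. finite {s. a s \<noteq> 0}}"
  have L: "?L \<subseteq> carrier (ell_ops p)"
    using left_regular_alg_in[of "carrier (ell_ops p)"] reg_mem by auto
  have C: "carrier (F_red TYPE('s) p) = ntopology (ell_ops p) closure_of ?L"
    by (simp add: F_red_def)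
  show ?thesis
    unfolding generates_def
  proof (intro conjI allI impI; (elim conjE)?)
    show "range (reg p) \<subseteq> carrier (F_red TYPE('s) p)"
      unfolding C using reg_in_alg BO.closure_of_superset[OF L] by blast
    fix H assume H: "closed_subspace (F_red TYPE('s) p) H" and G: "range (reg p) \<subseteq> H"
    note HD = closed_subspaceD[OF H, unfolded F_red_simps]
    have LH: "?L \<subseteq> H" using left_regular_alg_in[OF HD(2,3,4) G] by blast
    show "carrier (F_red TYPE('s) p) \<subseteq> H"
    proof
      fix T assume T: "T \<in> carrier (F_red TYPE('s) p)"
      show "T \<in> H"
      proof (rule closed_subspaceD(5)[OF H T])
        fix r :: real assume "0 < r"
        then obtain S where S: "S \<in> ?L" "nrm (ell_ops p) (T \<ominus>\<^bsub>ell_ops p\<^esub> S) < r"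
          using T unfolding C BO.closure_of_iff[OF L] by blast
        then have SH: "S \<in> H" using LH by blast
        then have SF: "S \<in> carrier (F_red TYPE('s) p)" using HD(1) by blast
        have "T \<ominus>\<^bsub>F_red TYPE('s) p\<^esub> S = T \<ominus>\<^bsub>ell_ops p\<^esub> S"
          unfolding F.minus_conv[OF T SF] BO.minus_conv[OF F_red_sub[OF T] F_red_sub[OF SF]]
          by (simp add: F_red_simps)
        then show "\<exists>S\<in>H. nrm (F_red TYPE('s) p) (T \<ominus>\<^bsub>F_red TYPE('s) p\<^esub> S) < r"
          using S(2) SH by (intro bexI[of _ S]) (simp_all add: F_red_simps)
      qed
    qed
  qed
qed

lemma F_red_mult:
  assumes "S \<in> carrier (F_red TYPE('s::inverse_semigroup) p)" "T \<in> carrier (F_red TYPE('s) p)"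
  shows "S \<otimes>\<^bsub>ell_ops p\<^esub> T \<in> carrier (F_red TYPE('s) p)"
proof -
  interpret F: banach_space "F_red TYPE('s) p" by (rule F_red_banach_space)
  have "reg p s \<otimes>\<^bsub>ell_ops p\<^esub> reg p t \<in> carrier (F_red TYPE('s) p)" for s t :: 's
    unfolding reg_mult using F_red_generated unfolding generates_def by blast
  then show ?thesis
    by (intro BO.product_of_generated[OF F.normed_space_axioms F.normed_space_axioms
          F_red_inclusion F_red_inclusion F_red_generated F_red_generated F_red_closed _ assms]) auto
qed

lemma banach_algebra_F_red: "banach_algebra (F_red TYPE('s::inverse_semigroup) p)"
proof (intro banach_algebra.intro banach_algebra_axioms.intro F_red_banach_space)
  show "contractive_bilinear (F_red TYPE('s) p) (F_red TYPE('s) p) (F_red TYPE('s) p)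
      (\<lambda>a b. a \<otimes>\<^bsub>F_red TYPE('s) p\<^esub> b)"
    using BO.mult_bilinear[where 'v = 's]
    unfolding contractive_bilinear_def linear_map_def F_red_simps
    by (intro conjI ballI allI) (simp_all add: F_red_mult F_red_sub)
  show "(a \<otimes>\<^bsub>F_red TYPE('s) p\<^esub> b) \<otimes>\<^bsub>F_red TYPE('s) p\<^esub> c = a \<otimes>\<^bsub>F_red TYPE('s) p\<^esub> (b \<otimes>\<^bsub>F_red TYPE('s) p\<^esub> c)"
    if "a \<in> carrier (F_red TYPE('s) p)" "b \<in> carrier (F_red TYPE('s) p)" "c \<in> carrier (F_red TYPE('s) p)" for a b c
    using that[THEN F_red_sub] unfolding F_red_simps by (rule BO.mult_assoc)
qed

text \<open>Left translation by \<open>s\<close> preserves \<open>u\<^sup>\<star> u\<close>, so \<open>\<lambda>(s)\<close> commutes with the projection to a column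
\<open>{u. u\<^sup>\<star> u = e}\<close>, and commuting with the projection is preserved by closed spans.\<close>

lemma column_projection:
  assumes a: "a \<in> carrier (F_red TYPE('s::inverse_semigroup) p)" and f: "f \<in> carrier (ell p)"
  shows "a (pull (\<lambda>s. s\<^sup>\<star> * s = e) (\<lambda>s. s) f) = pull (\<lambda>s. s\<^sup>\<star> * s = e) (\<lambda>s. s) (a f)"
proof -
  interpret F: banach_space "F_red TYPE('s) p" by (rule F_red_banach_space)
  let ?Q = "pull (\<lambda>s::'s. s\<^sup>\<star> * s = e) (\<lambda>s. s)"
  have Q: "?Q g \<in> carrier (ell p) \<and> nrm (ell p) (?Q g) \<le> nrm (ell p) g" if "g \<in> carrier (ell p)" for g
    by (rule pull_ell[OF p _ that]) simp
  note sub = F_red_sub[where 's = 's]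
  note BD = ell.BO_linearD[OF sub] and BN = ell.BO_norm[OF sub]
  have "bounded_linear_map (F_red TYPE('s) p) (ell p) (\<lambda>a. a (?Q f))"
  proof (rule bounded_linear_mapI[where c = "nrm (ell p) f"])
    show "linear_map (F_red TYPE('s) p) (ell p) (\<lambda>a. a (?Q f))"
      using BD(1) Q[OF f] by (simp add: linear_map_def F_red_simps ell.BO_simps)
    show "nrm (ell p) (a (?Q f)) \<le> nrm (ell p) f * nrm (F_red TYPE('s) p) a"
      if a: "a \<in> carrier (F_red TYPE('s) p)" for a
    proof -
      have "nrm (ell p) (a (?Q f)) \<le> nrm (F_red TYPE('s) p) a * nrm (ell p) (?Q f)"
        using BN[OF a conjunct1[OF Q[OF f]]] by (simp add: F_red_simps)
      also have "\<dots> \<le> nrm (F_red TYPE('s) p) a * nrm (ell p) f"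
        using Q[OF f] F.nrm_nonneg[OF a] by (intro mult_left_mono) auto
      finally show ?thesis by (simp add: mult.commute)
    qed
  qed
  moreover have "bounded_linear_map (F_red TYPE('s) p) (ell p) (\<lambda>a. ?Q (a f))"
  proof (rule bounded_linear_mapI[where c = "nrm (ell p) f"])
    show "linear_map (F_red TYPE('s) p) (ell p) (\<lambda>a. ?Q (a f))"
      using BD(1) Q f
      by (auto simp: linear_map_def F_red_simps ell.BO_simps ell_simps(3,4) pull_def fun_eq_iff)
    show "nrm (ell p) (?Q (a f)) \<le> nrm (ell p) f * nrm (F_red TYPE('s) p) a"
      if a: "a \<in> carrier (F_red TYPE('s) p)" for a
      using order_trans[OF conjunct2[OF Q[OF BD(1)[OF a f]]] BN[OF a f]] by (simp add: F_red_simps mult.commute)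
  qed
  ultimately have "closed_subspace (F_red TYPE('s) p) {a \<in> carrier (F_red TYPE('s) p). a (?Q f) = ?Q (a f)}"
    by (rule closed_subspace_equalizer[OF F.normed_space_axioms ell.normed_space_axioms])
  moreover have "reg p s (?Q f) = ?Q (reg p s f)" for s
  proof
    fix u
    show "reg p s (?Q f) u = ?Q (reg p s f) u"
      using Q[OF f] f by (auto simp: reg_apply pull_def star_mult_fixed)
  qed
  then have "range (reg p) \<subseteq> {a \<in> carrier (F_red TYPE('s) p). a (?Q f) = ?Q (a f)}"
    using F_red_generated unfolding generates_def by blast
  ultimately have "carrier (F_red TYPE('s) p) \<subseteq> {a \<in> carrier (F_red TYPE('s) p). a (?Q f) = ?Q (a f)}"
    using F_red_generated unfolding generates_def by blast
  then show ?thesis using a by blast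
qed

end

section \<open>Amplification to repeated columns\<close>

text \<open>The injection \<open>\<kappa>\<close> places countably many copies of \<open>S\<close> in an index type \<open>'w\<close>, and of the \<open>n\<close>-th copy
only the column at the idempotent \<open>e n\<close> is used.  An operator acts on all these columns
simultaneously and by \<open>0\<close> on the rest of \<open>\<ell>\<^sup>p('w)\<close>, so that other corners of the linking
semigroupoid have room in the same index type.\<close>

definition slice :: "('s \<Rightarrow> nat \<Rightarrow> 'w) \<Rightarrow> (nat \<Rightarrow> 's::inverse_semigroup) \<Rightarrow> nat \<Rightarrow> ('w \<Rightarrow> complex) \<Rightarrow> 's \<Rightarrow> complex" where
  "slice \<kappa> e n = pull (\<lambda>s. s\<^sup>\<star> * s = e n) (\<lambda>s. \<kappa> s n)"

definition amp_fun :: "('s \<Rightarrow> nat \<Rightarrow> 'w) \<Rightarrow> (nat \<Rightarrow> 's::inverse_semigroup) \<Rightarrow>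
    (('s \<Rightarrow> complex) \<Rightarrow> 's \<Rightarrow> complex) \<Rightarrow> ('w \<Rightarrow> complex) \<Rightarrow> 'w \<Rightarrow> complex" where
  "amp_fun \<kappa> e a \<eta> w = (case inv_into UNIV (case_prod \<kappa>) w of (s, n) \<Rightarrow>
     if w = \<kappa> s n \<and> s\<^sup>\<star> * s = e n then a (slice \<kappa> e n \<eta>) s else 0)"

definition amplification :: "real \<Rightarrow> ('s \<Rightarrow> nat \<Rightarrow> 'w) \<Rightarrow> (nat \<Rightarrow> 's::inverse_semigroup) \<Rightarrow>
    (('s \<Rightarrow> complex) \<Rightarrow> 's \<Rightarrow> complex) \<Rightarrow> ('w \<Rightarrow> complex) \<Rightarrow> 'w \<Rightarrow> complex" where
  "amplification p \<kappa> e a = restrict (amp_fun \<kappa> e a) (carrier (ell p))"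

locale amplified =
  fixes p :: real and \<kappa> :: "'s::inverse_semigroup \<Rightarrow> nat \<Rightarrow> 'w" and e :: "nat \<Rightarrow> 's"
  assumes p: "1 \<le> p" and inj_\<kappa>: "inj (case_prod \<kappa>)"
begin

sublocale ell: banach_space "ell p :: ('v \<Rightarrow> complex) cnormed" by (rule banach_space_ell[OF p])

abbreviation (input) "amp \<equiv> amplification p \<kappa> e"

lemma \<kappa>_eq_iff [simp]: "\<kappa> s n = \<kappa> t m \<longleftrightarrow> s = t \<and> n = m"
  using inj_\<kappa> by (auto dest: injD[where x = "(s, n)" and y = "(t, m)"])

lemma inv_\<kappa> [simp]: "inv_into UNIV (case_prod \<kappa>) (\<kappa> s n) = (s, n)"
  using inv_f_f[OF inj_\<kappa>, of "(s, n)"] by simp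

lemma amp_fun_\<kappa>: "amp_fun \<kappa> e a \<eta> (\<kappa> s n) = (if s\<^sup>\<star> * s = e n then a (slice \<kappa> e n \<eta>) s else 0)"
  by (simp add: amp_fun_def)

lemma amp_fun_off: "(\<And>s n. w \<noteq> \<kappa> s n) \<Longrightarrow> amp_fun \<kappa> e a \<eta> w = 0"
  by (simp add: amp_fun_def split: prod.split)

lemma slice_ell:
  assumes "\<eta> \<in> carrier (ell p)" shows "slice \<kappa> e n \<eta> \<in> carrier (ell p)"
  unfolding slice_def by (rule pull_ell[OF p _ assms, THEN conjunct1]) (auto intro: inj_onI)

lemma slice_linear:
  "slice \<kappa> e n (\<eta> \<oplus>\<^bsub>ell p\<^esub> \<theta>) = slice \<kappa> e n \<eta> \<oplus>\<^bsub>ell p\<^esub> slice \<kappa> e n \<theta>"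
  "slice \<kappa> e n (c \<odot>\<^bsub>ell p\<^esub> \<eta>) = c \<odot>\<^bsub>ell p\<^esub> slice \<kappa> e n \<eta>"
  by (auto simp: slice_def pull_def ell_simps(3,4))

text \<open>The slices live on disjoint sets of indices.\<close>

lemma slice_norms:
  assumes \<eta>: "\<eta> \<in> carrier (ell p)" and N: "finite N"
  shows "(\<Sum>n\<in>N. nrm (ell p) (slice \<kappa> e n \<eta>) powr p) \<le> nrm (ell p) \<eta> powr p"
proof -
  let ?h = "\<lambda>n s. cmod (slice \<kappa> e n \<eta> s) powr p"
  have s: "?h n summable_on UNIV" for n
    using slice_ell[OF \<eta>, of n] by (simp add: ell_simps(1))
  have "((\<lambda>s. \<Sum>n\<in>N. ?h n s) has_sum (\<Sum>n\<in>N. infsum (?h n) UNIV)) UNIV"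
    using N
  proof induction
    case (insert n N)
    then show ?case using has_sum_add[OF has_sum_infsum[OF s[of n]] insert.IH] by simp
  qed simp
  then have "(\<Sum>n\<in>N. infsum (?h n) UNIV) \<le> nrm (ell p) \<eta> powr p"
  proof (rule has_sum_le_finite_sums)
    fix F :: "'s set" assume F: "finite F"
    have "(\<Sum>s\<in>F. \<Sum>n\<in>N. ?h n s) = (\<Sum>(s, n)\<in>F \<times> N. ?h n s)"
      by (rule sum.cartesian_product)
    also have "\<dots> \<le> (\<Sum>(s, n)\<in>F \<times> N. cmod (\<eta> (\<kappa> s n)) powr p)"
      by (rule sum_mono) (auto simp: slice_def pull_def)
    also have "\<dots> = (\<Sum>w\<in>case_prod \<kappa> ` (F \<times> N). cmod (\<eta> w) powr p)"
      using inj_\<kappa> by (subst sum.reindex) (auto simp: case_prod_unfold intro: inj_on_subset)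
    also have "\<dots> \<le> nrm (ell p) \<eta> powr p"
      by (rule ell_sum_le[OF p \<eta>]) (use F N in simp)
    finally show "(\<Sum>s\<in>F. \<Sum>n\<in>N. ?h n s) \<le> nrm (ell p) \<eta> powr p" .
  qed
  then show ?thesis by (simp add: ell_nrm_powr[OF p])
qed

text \<open>The operator is block diagonal with blocks of norm at most \<open>\<parallel>a\<parallel>\<close>, and \<open>p\<close>-th powers of norms add up
over the blocks.\<close>

lemma amp_bound:
  assumes a: "a \<in> carrier (ell_ops p)" and \<eta>: "\<eta> \<in> carrier (ell p)"
  shows "amp_fun \<kappa> e a \<eta> \<in> carrier (ell p) \<and>
    nrm (ell p) (amp_fun \<kappa> e a \<eta>) \<le> nrm (ell_ops p) a * nrm (ell p) \<eta>"
proof (rule ell_memI[OF p])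
  let ?c = "nrm (ell_ops p) a"
  have c: "0 \<le> ?c" by (rule ell.BO_nonneg[OF a])
  show "0 \<le> ?c * nrm (ell p) \<eta>" by (intro mult_nonneg_nonneg c ell_nrm_nonneg[OF p])
  fix F :: "'w set" assume F: "finite F"
  let ?g = "\<lambda>w. cmod (amp_fun \<kappa> e a \<eta> w) powr p"
  define S where "S = (fst \<circ> inv_into UNIV (case_prod \<kappa>)) ` F"
  define N where "N = (snd \<circ> inv_into UNIV (case_prod \<kappa>)) ` F"
  have fin: "finite S" "finite N" using F by (simp_all add: S_def N_def)
  have sub: "{w \<in> F. w \<in> range (case_prod \<kappa>)} \<subseteq> case_prod \<kappa> ` (S \<times> N)"
    by (force simp: S_def N_def image_iff)
  have "sum ?g F = sum ?g {w \<in> F. w \<in> range (case_prod \<kappa>)}"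
  proof (rule sum.mono_neutral_right)
    show "\<forall>w\<in>F - {w \<in> F. w \<in> range (case_prod \<kappa>)}. ?g w = 0"
      using p by (auto simp: image_iff intro!: amp_fun_off)
  qed (use F in auto)
  also have "\<dots> \<le> sum ?g (case_prod \<kappa> ` (S \<times> N))"
    using sub fin by (intro sum_mono2) auto
  also have "\<dots> = (\<Sum>(s, n)\<in>S \<times> N. ?g (\<kappa> s n))"
    using inj_\<kappa> by (subst sum.reindex) (auto simp: case_prod_unfold intro: inj_on_subset)
  also have "\<dots> = (\<Sum>n\<in>N. \<Sum>s\<in>S. ?g (\<kappa> s n))"
    by (simp only: sum.cartesian_product[symmetric] sum.swap[of _ S N])
  also have "\<dots> \<le> (\<Sum>n\<in>N. ?c powr p * nrm (ell p) (slice \<kappa> e n \<eta>) powr p)"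
  proof (rule sum_mono)
    fix n
    note sl = slice_ell[OF \<eta>, of n]
    have "(\<Sum>s\<in>S. ?g (\<kappa> s n)) \<le> (\<Sum>s\<in>S. cmod (a (slice \<kappa> e n \<eta>) s) powr p)"
      by (rule sum_mono) (simp add: amp_fun_\<kappa>)
    also have "\<dots> \<le> nrm (ell p) (a (slice \<kappa> e n \<eta>)) powr p"
      by (rule ell_sum_le[OF p ell.BO_linearD(1)[OF a sl] fin(1)])
    also have "\<dots> \<le> (?c * nrm (ell p) (slice \<kappa> e n \<eta>)) powr p"
      using ell.BO_norm[OF a sl] p by (intro powr_mono2 ell_nrm_nonneg[OF p]) auto
    also have "\<dots> = ?c powr p * nrm (ell p) (slice \<kappa> e n \<eta>) powr p"
      by (intro powr_mult c ell_nrm_nonneg[OF p])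
    finally show "(\<Sum>s\<in>S. ?g (\<kappa> s n)) \<le> \<dots>" .
  qed
  also have "\<dots> \<le> ?c powr p * nrm (ell p) \<eta> powr p"
    unfolding sum_distrib_left[symmetric] using slice_norms[OF \<eta> fin(2)] by (intro mult_left_mono) auto
  also have "\<dots> = (?c * nrm (ell p) \<eta>) powr p"
    by (intro powr_mult[symmetric] c ell_nrm_nonneg[OF p])
  finally show "sum ?g F \<le> (?c * nrm (ell p) \<eta>) powr p" .
qed

lemma amp_mem:
  assumes a: "a \<in> carrier (ell_ops p)"
  shows "amp a \<in> carrier (ell_ops p) \<and>
    nrm (ell_ops p) (amp a) \<le> nrm (ell_ops p) a"
  unfolding amplification_def
proof (rule ell.BO_restrict)
  show "amp_fun \<kappa> e a (\<eta> \<oplus>\<^bsub>ell p\<^esub> \<theta>) = amp_fun \<kappa> e a \<eta> \<oplus>\<^bsub>ell p\<^esub> amp_fun \<kappa> e a \<theta>"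
    if "\<eta> \<in> carrier (ell p)" "\<theta> \<in> carrier (ell p)" for \<eta> \<theta>
  proof
    have eq: "a (slice \<kappa> e n (\<eta> \<oplus>\<^bsub>ell p\<^esub> \<theta>)) = a (slice \<kappa> e n \<eta>) \<oplus>\<^bsub>ell p\<^esub> a (slice \<kappa> e n \<theta>)" for n
      unfolding slice_linear by (rule ell.BO_linearD(2)[OF a that[THEN slice_ell]])
    show "amp_fun \<kappa> e a (\<eta> \<oplus>\<^bsub>ell p\<^esub> \<theta>) w = (amp_fun \<kappa> e a \<eta> \<oplus>\<^bsub>ell p\<^esub> amp_fun \<kappa> e a \<theta>) w" for w
      unfolding amp_fun_def eq by (simp add: ell_simps(3) split: prod.split)
  qed
  show "amp_fun \<kappa> e a (c \<odot>\<^bsub>ell p\<^esub> \<eta>) = c \<odot>\<^bsub>ell p\<^esub> amp_fun \<kappa> e a \<eta>"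
    if "\<eta> \<in> carrier (ell p)" for c \<eta>
  proof
    have eq: "a (slice \<kappa> e n (c \<odot>\<^bsub>ell p\<^esub> \<eta>)) = c \<odot>\<^bsub>ell p\<^esub> a (slice \<kappa> e n \<eta>)" for n
      unfolding slice_linear by (rule ell.BO_linearD(3)[OF a that[THEN slice_ell]])
    show "amp_fun \<kappa> e a (c \<odot>\<^bsub>ell p\<^esub> \<eta>) w = (c \<odot>\<^bsub>ell p\<^esub> amp_fun \<kappa> e a \<eta>) w" for w
      unfolding amp_fun_def eq by (simp add: ell_simps(4) split: prod.split)
  qed
qed (use amp_bound[OF a] ell.BO_nonneg[OF a] in auto)

lemma amp_reg_\<kappa>:
  assumes "\<eta> \<in> carrier (ell p)"
  shows "amp (reg p s) \<eta> (\<kappa> u n) = (if u\<^sup>\<star> * u = e n \<and> s * s\<^sup>\<star> * u = u then \<eta> (\<kappa> (s\<^sup>\<star> * u) n) else 0)"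
  using assms
  by (simp add: amplification_def amp_fun_\<kappa> reg_apply[OF p slice_ell[OF assms]])
    (simp add: slice_def pull_def star_mult_fixed)

lemma amp_off: "\<eta> \<in> carrier (ell p) \<Longrightarrow> (\<And>s n. w \<noteq> \<kappa> s n) \<Longrightarrow> amp a \<eta> w = 0"
  by (simp add: amplification_def amp_fun_off)

text \<open>Since \<open>b\<close> preserves columns, cutting its output down to a column loses nothing before \<open>a\<close> is applied.\<close>

lemma amp_mult:
  assumes a: "a \<in> carrier (F_red TYPE('s) p)" and b: "b \<in> carrier (F_red TYPE('s) p)"
  shows "amp (a \<otimes>\<^bsub>F_red TYPE('s) p\<^esub> b) = amp a \<otimes>\<^bsub>ell_ops p\<^esub> amp b"
proof -
  note a' = F_red_sub[OF p a] and b' = F_red_sub[OF p b]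
  have "amp_fun \<kappa> e (a \<otimes>\<^bsub>F_red TYPE('s) p\<^esub> b) \<eta> = amp_fun \<kappa> e a (amp_fun \<kappa> e b \<eta>)"
    if \<eta>: "\<eta> \<in> carrier (ell p)" for \<eta>
  proof -
    have "slice \<kappa> e n (amp_fun \<kappa> e b \<eta>) = pull (\<lambda>s. s\<^sup>\<star> * s = e n) (\<lambda>s. s) (b (slice \<kappa> e n \<eta>))" for n
      by (auto simp: slice_def pull_def amp_fun_\<kappa> fun_eq_iff)
    also have "\<dots> n = b (pull (\<lambda>s. s\<^sup>\<star> * s = e n) (\<lambda>s. s) (slice \<kappa> e n \<eta>))" for n
      by (rule column_projection[OF p b slice_ell[OF \<eta>], symmetric])
    also have "\<dots> n = b (slice \<kappa> e n \<eta>)" for n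
      by (rule arg_cong[where f = b]) (auto simp: slice_def pull_def)
    finally have "slice \<kappa> e n (amp_fun \<kappa> e b \<eta>) = b (slice \<kappa> e n \<eta>)" for n .
    then show ?thesis
      using slice_ell[OF \<eta>]
      by (intro ext) (simp add: amp_fun_def F_red_simps ell.BO_simps split: prod.split)
  qed
  then show ?thesis
    using amp_bound[OF b'] by (simp add: amplification_def ell.BO_simps cong: restrict_cong)
qed

text \<open>Amplification is contractive by \<open>amp_mem\<close>.  Conversely, choose for every idempotent one copy of its column
and let \<open>f'\<close> be \<open>f\<close> distributed over the chosen copies.  Since \<open>a\<close> preserves columns, \<open>a f\<close> is
found in the amplification of \<open>a\<close> applied to \<open>f'\<close>, on the same copies.\<close>

lemma amp_isometric:
  assumes surj: "\<And>s::'s. \<exists>n. e n = s\<^sup>\<star> * s"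
  shows "isometric_embedding (F_red TYPE('s) p) (ell_ops p) amp"
  unfolding isometric_embedding_def linear_map_def
proof (intro conjI ballI allI)
  note sub = F_red_sub[OF p, where 's = 's]
  fix a assume a: "a \<in> carrier (F_red TYPE('s) p)"
  note a' = sub[OF a]
  show "amp a \<in> carrier (ell_ops p)" using amp_mem[OF a'] by blast
  show "amp (c \<odot>\<^bsub>F_red TYPE('s) p\<^esub> a) = c \<odot>\<^bsub>ell_ops p\<^esub> amp a" for c
    by (auto simp: amplification_def F_red_simps ell.BO_simps ell_simps(4) amp_fun_def fun_eq_iff slice_ell
        intro!: restrict_ext split: prod.split)
  show "amp (a \<oplus>\<^bsub>F_red TYPE('s) p\<^esub> b) = amp a \<oplus>\<^bsub>ell_ops p\<^esub> amp b" for b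
    by (auto simp: amplification_def F_red_simps ell.BO_simps ell_simps(3) amp_fun_def fun_eq_iff slice_ell
        intro!: restrict_ext split: prod.split)
  define \<nu> where "\<nu> f = (SOME n. e n = f)" for f
  have \<nu>: "e (\<nu> (s\<^sup>\<star> * s)) = s\<^sup>\<star> * s" for s :: 's
    unfolding \<nu>_def by (rule someI_ex[OF surj])
  have "nrm (ell_ops p) a \<le> nrm (ell_ops p) (amp a)"
    unfolding ell.BO_simps(5)[where T = a]
  proof (rule operator_norm_leI)
    show "0 \<le> nrm (ell_ops p) (amp a)" using amp_mem[OF a'] ell.BO_nonneg by blast
    fix f :: "'s \<Rightarrow> complex" assume f: "f \<in> carrier (ell p)"
    \<comment> \<open>\<open>P\<close> holds at the chosen copies, and \<open>g\<close> reads off the element of \<open>S\<close>.\<close>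
    define g where "g = fst \<circ> inv_into UNIV (case_prod \<kappa>)"
    define P where "P w \<longleftrightarrow> w = \<kappa> (g w) (\<nu> ((g w)\<^sup>\<star> * g w))" for w
    have gk: "g (\<kappa> s n) = s" for s n by (simp add: g_def)
    have inj: "inj_on g {w. P w}" by (rule inj_onI) (metis P_def mem_Collect_eq)
    define f' where "f' = pull P g f"
    have f': "f' \<in> carrier (ell p)" "nrm (ell p) f' \<le> nrm (ell p) f"
      unfolding f'_def using pull_ell[OF p inj f] by auto
    have sl: "slice \<kappa> e (\<nu> (s\<^sup>\<star> * s)) f' = pull (\<lambda>t. t\<^sup>\<star> * t = s\<^sup>\<star> * s) (\<lambda>t. t) f" for s
      by (auto simp: slice_def f'_def pull_def P_def gk \<nu> fun_eq_iff)
    have af: "a f = pull (\<lambda>_. True) (\<lambda>s. \<kappa> s (\<nu> (s\<^sup>\<star> * s))) (amp a f')"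
      using f' by (simp add: amplification_def pull_def amp_fun_\<kappa> \<nu> sl column_projection[OF p a f, unfolded pull_def] fun_eq_iff)
    have "nrm (ell p) (a f) \<le> nrm (ell p) (amp a f')"
      unfolding af
      using amp_mem[OF a'] ell.BO_linearD(1)[OF _ f'(1), of "amp a"]
      by (intro conjunct2[OF pull_ell[OF p]]) (auto simp: inj_on_def)
    also have "\<dots> \<le> nrm (ell_ops p) (amp a) * nrm (ell p) f'"
      using amp_mem[OF a'] ell.BO_norm[OF _ f'(1), of "amp a"] by blast
    also have "\<dots> \<le> nrm (ell_ops p) (amp a) * nrm (ell p) f"
      using f'(2) amp_mem[OF a'] ell.BO_nonneg by (intro mult_left_mono) auto
    finally show "nrm (ell p) (a f) \<le> nrm (ell_ops p) (amp a) * nrm (ell p) f" .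
  qed
  then show "nrm (ell_ops p) (amp a) = nrm (F_red TYPE('s) p) a"
    using amp_mem[OF a'] by (simp add: F_red_simps)
qed

end

section \<open>Equivalence bisets\<close>

lemma morita_bisetD:
  fixes X :: "'a set"
  assumes "morita_biset X la ra ips ipt"
  shows "\<And>s x. x \<in> X \<Longrightarrow> la s x \<in> X" "\<And>s s' x. x \<in> X \<Longrightarrow> la (s * s') x = la s (la s' x)"
    "\<And>t x. x \<in> X \<Longrightarrow> ra x t \<in> X" "\<And>t t' x. x \<in> X \<Longrightarrow> ra x (t * t') = ra (ra x t) t'"
    "\<And>s. \<exists>x\<in>X. \<exists>y\<in>X. ips x y = s" "\<And>t. \<exists>x\<in>X. \<exists>y\<in>X. ipt x y = t"
    "\<And>s x y. \<lbrakk>x \<in> X; y \<in> X\<rbrakk> \<Longrightarrow> ips (la s x) y = s * ips x y"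
    "\<And>x y. \<lbrakk>x \<in> X; y \<in> X\<rbrakk> \<Longrightarrow> ips y x = (ips x y)\<^sup>\<star>"
    "\<And>x. x \<in> X \<Longrightarrow> la (ips x x) x = x"
    "\<And>t x y. \<lbrakk>x \<in> X; y \<in> X\<rbrakk> \<Longrightarrow> ipt x (ra y t) = ipt x y * t"
    "\<And>x y. \<lbrakk>x \<in> X; y \<in> X\<rbrakk> \<Longrightarrow> ipt y x = (ipt x y)\<^sup>\<star>"
    "\<And>x. x \<in> X \<Longrightarrow> ra x (ipt x x) = x"
    "\<And>x y z. \<lbrakk>x \<in> X; y \<in> X; z \<in> X\<rbrakk> \<Longrightarrow> la (ips x y) z = ra x (ipt y z)"
proof -
  note A = assms[unfolded morita_biset_def]
  have surj: "\<exists>x\<in>X. \<exists>y\<in>X. h x y = w" if "(\<lambda>(x, y). h x y) ` (X \<times> X) = UNIV"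
    for h :: "'a \<Rightarrow> 'a \<Rightarrow> 'v" and w
  proof -
    have "w \<in> (\<lambda>(x, y). h x y) ` (X \<times> X)" unfolding that ..
    then show ?thesis by auto
  qed
  have "(\<lambda>(x, y). ips x y) ` (X \<times> X) = UNIV" "(\<lambda>(x, y). ipt x y) ` (X \<times> X) = UNIV"
    using A by simp_all
  note onto = this
  show "\<exists>x\<in>X. \<exists>y\<in>X. ips x y = s" for s by (rule surj[OF onto(1)])
  show "\<exists>x\<in>X. \<exists>y\<in>X. ipt x y = t" for t by (rule surj[OF onto(2)])
qed (use assms in \<open>unfold morita_biset_def, meson\<close>)+

text \<open>The opposite biset makes every statement below available with the roles of \<open>S\<close> and \<open>T\<close> exchanged.\<close>

lemma morita_biset_opposite:
  assumes "morita_biset X la ra ips ipt"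
  shows "morita_biset X (\<lambda>t x. ra x (t\<^sup>\<star>)) (\<lambda>x s. la (s\<^sup>\<star>) x) ipt ips"
proof -
  note D = morita_bisetD[OF assms]
  have "(\<lambda>(x, y). ipt x y) ` (X \<times> X) = UNIV" "(\<lambda>(x, y). ips x y) ` (X \<times> X) = UNIV"
    using assms unfolding morita_biset_def by simp_all
  moreover have "ipt (ra x (t\<^sup>\<star>)) y = t * ipt x y" if "x \<in> X" "y \<in> X" for x y t
    using that D(3,10) D(11)[of x y] D(11)[of y "ra x (t\<^sup>\<star>)"] by (simp add: star_mult)
  moreover have "ips x (la (s\<^sup>\<star>) y) = ips x y * s" if "x \<in> X" "y \<in> X" for x y s
    using that D(1,7) D(8)[of "la (s\<^sup>\<star>) y" x] D(8)[of y x] by (simp add: star_mult)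
  moreover have "(ipt x x)\<^sup>\<star> = ipt x x" "(ips x x)\<^sup>\<star> = ips x x" if "x \<in> X" for x
    using D(8,11)[OF that that] by simp_all
  moreover have "ra z ((ipt x y)\<^sup>\<star>) = la ((ips y z)\<^sup>\<star>) x" if "x \<in> X" "y \<in> X" "z \<in> X" for x y z
    using that D(13)[of z y x] D(8)[of y z] D(11)[of x y] by simp
  ultimately show ?thesis
    unfolding morita_biset_def by (intro conjI allI ballI) (simp_all add: D(1-4,9,12) star_mult D(8,11)[symmetric])
qed

locale biset =
  fixes X :: "'x set" and la :: "'s::inverse_semigroup \<Rightarrow> 'x \<Rightarrow> 'x" and ra :: "'x \<Rightarrow> 't::inverse_semigroup \<Rightarrow> 'x"
    and ips ipt
  assumes morita: "morita_biset X la ra ips ipt"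
begin

lemmas biset = morita_bisetD[OF morita]

lemma ips_star: "\<lbrakk>x \<in> X; y \<in> X\<rbrakk> \<Longrightarrow> (ips x y)\<^sup>\<star> = ips y x"
  and ipt_star: "\<lbrakk>x \<in> X; y \<in> X\<rbrakk> \<Longrightarrow> (ipt x y)\<^sup>\<star> = ipt y x"
  by (rule biset(8,11)[symmetric]; assumption)+

lemma ipt_ra: "\<lbrakk>x \<in> X; y \<in> X\<rbrakk> \<Longrightarrow> ipt (ra x t) y = t\<^sup>\<star> * ipt x y"
  using biset(10)[of y x t] ipt_star[of y "ra x t"] ipt_star[of y x] biset(3) by (simp add: star_mult)

lemma ips_la: "\<lbrakk>x \<in> X; y \<in> X\<rbrakk> \<Longrightarrow> ips x (la s y) = ips x y * s\<^sup>\<star>"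
  using biset(7)[of y x s] ips_star[of "la s y" x] ips_star[of y x] biset(1) by (simp add: star_mult)

text \<open>Every \<open>s\<close> is a value \<open>\<langle>a, b\<rangle>\<close>, and \<open>\<langle>a, b\<rangle>x = a[b, x]\<close> turns the action of \<open>s\<close> into one of \<open>T\<close>.\<close>

lemma ipt_adjoint:
  assumes "x \<in> X" "y \<in> X" shows "ipt (la s x) y = ipt x (la (s\<^sup>\<star>) y)"
proof -
  obtain a b where ab: "a \<in> X" "b \<in> X" "ips a b = s" using biset(5) by blast
  then have ba: "ips b a = s\<^sup>\<star>" using ips_star[OF ab(1,2)] by simp
  have "la (s\<^sup>\<star>) y = ra b (ipt a y)" unfolding ba[symmetric] by (rule biset(13)[OF ab(2,1) assms(2)])
  moreover have "la s x = ra a (ipt b x)" unfolding ab(3)[symmetric] by (rule biset(13)[OF ab(1,2) assms(1)])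
  ultimately show ?thesis using ab(1,2) assms by (simp add: ipt_ra ipt_star biset(10))
qed

lemma ips_adjoint:
  assumes "x \<in> X" "y \<in> X" shows "ips (ra x t) y = ips x (ra y (t\<^sup>\<star>))"
proof -
  obtain a b where ab: "a \<in> X" "b \<in> X" "ipt a b = t" using biset(6) by blast
  then have ba: "ipt b a = t\<^sup>\<star>" using ipt_star[OF ab(1,2)] by simp
  have "ra y (t\<^sup>\<star>) = la (ips y b) a" unfolding ba[symmetric] by (rule biset(13)[OF assms(2) ab(2,1), symmetric])
  moreover have "ra x t = la (ips x a) b" unfolding ab(3)[symmetric] by (rule biset(13)[OF assms(1) ab(1,2), symmetric])
  ultimately show ?thesis using ab(1,2) assms by (simp add: ips_la ips_star biset(7))
qed

lemma idem_ips: "x \<in> X \<Longrightarrow> ips x x * ips x x = ips x x"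
  using biset(7)[of x x "ips x x"] biset(9) by simp

lemma idem_ipt: "x \<in> X \<Longrightarrow> ipt x x * ipt x x = ipt x x"
  using biset(10)[of x x "ipt x x"] biset(12) by simp

text \<open>For \<open>s\<close> in the column at \<open>\<langle>z, z\<rangle>\<close>, the next lemmas record that \<open>s \<mapsto> s z\<close> is inverted by
\<open>y \<mapsto> \<langle>y, z\<rangle>\<close>, and that \<open>s \<mapsto> [x, s z]\<close> maps the part of this column below \<open>\<langle>x, x\<rangle>\<close> into the
column of \<open>T\<close> at \<open>[z, z]\<close>, with \<open>q \<mapsto> x q\<close> recovering \<open>s z\<close>.\<close>

lemma ips_la_z:
  assumes z: "z \<in> X" and s: "s\<^sup>\<star> * s = ips z z" shows "ips (la s z) z = s"
  using z biset(7) s star_props(1)[of s] by (simp add: mult.assoc flip: s)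

lemma ra_ipt_la:
  assumes x: "x \<in> X" and z: "z \<in> X" shows "ra x (ipt x (la s z)) = la (ips x x * s) z"
  using biset(13)[OF x x biset(1)[OF z]] biset(2)[OF z] by simp

lemma ipt_la_idem:
  assumes x: "x \<in> X" and z: "z \<in> X" and s: "s\<^sup>\<star> * s = ips z z" and sx: "ips x x * s = s"
  shows "(ipt x (la s z))\<^sup>\<star> * ipt x (la s z) = ipt z z"
proof -
  have "(ipt x (la s z))\<^sup>\<star> * ipt x (la s z) = ipt (ra x (ipt x (la s z))) (la s z)"
    using ipt_ra x biset(1) z by simp
  also have "\<dots> = ipt (la s z) (la s z)" using ra_ipt_la[OF x z] sx by simp
  also have "\<dots> = ipt z (la (s\<^sup>\<star> * s) z)" using ipt_adjoint biset(1,2) z by simp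
  also have "\<dots> = ipt z z" using s biset(9) z by simp
  finally show ?thesis .
qed

text \<open>The counterpart of \<open>idem_conj_fix\<close> for translation by a point \<open>x\<close> of the biset, where \<open>\<langle>x f, x\<rangle>\<close>
takes the place of \<open>s f s\<^sup>\<star>\<close>.\<close>

lemma cut_by_idem:
  assumes x: "x \<in> X" and z: "z \<in> X" and s: "s\<^sup>\<star> * s = ips z z" and f: "f * f = f"
  shows "ips (ra x f) x * s = s \<longleftrightarrow> ips x x * s = s \<and> f * ipt x (la s z) = ipt x (la s z)"
proof -
  have szX: "la s z \<in> X" and xf: "ra x f \<in> X" using biset(1,3) x z by auto
  have la_eq: "la (ips (ra x f) x) (la s z) = ra (ra x f) (ipt x (la s z))"
    by (rule biset(13)[OF xf x szX])
  show ?thesis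
  proof
    assume "ips x x * s = s \<and> f * ipt x (la s z) = ipt x (la s z)"
    then have xx: "ips x x * s = s" and fq: "f * ipt x (la s z) = ipt x (la s z)" by auto
    have "la (ips (ra x f) x) (la s z) = la s z"
      unfolding la_eq biset(4)[OF x, symmetric] fq using ra_ipt_la[OF x z] xx by simp
    then have "ips (ra x f) x * ips (la s z) z = ips (la s z) z"
      using biset(7)[OF szX z, of "ips (ra x f) x"] by simp
    then show "ips (ra x f) x * s = s" unfolding ips_la_z[OF z s] .
  next
    assume cut: "ips (ra x f) x * s = s"
    have "la (ips x x) (ra x f) = ra x f"
      using biset(13)[OF x x xf] biset(10)[OF x x] biset(4)[OF x] biset(12)[OF x] by simp
    then have "ips x x * ips (ra x f) x = ips (ra x f) x"
      using biset(7)[OF xf x, of "ips x x"] by simp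
    then have xx: "ips x x * s = s" using cut by (metis mult.assoc)
    have recover: "ra (ra x f) (ipt x (la s z)) = la s z"
      using la_eq biset(2)[OF z, of "ips (ra x f) x" s] cut by simp
    have "ipt x (la s z) = ipt x (ra (ra x f) (ipt x (la s z)))" using recover by simp
    also have "\<dots> = ipt x x * f * ipt x (la s z)" using biset(10) x xf by simp
    finally have q: "ipt x (la s z) = ipt x x * f * ipt x (la s z)" .
    have "f * (ipt x x * f) = ipt x x * f"
      using idem_commute[OF f idem_ipt[OF x]] f by (metis mult.assoc)
    then have "f * ipt x (la s z) = ipt x (la s z)" using q by (metis mult.assoc)
    then show "ips x x * s = s \<and> f * ipt x (la s z) = ipt x (la s z)" using xx by blast
  qed
qed

end

text \<open>If \<open>f = \<langle>x, y\<rangle>\<close> is idempotent, then \<open>\<langle>x, x\<rangle>f = f\<close>, so \<open>\<langle>f x, f x\<rangle> = f\<langle>x, x\<rangle>f = f\<close>.\<close>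

lemma (in biset) every_idempotent_is_norm:
  "\<exists>z\<in>X. ips z z = s\<^sup>\<star> * s"
proof -
  let ?f = "s\<^sup>\<star> * s"
  obtain x y where xy: "x \<in> X" "y \<in> X" "ips x y = ?f" using biset(5) by blast
  have star_f: "?f\<^sup>\<star> = ?f" by (rule star_idem) simp
  have "ips x x * ?f = ?f" using biset(7)[OF xy(1,2), of "ips x x"] biset(9)[OF xy(1)] xy(3) by simp
  then have "ips (la ?f x) (la ?f x) = ?f * ?f"
    using xy(1) by (simp add: biset(1,7) ips_la star_f mult.assoc)
  then show ?thesis using biset(1)[OF xy(1)] idem_star_mult(1)[of s] by metis
qed

section \<open>The linking operators\<close>

text \<open>Translation by \<open>x\<close> maps \<open>t\<close> in the \<open>n\<close>-th column of \<open>T\<close> to \<open>\<langle>x t, \<zeta> n\<rangle>\<close>.  As for \<open>\<lambda>(s)\<close>, the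
operator on functions uses the inverse of this partial bijection, which is \<open>s \<mapsto> [x, s (\<zeta> n)]\<close>
on the \<open>s\<close> below \<open>\<langle>x, x\<rangle>\<close>.\<close>

definition link_fun ::
  "('s::inverse_semigroup \<Rightarrow> nat \<Rightarrow> 'w) \<Rightarrow> ('t \<Rightarrow> nat \<Rightarrow> 'w) \<Rightarrow> (nat \<Rightarrow> 'x) \<Rightarrow> ('s \<Rightarrow> 'x \<Rightarrow> 'x) \<Rightarrow>
    ('x \<Rightarrow> 'x \<Rightarrow> 's) \<Rightarrow> ('x \<Rightarrow> 'x \<Rightarrow> 't) \<Rightarrow> 'x \<Rightarrow> ('w \<Rightarrow> complex) \<Rightarrow> 'w \<Rightarrow> complex" where
  "link_fun \<kappa> \<mu> \<zeta> la ips ipt x \<eta> w = (case inv_into UNIV (case_prod \<kappa>) w of (s, n) \<Rightarrow>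
     if w = \<kappa> s n \<and> s\<^sup>\<star> * s = ips (\<zeta> n) (\<zeta> n) \<and> ips x x * s = s then \<eta> (\<mu> (ipt x (la s (\<zeta> n))) n) else 0)"

definition link where
  "link p \<kappa> \<mu> \<zeta> la ips ipt x = restrict (link_fun \<kappa> \<mu> \<zeta> la ips ipt x) (carrier (ell p))"

locale linked_biset = biset X la ra ips ipt
  for X :: "'x set" and la :: "'s::inverse_semigroup \<Rightarrow> 'x \<Rightarrow> 'x" and ra :: "'x \<Rightarrow> 't::inverse_semigroup \<Rightarrow> 'x"
    and ips ipt +
  fixes p :: real and \<kappa> :: "'s \<Rightarrow> nat \<Rightarrow> 'w" and \<mu> :: "'t \<Rightarrow> nat \<Rightarrow> 'w" and \<zeta> :: "nat \<Rightarrow> 'x"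
  assumes p: "1 \<le> p" and inj_\<kappa>: "inj (case_prod \<kappa>)" and inj_\<mu>: "inj (case_prod \<mu>)"
    and \<zeta>: "\<zeta> n \<in> X"
begin

sublocale src: amplified p \<kappa> "\<lambda>n. ips (\<zeta> n) (\<zeta> n)" by unfold_locales (fact p inj_\<kappa>)+
sublocale tgt: amplified p \<mu> "\<lambda>n. ipt (\<zeta> n) (\<zeta> n)" by unfold_locales (fact p inj_\<mu>)+

abbreviation "ampS \<equiv> amplification p \<kappa> (\<lambda>n. ips (\<zeta> n) (\<zeta> n))"
abbreviation "ampT \<equiv> amplification p \<mu> (\<lambda>n. ipt (\<zeta> n) (\<zeta> n))"
abbreviation "L \<equiv> link p \<kappa> \<mu> \<zeta> la ips ipt"
abbreviation "L' \<equiv> link p \<mu> \<kappa> \<zeta> (\<lambda>t x. ra x (t\<^sup>\<star>)) ipt ips"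
abbreviation E :: "(('w \<Rightarrow> complex) \<Rightarrow> ('w \<Rightarrow> complex)) cnormed" where "E \<equiv> ell_ops p"

lemma opposite: "linked_biset X (\<lambda>t x. ra x (t\<^sup>\<star>)) (\<lambda>x s. la (s\<^sup>\<star>) x) ipt ips p \<mu> \<kappa> \<zeta>"
  by unfold_locales (fact morita_biset_opposite[OF morita] p inj_\<kappa> inj_\<mu> \<zeta>)+

lemma link_\<kappa>: "\<eta> \<in> carrier (ell p) \<Longrightarrow> L x \<eta> (\<kappa> s n) =
    (if s\<^sup>\<star> * s = ips (\<zeta> n) (\<zeta> n) \<and> ips x x * s = s then \<eta> (\<mu> (ipt x (la s (\<zeta> n))) n) else 0)"
  by (simp add: link_def link_fun_def)

lemma link_off: "\<eta> \<in> carrier (ell p) \<Longrightarrow> (\<And>s n. w \<noteq> \<kappa> s n) \<Longrightarrow> L x \<eta> w = 0"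
  by (simp add: link_def link_fun_def split: prod.split)

lemma link_mem:
  assumes x: "x \<in> X" shows "L x \<in> carrier E"
proof -
  \<comment> \<open>A point \<open>s\<close> with \<open>\<langle>x, x\<rangle>s = s\<close> is recovered from \<open>q = [x, s z]\<close>, because \<open>x q = s z\<close>.\<close>
  define P where "P w \<longleftrightarrow> (\<exists>s n. w = \<kappa> s n \<and> s\<^sup>\<star> * s = ips (\<zeta> n) (\<zeta> n) \<and> ips x x * s = s)" for w
  define g where "g w = (case inv_into UNIV (case_prod \<kappa>) w of (s, n) \<Rightarrow> \<mu> (ipt x (la s (\<zeta> n))) n)" for w
  have "inj_on g {w. P w}"
  proof (rule inj_onI, clarsimp simp: P_def g_def)
    fix s s' n
    assume s: "s\<^sup>\<star> * s = ips (\<zeta> n) (\<zeta> n)" "ips x x * s = s"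
      and s': "s'\<^sup>\<star> * s' = ips (\<zeta> n) (\<zeta> n)" "ips x x * s' = s'"
      and eq: "ipt x (la s (\<zeta> n)) = ipt x (la s' (\<zeta> n))"
    have "la s (\<zeta> n) = la s' (\<zeta> n)"
      using ra_ipt_la[OF x \<zeta>, of s n] ra_ipt_la[OF x \<zeta>, of s' n] unfolding s(2) s'(2) eq by metis
    then have "ips (la s (\<zeta> n)) (\<zeta> n) = ips (la s' (\<zeta> n)) (\<zeta> n)" by (rule arg_cong)
    then show "s = s'" unfolding ips_la_z[OF \<zeta> s(1)] ips_la_z[OF \<zeta> s'(1)] .
  qed
  moreover have "link_fun \<kappa> \<mu> \<zeta> la ips ipt x = pull P g"
    by (auto simp: fun_eq_iff link_fun_def pull_def P_def g_def split: prod.split)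
  ultimately show ?thesis unfolding link_def using pull_operator[OF p] by metis
qed

lemma operator_eqI:
  assumes "S \<in> carrier E" "T \<in> carrier E"
    and "\<And>\<eta> s n. \<eta> \<in> carrier (ell p) \<Longrightarrow> S \<eta> (\<kappa> s n) = T \<eta> (\<kappa> s n)"
    and "\<And>\<eta> w. \<lbrakk>\<eta> \<in> carrier (ell p); \<And>s n. w \<noteq> \<kappa> s n\<rbrakk> \<Longrightarrow> S \<eta> w = T \<eta> w"
  shows "S = T"
  by (rule src.ell.BO_eqI) (use assms in \<open>auto intro!: ext\<close>, metis assms(3,4))

text \<open>The three product rules compare the action of both sides at a point \<open>\<kappa> u n\<close>: the domain conditions
agree by \<open>idem_conj_fix\<close> or \<open>cut_by_idem\<close>, the values by the adjoint relations of the biset.\<close>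

lemma ampS_link:
  assumes x: "x \<in> X" shows "ampS (reg p s) \<otimes>\<^bsub>E\<^esub> L x = L (la s x)"
proof (rule operator_eqI)
  note L = link_mem[OF x] and A = conjunct1[OF src.amp_mem[OF reg_mem[OF p]], of s]
  show "ampS (reg p s) \<otimes>\<^bsub>E\<^esub> L x \<in> carrier E" "L (la s x) \<in> carrier E"
    by (intro src.ell.BO_mult A L link_mem biset(1) x)+
  fix \<eta> :: "'w \<Rightarrow> complex" assume \<eta>: "\<eta> \<in> carrier (ell p)"
  note L\<eta> = src.ell.BO_linearD(1)[OF L \<eta>]
  show "(ampS (reg p s) \<otimes>\<^bsub>E\<^esub> L x) \<eta> w = L (la s x) \<eta> w" if "\<And>s n. w \<noteq> \<kappa> s n" for w
    using \<eta> that by (simp add: src.ell.BO_simps src.amp_off[OF L\<eta>] link_off)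
  fix u n
  have "ips (la s x) (la s x) = s * ips x x * s\<^sup>\<star>"
    using x biset(1,7) ips_la by (simp add: mult.assoc)
  then have "ips (la s x) (la s x) * u = u \<longleftrightarrow> s * s\<^sup>\<star> * u = u \<and> ips x x * (s\<^sup>\<star> * u) = s\<^sup>\<star> * u"
    using idem_conj_fix[OF idem_ips[OF x], of s u] by simp
  moreover have "ipt (la s x) (la u (\<zeta> n)) = ipt x (la (s\<^sup>\<star> * u) (\<zeta> n))"
    using ipt_adjoint[OF x biset(1)[OF \<zeta>]] biset(2)[OF \<zeta>] by simp
  ultimately show "(ampS (reg p s) \<otimes>\<^bsub>E\<^esub> L x) \<eta> (\<kappa> u n) = L (la s x) \<eta> (\<kappa> u n)"
    using \<eta> by (auto simp: src.ell.BO_simps src.amp_reg_\<kappa>[OF L\<eta>] link_\<kappa>[OF \<eta>] star_mult_fixed)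
qed

lemma link_ampT:
  assumes x: "x \<in> X" shows "L x \<otimes>\<^bsub>E\<^esub> ampT (reg p t) = L (ra x t)"
proof (rule operator_eqI)
  note L = link_mem[OF x] and A = conjunct1[OF tgt.amp_mem[OF reg_mem[OF p]], of t]
  show "L x \<otimes>\<^bsub>E\<^esub> ampT (reg p t) \<in> carrier E" "L (ra x t) \<in> carrier E"
    by (intro src.ell.BO_mult A L link_mem biset(3) x)+
  fix \<eta> :: "'w \<Rightarrow> complex" assume \<eta>: "\<eta> \<in> carrier (ell p)"
  note A\<eta> = src.ell.BO_linearD(1)[OF A \<eta>]
  show "(L x \<otimes>\<^bsub>E\<^esub> ampT (reg p t)) \<eta> w = L (ra x t) \<eta> w" if "\<And>s n. w \<noteq> \<kappa> s n" for w
    using \<eta> that by (simp add: src.ell.BO_simps link_off[OF A\<eta>] link_off)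
  fix s n
  have "ips (ra x t) (ra x t) = ips (ra x (t * t\<^sup>\<star>)) x"
    using ips_adjoint[OF biset(3)[OF x] x, of t "t\<^sup>\<star>"] biset(4)[OF x] by simp
  then have "s\<^sup>\<star> * s = ips (\<zeta> n) (\<zeta> n) \<Longrightarrow> ips (ra x t) (ra x t) * s = s \<longleftrightarrow>
      ips x x * s = s \<and> t * t\<^sup>\<star> * ipt x (la s (\<zeta> n)) = ipt x (la s (\<zeta> n))"
    using cut_by_idem[OF x \<zeta>, of s n "t * t\<^sup>\<star>"] by simp
  moreover have "ipt (ra x t) (la s (\<zeta> n)) = t\<^sup>\<star> * ipt x (la s (\<zeta> n))"
    using ipt_ra[OF x biset(1)[OF \<zeta>]] .
  ultimately show "(L x \<otimes>\<^bsub>E\<^esub> ampT (reg p t)) \<eta> (\<kappa> s n) = L (ra x t) \<eta> (\<kappa> s n)"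
    using \<eta> ipt_la_idem[OF x \<zeta>, of s n]
    by (auto simp: src.ell.BO_simps tgt.amp_reg_\<kappa>[OF \<eta>] link_\<kappa>[OF \<eta>] link_\<kappa>[OF A\<eta>])
qed

lemma link_link':
  assumes x: "x \<in> X" and y: "y \<in> X" shows "L x \<otimes>\<^bsub>E\<^esub> L' y = ampS (reg p (ips x y))"
proof (rule operator_eqI)
  interpret op: linked_biset X "\<lambda>t x. ra x (t\<^sup>\<star>)" "\<lambda>x s. la (s\<^sup>\<star>) x" ipt ips p \<mu> \<kappa> \<zeta>
    by (rule opposite)
  note L = link_mem[OF x] and L' = op.link_mem[OF y]
    and A = conjunct1[OF src.amp_mem[OF reg_mem[OF p]], of "ips x y"]
  show "L x \<otimes>\<^bsub>E\<^esub> L' y \<in> carrier E" "ampS (reg p (ips x y)) \<in> carrier E"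
    by (intro src.ell.BO_mult A L L')+
  fix \<eta> :: "'w \<Rightarrow> complex" assume \<eta>: "\<eta> \<in> carrier (ell p)"
  note L'\<eta> = src.ell.BO_linearD(1)[OF L' \<eta>]
  show "(L x \<otimes>\<^bsub>E\<^esub> L' y) \<eta> w = ampS (reg p (ips x y)) \<eta> w" if "\<And>s n. w \<noteq> \<kappa> s n" for w
    using \<eta> that by (simp add: src.ell.BO_simps link_off[OF L'\<eta>] src.amp_off[OF \<eta>])
  fix s n
  let ?q = "ipt x (la s (\<zeta> n))"
  have z: "la s (\<zeta> n) \<in> X" using biset(1) \<zeta> .
  have "ips x y * (ips x y)\<^sup>\<star> = ips (ra x (ipt y y)) x"
    using ips_star[OF x y] biset(7)[OF y x, of "ips x y"] biset(13)[OF x y y] by simp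
  then have c: "ips x y * (ips x y)\<^sup>\<star> * s = s \<longleftrightarrow> ips x x * s = s \<and> ipt y y * ?q = ?q"
    if "s\<^sup>\<star> * s = ips (\<zeta> n) (\<zeta> n)"
    using cut_by_idem[OF x \<zeta> that idem_ipt[OF y]] by simp
  have v: "ips y (ra (\<zeta> n) (?q\<^sup>\<star>)) = (ips x y)\<^sup>\<star> * s" if "s\<^sup>\<star> * s = ips (\<zeta> n) (\<zeta> n)"
  proof -
    have "ips y (ra (\<zeta> n) (?q\<^sup>\<star>)) = ips (ra y ?q) (\<zeta> n)" using ips_adjoint[OF y \<zeta>] by simp
    also have "\<dots> = ips (la (ips y x) (la s (\<zeta> n))) (\<zeta> n)" using biset(13)[OF y x z] by simp
    also have "\<dots> = ips y x * s" using biset(7)[OF z \<zeta>] ips_la_z[OF \<zeta> that] by simp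
    finally show ?thesis using ips_star[OF x y] by simp
  qed
  show "(L x \<otimes>\<^bsub>E\<^esub> L' y) \<eta> (\<kappa> s n) = ampS (reg p (ips x y)) \<eta> (\<kappa> s n)"
    using \<eta> c v ipt_la_idem[OF x \<zeta>, of s n]
    by (auto simp: src.ell.BO_simps src.amp_reg_\<kappa>[OF \<eta>] link_\<kappa>[OF L'\<eta>] op.link_\<kappa>[OF \<eta>])
qed

end

theorem corollary8p11:
  fixes p :: real
  assumes "countable (UNIV :: 's::inverse_semigroup set)"
    and "countable (UNIV :: 't::inverse_semigroup set)"
    and "strongly_morita_equivalent TYPE('x) TYPE('s) TYPE('t)"
    and "\<not> has_zero TYPE('s)" and "\<not> has_zero TYPE('t)"
    and "weak_semilattice TYPE('s)" and "weak_semilattice TYPE('t)"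
    and "1 \<le> p"
  shows "morita_equivalent TYPE(nat \<Rightarrow> complex) TYPE(nat \<Rightarrow> complex)
           (F_red TYPE('s) p) (F_red TYPE('t) p)"
proof -
  obtain X :: "'x set" and la :: "'s \<Rightarrow> 'x \<Rightarrow> 'x" and ra :: "'x \<Rightarrow> 't \<Rightarrow> 'x" and ips ipt
    where M: "morita_biset X la ra ips ipt"
    using assms(3) unfolding strongly_morita_equivalent_def by blast
  interpret biset X la ra ips ipt by unfold_locales (rule M)
  interpret opp: biset X "\<lambda>t x. ra x (t\<^sup>\<star>)" "\<lambda>x s. la (s\<^sup>\<star>) x" ipt ips
    by unfold_locales (rule morita_biset_opposite[OF M])
  obtain a where a: "\<And>s. a s \<in> X \<and> ips (a s) (a s) = s\<^sup>\<star> * s" using every_idempotent_is_norm by metis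
  obtain b where b: "\<And>t. b t \<in> X \<and> ipt (b t) (b t) = t\<^sup>\<star> * t" using opp.every_idempotent_is_norm by metis
  \<comment> \<open>The sequence has to meet every idempotent on either side, or columns would be lost.\<close>
  define \<zeta> where "\<zeta> = from_nat_into (range a \<union> range b)"
  have range_\<zeta>: "range \<zeta> = range a \<union> range b"
    unfolding \<zeta>_def using assms(1,2) by (intro range_from_nat_into) auto
  \<comment> \<open>The two halves of the index set are disjoint, so both algebras and both bimodules act on
    one space.\<close>
  define \<kappa> :: "'s \<Rightarrow> nat \<Rightarrow> ('s + 't) \<times> nat" where "\<kappa> s n = (Inl s, n)" for s n
  define \<mu> :: "'t \<Rightarrow> nat \<Rightarrow> ('s + 't) \<times> nat" where "\<mu> t n = (Inr t, n)" for t n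
  interpret linked_biset X la ra ips ipt p \<kappa> \<mu> \<zeta>
  proof unfold_locales
    show "\<zeta> n \<in> X" for n using range_\<zeta> a b by (metis UnE rangeE rangeI)
  qed (use assms(8) in \<open>auto simp: \<kappa>_def \<mu>_def inj_def\<close>)
  interpret op: linked_biset X "\<lambda>t x. ra x (t\<^sup>\<star>)" "\<lambda>x s. la (s\<^sup>\<star>) x" ipt ips p \<mu> \<kappa> \<zeta>
    by (rule opposite)
  have star_X: "(ipt x x)\<^sup>\<star> = ipt x x" "(ips x x)\<^sup>\<star> = ips x x" if "x \<in> X" for x
    using ips_star[OF that that] ipt_star[OF that that] by simp_all
  have L'L: "L' x \<otimes>\<^bsub>E\<^esub> L y = ampT (reg p (ipt x y))" if "x \<in> X" "y \<in> X" for x y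
    using op.link_link'[OF that] by simp
  have "countable (UNIV :: (('s + 't) \<times> nat) set)"
    using assms(1,2) by (simp add: UNIV_Plus_UNIV[symmetric] UNIV_Times_UNIV[symmetric] del: UNIV_Times_UNIV UNIV_Plus_UNIV)
  then obtain \<phi> :: "((('s + 't) \<times> nat \<Rightarrow> complex) \<Rightarrow> (('s + 't) \<times> nat \<Rightarrow> complex)) \<Rightarrow> nat \<Rightarrow> complex"
    where \<phi>: "inj_on \<phi> (carrier E)"
    using matrix_coefficients_inj[OF assms(8)] by metis
  have surj: "\<exists>n. ips (\<zeta> n) (\<zeta> n) = s\<^sup>\<star> * s" "\<exists>n. ipt (\<zeta> n) (\<zeta> n) = t\<^sup>\<star> * t" for s t
  proof -
    have "a s \<in> range \<zeta>" "b t \<in> range \<zeta>" unfolding range_\<zeta> by auto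
    then obtain m n where "\<zeta> m = a s" "\<zeta> n = b t" by (metis imageE)
    then show "\<exists>n. ips (\<zeta> n) (\<zeta> n) = s\<^sup>\<star> * s" "\<exists>n. ipt (\<zeta> n) (\<zeta> n) = t\<^sup>\<star> * t"
      using a[of s] b[of t] by metis+
  qed
  show ?thesis
  proof (rule morita_equivalent_of_embeddings[where E = E and i = ampS and j = ampT
        and U = "L' ` X" and V = "L ` X" and GA = "range (reg p)" and GB = "range (reg p)" and \<phi> = \<phi> and \<psi> = \<phi>])
    show "banach_algebra E" by (rule src.ell.banach_algebra_BO)
    show "banach_algebra (F_red TYPE('s) p)" "banach_algebra (F_red TYPE('t) p)"
      by (rule banach_algebra_F_red[OF assms(8)])+
    show "isometric_embedding (F_red TYPE('s) p) E ampS" by (rule src.amp_isometric[OF surj(1)])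
    show "isometric_embedding (F_red TYPE('t) p) E ampT" by (rule tgt.amp_isometric[OF surj(2)])
    show "generates (F_red TYPE('s) p) (range (reg p))" "generates (F_red TYPE('t) p) (range (reg p))"
      by (rule F_red_generated[OF assms(8)])+
    show "L' ` X \<subseteq> carrier E" "L ` X \<subseteq> carrier E" using link_mem op.link_mem by auto
    show "ampT b \<otimes>\<^bsub>E\<^esub> u \<in> L' ` X" if "b \<in> range (reg p)" "u \<in> L' ` X" for b u
      using that op.ampS_link biset(3) by force
    show "u \<otimes>\<^bsub>E\<^esub> ampS a \<in> L' ` X" if "a \<in> range (reg p)" "u \<in> L' ` X" for a u
      using that op.link_ampT biset(1) by force
    show "ampS a \<otimes>\<^bsub>E\<^esub> v \<in> L ` X" if "a \<in> range (reg p)" "v \<in> L ` X" for a v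
      using that ampS_link biset(1) by force
    show "v \<otimes>\<^bsub>E\<^esub> ampT b \<in> L ` X" if "b \<in> range (reg p)" "v \<in> L ` X" for b v
      using that link_ampT biset(3) by force
    show "u \<otimes>\<^bsub>E\<^esub> v \<in> ampT ` range (reg p)" if "u \<in> L' ` X" "v \<in> L ` X" for u v
      using that L'L by force
    show "v \<otimes>\<^bsub>E\<^esub> u \<in> ampS ` range (reg p)" if "u \<in> L' ` X" "v \<in> L ` X" for u v
      using that link_link' by force
    show "\<exists>u\<in>L' ` X. \<exists>v\<in>L ` X. u \<otimes>\<^bsub>E\<^esub> v = ampT b" if m: "b \<in> range (reg p)" for b
    proof -
      obtain t where t: "b = reg p t" using m by blast
      obtain x y where xy: "x \<in> X" "y \<in> X" "ipt x y = t" using biset(6) by blast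
      show ?thesis
        by (intro bexI[of _ "L' x"] bexI[of _ "L y"] imageI xy) (simp only: L'L[OF xy(1,2)] xy(3) t)
    qed
    show "\<exists>v\<in>L ` X. \<exists>u\<in>L' ` X. v \<otimes>\<^bsub>E\<^esub> u = ampS a" if m: "a \<in> range (reg p)" for a
    proof -
      obtain s where s: "a = reg p s" using m by blast
      obtain x y where xy: "x \<in> X" "y \<in> X" "ips x y = s" using biset(5) by blast
      show ?thesis
        by (intro bexI[of _ "L x"] bexI[of _ "L' y"] imageI xy) (simp only: link_link'[OF xy(1,2)] xy(3) s)
    qed
    show "\<exists>b\<in>range (reg p). \<exists>u'\<in>L' ` X. ampT b \<otimes>\<^bsub>E\<^esub> u' = u" if m: "u \<in> L' ` X" for u
    proof -
      obtain x where x: "x \<in> X" "u = L' x" using m by blast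
      show ?thesis
        by (intro bexI[of _ "reg p (ipt x x)"] bexI[of _ "L' x"] imageI rangeI x(1)) (simp only: x(2) op.ampS_link[OF x(1)] star_X[OF x(1)] biset(12)[OF x(1)])
    qed
    show "\<exists>u'\<in>L' ` X. \<exists>a\<in>range (reg p). u' \<otimes>\<^bsub>E\<^esub> ampS a = u" if m: "u \<in> L' ` X" for u
    proof -
      obtain x where x: "x \<in> X" "u = L' x" using m by blast
      show ?thesis
        by (intro bexI[of _ "L' x"] bexI[of _ "reg p (ips x x)"] imageI rangeI x(1)) (simp only: x(2) op.link_ampT[OF x(1)] star_X[OF x(1)] biset(9)[OF x(1)])
    qed
    show "\<exists>a\<in>range (reg p). \<exists>v'\<in>L ` X. ampS a \<otimes>\<^bsub>E\<^esub> v' = v" if m: "v \<in> L ` X" for v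
    proof -
      obtain x where x: "x \<in> X" "v = L x" using m by blast
      show ?thesis
        by (intro bexI[of _ "reg p (ips x x)"] bexI[of _ "L x"] imageI rangeI x(1)) (simp only: x(2) ampS_link[OF x(1)] biset(9)[OF x(1)])
    qed
    show "\<exists>v'\<in>L ` X. \<exists>b\<in>range (reg p). v' \<otimes>\<^bsub>E\<^esub> ampT b = v" if m: "v \<in> L ` X" for v
    proof -
      obtain x where x: "x \<in> X" "v = L x" using m by blast
      show ?thesis
        by (intro bexI[of _ "L x"] bexI[of _ "reg p (ipt x x)"] imageI rangeI x(1)) (simp only: x(2) link_ampT[OF x(1)] biset(12)[OF x(1)])
    qed
  qed (fact \<phi> src.amp_mult tgt.amp_mult)+
qed

end
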